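(* Let $P$ be a Lorentzian manifold of dimension $n$, let $m\in P$, and assume that some curvature tensor of $P$ (the Riemann tensor, a tensor obtained from it by contraction with the metric or trace-free projection such as the Ricci or Weyl tensor, or a covariant derivative of one of these) is of proper type II, III, or N at $m$. Then $P$ cannot be Wick-rotated, with respect to $m$, to a real Riemannian space (a manifold with positive definite metric).
   Context: A holomorphic Riemannian manifold $(M,g)$ is a complex manifold with a holomorphic symmetric non-degenerate $\mathbb C$-bilinear form $g$ on its holomorphic tangent bundle. A real slice of $(M,g)$ is a submanifold $N$ such that for every $y\in N$ the form $g$ is real valued and non-degenerate on the real subspace $T_yN\subset T_yM$; it is then pseudo-Riemannian. Two pseudo-Riemannian manifolds $P,Q$ are Wick-rotated with respect to $m$ if both are embedded as real slices of a common holomorphic Riemannian manifold $(M,g)$ and intersect at $m\in M$. Throughout, real dimensions of $P$ and $Q$ and the complex dimension of $M$ are equal. Lorentzian means signature $(-,+,\dots,+)$. Algebraic (boost-weight) classification. Let $T$ be a tensor (all indices lowered) over the Lorentzian space $T_mP$. For a real null frame $\{\ell,k,e_3,\dots,e_n\}$ (with $\ell,k$ null, $g(\ell,k)=1$, $e_i$ orthonormal and orthogonal to $\ell,k$), the boost $\ell\mapsto e^{s}\ell$, $k\mapsto e^{-s}k$, $e_i\mapsto e_i$ rescales each frame component of $T$ by $e^{bs}$ for an integer $b$, called its boost weight; write $T=\sum_b(T)_b$ for the resulting decomposition. $T$ is of type II if there is a null frame with $(T)_b=0$ for all $b>0$; of type D if there is a null frame with $(T)_b=0$ for all $b\ne0$;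 of type III if there is a null frame with $(T)_b=0$ for all $b\ge 0$; of type N if there is a null frame with $(T)_b=0$ for all $b\ge -1$; of type O if $T=0$. A type is called proper if no other choice of null frame puts $T$ in a simpler category; in particular a tensor of proper type II is not of type D, III, N or O, and a tensor of proper type III or N is nonzero. *)

theory Defs
  imports "HOL-Analysis.Analysis"
begin

section \<open>Smooth and holomorphic functions of several variables\<close>

text \<open>Both notions are meant for open sets \<open>S\<close>.\<close>

primrec continuously_differentiable_on ::
    "nat \<Rightarrow> 'a::real_normed_vector set \<Rightarrow> ('a \<Rightarrow> 'b::real_normed_vector) \<Rightarrow> bool" where
  "continuously_differentiable_on 0 S f \<longleftrightarrow> continuous_on S f"
| "continuously_differentiable_on (Suc k) S f \<longleftrightarrow>
     (\<forall>x\<in>S. f differentiable (at x)) \<and>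
     (\<forall>v. continuously_differentiable_on k S (\<lambda>x. frechet_derivative f (at x) v))"

definition smooth_on :: "'a::real_normed_vector set \<Rightarrow> ('a \<Rightarrow> 'b::real_normed_vector) \<Rightarrow> bool" where
  "smooth_on S f \<longleftrightarrow> (\<forall>k. continuously_differentiable_on k S f)"

text \<open>Holomorphic in several variables: Frechet differentiable with complex-linear derivative.\<close>

definition holomorphic_several_on :: "(complex^'n::finite) set \<Rightarrow> (complex^'n \<Rightarrow> complex) \<Rightarrow> bool" where
  "holomorphic_several_on S f \<longleftrightarrow>
     (\<forall>z\<in>S. \<exists>D. (f has_derivative D) (at z) \<and> (\<forall>c v. D (c *s v) = c * D v))"

section \<open>Manifolds with a metric\<close>

text \<open>A chart is a pair of an open domain and a coordinate map. The metric is given classically, by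
  its matrix of components in each chart as a function of the coordinates of that chart. The scalar
  type is \<open>real\<close> for pseudo-Riemannian and \<open>complex\<close> for holomorphic Riemannian manifolds, and the
  dimension over the scalars is the cardinality of the index type.\<close>

record ('a, 'k, 'n::finite) metric_manifold =
  points :: "'a topology"
  charts :: "('a set \<times> ('a \<Rightarrow> 'k^'n)) set"
  metric :: "('a set \<times> ('a \<Rightarrow> 'k^'n)) \<Rightarrow> 'k^'n \<Rightarrow> 'k^'n^'n"

definition bilin :: "'k::comm_ring_1^'n^'n \<Rightarrow> 'k^'n::finite \<Rightarrow> 'k^'n \<Rightarrow> 'k" where
  "bilin G u v = (\<Sum>i\<in>UNIV. \<Sum>j\<in>UNIV. G $ i $ j * u $ i * v $ j)"

definition is_chart :: "'a topology \<Rightarrow> 'a set \<times> ('a \<Rightarrow> 'k::real_normed_vector^'n::finite) \<Rightarrow> bool" where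
  "is_chart X c \<longleftrightarrow> openin X (fst c) \<and> open (snd c ` fst c) \<and>
     homeomorphic_map (subtopology X (fst c)) (top_of_set (snd c ` fst c)) (snd c)"

text \<open>Coordinate expression of \<open>f\<close> with respect to the chart \<open>c\<close> of the source and the chart \<open>d\<close> of
  the target, and the set of coordinates on which it makes sense. With \<open>f = id\<close> it is the change
  of coordinates from \<open>c\<close> to \<open>d\<close>.\<close>

definition chart_rep :: "'a set \<times> ('a \<Rightarrow> 'e) \<Rightarrow> 'b set \<times> ('b \<Rightarrow> 'f) \<Rightarrow> ('a \<Rightarrow> 'b) \<Rightarrow> 'e \<Rightarrow> 'f" where
  "chart_rep c d f = snd d \<circ> f \<circ> inv_into (fst c) (snd c)"

definition chart_rep_dom :: "'a set \<times> ('a \<Rightarrow> 'e) \<Rightarrow> 'b set \<times> ('b \<Rightarrow> 'f) \<Rightarrow> ('a \<Rightarrow> 'b) \<Rightarrow> 'e set" where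
  "chart_rep_dom c d f = snd c ` (fst c \<inter> f -` fst d)"

text \<open>The parameter \<open>reg\<close> is the regularity (smooth or holomorphic) demanded of changes of
  coordinates and of the metric components.\<close>

definition is_metric_manifold ::
    "(('k::real_normed_field^'n::finite) set \<Rightarrow> ('k^'n \<Rightarrow> 'k) \<Rightarrow> bool) \<Rightarrow>
     ('a, 'k, 'n) metric_manifold \<Rightarrow> bool" where
  "is_metric_manifold reg M \<longleftrightarrow>
     Hausdorff_space (points M) \<and> second_countable (points M) \<and>
     (\<forall>c\<in>charts M. is_chart (points M) c) \<and>
     (\<Union>c\<in>charts M. fst c) = topspace (points M) \<and>
     (\<forall>c\<in>charts M. \<forall>d\<in>charts M. \<forall>i. reg (chart_rep_dom c d id) (\<lambda>x. chart_rep c d id x $ i)) \<and>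
     (\<forall>c\<in>charts M. \<forall>i j. reg (snd c ` fst c) (\<lambda>x. metric M c x $ i $ j)) \<and>
     (\<forall>c\<in>charts M. \<forall>x\<in>snd c ` fst c.
        (\<forall>u v. bilin (metric M c x) u v = bilin (metric M c x) v u) \<and>
        (\<forall>u. (\<forall>v. bilin (metric M c x) u v = 0) \<longrightarrow> u = 0)) \<and>
     (\<forall>c\<in>charts M. \<forall>d\<in>charts M. \<forall>x\<in>chart_rep_dom c d id.
        let J = frechet_derivative (chart_rep c d id) (at x)
        in \<forall>u v. bilin (metric M c x) u v = bilin (metric M d (chart_rep c d id x)) (J u) (J v))"

definition pseudo_riemannian :: "('a, real, 'n::finite) metric_manifold \<Rightarrow> bool" where
  "pseudo_riemannian N \<longleftrightarrow> is_metric_manifold smooth_on N"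

definition holomorphic_riemannian :: "('a, complex, 'n::finite) metric_manifold \<Rightarrow> bool" where
  "holomorphic_riemannian M \<longleftrightarrow> is_metric_manifold holomorphic_several_on M"

definition lorentzian_form :: "real^'n^'n::finite \<Rightarrow> bool" where
  "lorentzian_form G \<longleftrightarrow> (\<exists>(F :: 'n \<Rightarrow> real^'n) t. \<forall>i j.
     bilin G (F i) (F j) = (if i \<noteq> j then 0 else if i = t then - 1 else 1))"

definition lorentzian :: "('a, real, 'n::finite) metric_manifold \<Rightarrow> bool" where
  "lorentzian N \<longleftrightarrow> pseudo_riemannian N \<and>
     (\<forall>c\<in>charts N. \<forall>x\<in>snd c ` fst c. lorentzian_form (metric N c x))"

definition riemannian :: "('a, real, 'n::finite) metric_manifold \<Rightarrow> bool" where
  "riemannian N \<longleftrightarrow> pseudo_riemannian N \<and>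
     (\<forall>c\<in>charts N. \<forall>x\<in>snd c ` fst c. \<forall>u. u \<noteq> 0 \<longrightarrow> bilin (metric N c x) u u > 0)"

section \<open>Real slices and Wick rotation\<close>

definition smooth_embedding ::
    "('a, real, 'n::finite) metric_manifold \<Rightarrow> ('b, complex, 'n) metric_manifold \<Rightarrow> ('a \<Rightarrow> 'b) \<Rightarrow> bool" where
  "smooth_embedding N M f \<longleftrightarrow>
     embedding_map (points N) (points M) f \<and>
     (\<forall>c\<in>charts N. \<forall>d\<in>charts M.
        smooth_on (chart_rep_dom c d f) (chart_rep c d f) \<and>
        (\<forall>x\<in>chart_rep_dom c d f. inj (frechet_derivative (chart_rep c d f) (at x))))"

text \<open>\<open>N\<close> is embedded by \<open>f\<close> as a real slice of \<open>M\<close>, its metric being the one induced from \<open>M\<close>.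
  In the charts \<open>c\<close> and \<open>d\<close>, the tangent space of the image is \<open>range D\<close>.\<close>

definition real_slice ::
    "('a, real, 'n::finite) metric_manifold \<Rightarrow> ('b, complex, 'n) metric_manifold \<Rightarrow> ('a \<Rightarrow> 'b) \<Rightarrow> bool" where
  "real_slice N M f \<longleftrightarrow>
     smooth_embedding N M f \<and>
     (\<forall>c\<in>charts N. \<forall>d\<in>charts M. \<forall>x\<in>chart_rep_dom c d f.
        let D = frechet_derivative (chart_rep c d f) (at x);
            g = bilin (metric M d (chart_rep c d f x))
        in (\<forall>v\<in>range D. \<forall>w\<in>range D. g v w \<in> \<real>) \<and>
           (\<forall>v\<in>range D. (\<forall>w\<in>range D. g v w = 0) \<longrightarrow> v = 0) \<and>
           (\<forall>u v. g (D u) (D v) = of_real (bilin (metric N c x) u v)))"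

text \<open>\<open>P\<close> and \<open>Q\<close> are Wick-rotated inside \<open>M\<close> with respect to the image of the point \<open>m\<close> of \<open>P\<close>.\<close>

definition wick_rotated ::
    "('b, complex, 'n::finite) metric_manifold \<Rightarrow> ('a, real, 'n) metric_manifold \<Rightarrow> 'a \<Rightarrow>
     ('c, real, 'n) metric_manifold \<Rightarrow> bool" where
  "wick_rotated M P m Q \<longleftrightarrow>
     holomorphic_riemannian M \<and> pseudo_riemannian P \<and> pseudo_riemannian Q \<and>
     m \<in> topspace (points P) \<and>
     (\<exists>f h. real_slice P M f \<and> real_slice Q M h \<and> f m \<in> h ` topspace (points Q))"

section \<open>Curvature tensors\<close>

text \<open>A covariant tensor of rank \<open>r\<close> is given by its components \<open>T [i\<^sub>1, \<dots>, i\<^sub>r]\<close>; values of \<open>T\<close> on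
  lists of other lengths are irrelevant. A tensor field in a chart is a function of the coordinates.
  Positions of indices are counted from \<open>0\<close>.\<close>

definition partial_deriv :: "'n::finite \<Rightarrow> ('k::real_normed_field^'n \<Rightarrow> 'k) \<Rightarrow> 'k^'n \<Rightarrow> 'k" where
  "partial_deriv i f x = frechet_derivative f (at x) (axis i 1)"

text \<open>The Christoffel symbol with upper index \<open>k\<close> and lower indices \<open>i\<close>, \<open>j\<close>.\<close>

definition christoffel ::
    "('k::real_normed_field^'n \<Rightarrow> 'k^'n^'n) \<Rightarrow> 'n::finite \<Rightarrow> 'n \<Rightarrow> 'n \<Rightarrow> 'k^'n \<Rightarrow> 'k" where
  "christoffel G k i j x = (\<Sum>l\<in>UNIV. matrix_inv (G x) $ k $ l *
     (partial_deriv i (\<lambda>y. G y $ j $ l) x + partial_deriv j (\<lambda>y. G y $ i $ l) x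
      - partial_deriv l (\<lambda>y. G y $ i $ j) x) / 2)"

text \<open>The component with upper index \<open>l\<close> is \<open>dx\<^sup>l (R(\<partial>\<^sub>i, \<partial>\<^sub>j) \<partial>\<^sub>k)\<close>.\<close>

definition riemann_up ::
    "('k::real_normed_field^'n \<Rightarrow> 'k^'n^'n) \<Rightarrow> 'n::finite \<Rightarrow> 'n \<Rightarrow> 'n \<Rightarrow> 'n \<Rightarrow> 'k^'n \<Rightarrow> 'k" where
  "riemann_up G l k i j x =
     partial_deriv i (christoffel G l j k) x - partial_deriv j (christoffel G l i k) x
     + (\<Sum>m\<in>UNIV. christoffel G l i m x * christoffel G m j k x
                 - christoffel G l j m x * christoffel G m i k x)"

definition riemann :: "('k::real_normed_field^'n \<Rightarrow> 'k^'n^'n) \<Rightarrow> 'k^'n \<Rightarrow> 'n::finite list \<Rightarrow> 'k" where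
  "riemann G x js = (\<Sum>l\<in>UNIV. G x $ (js ! 0) $ l * riemann_up G l (js ! 1) (js ! 2) (js ! 3) x)"

definition insert_index :: "nat \<Rightarrow> 'i \<Rightarrow> 'i list \<Rightarrow> 'i list" where
  "insert_index p a js = take p js @ a # drop p js"

definition delete_index :: "nat \<Rightarrow> 'i list \<Rightarrow> 'i list" where
  "delete_index p js = take p js @ drop (Suc p) js"

text \<open>Metric contraction of the indices at positions \<open>p < q\<close>.\<close>

definition contract ::
    "'k::real_normed_field^'n^'n \<Rightarrow> nat \<Rightarrow> nat \<Rightarrow> ('n::finite list \<Rightarrow> 'k) \<Rightarrow> 'n list \<Rightarrow> 'k" where
  "contract G p q T js = (\<Sum>a\<in>UNIV. \<Sum>b\<in>UNIV.
     matrix_inv G $ a $ b * T (insert_index q b (insert_index p a js)))"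

text \<open>\<open>W\<close> is the totally trace-free part of the rank \<open>r\<close> tensor \<open>T\<close>: all its metric traces vanish,
  and \<open>T - W\<close> is a sum of products of the metric with tensors of rank \<open>r - 2\<close>. These two
  spaces of tensors are complementary, so \<open>W\<close> is determined by \<open>T\<close>. For the Riemann tensor this
  is the Weyl tensor, for the Ricci tensor the trace-free Ricci tensor.\<close>

definition trace_free_projection ::
    "'k::real_normed_field^'n^'n \<Rightarrow> nat \<Rightarrow> ('n::finite list \<Rightarrow> 'k) \<Rightarrow> ('n list \<Rightarrow> 'k) \<Rightarrow> bool" where
  "trace_free_projection G r T W \<longleftrightarrow>
     (\<forall>p q js. p < q \<longrightarrow> q < r \<longrightarrow> length js = r - 2 \<longrightarrow> contract G p q W js = 0) \<and>
     (\<exists>S. \<forall>js. length js = r \<longrightarrow>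
        T js - W js = (\<Sum>q<r. \<Sum>p<q. G $ (js ! p) $ (js ! q) * S p q (delete_index p (delete_index q js))))"

text \<open>The differentiation index comes first.\<close>

definition cov_deriv ::
    "('k::real_normed_field^'n \<Rightarrow> 'k^'n^'n) \<Rightarrow> ('k^'n \<Rightarrow> 'n::finite list \<Rightarrow> 'k) \<Rightarrow> 'k^'n \<Rightarrow> 'n list \<Rightarrow> 'k" where
  "cov_deriv G T x js =
     partial_deriv (hd js) (\<lambda>y. T y (tl js)) x
     - (\<Sum>p<length (tl js). \<Sum>c\<in>UNIV. christoffel G c (hd js) (tl js ! p) x * T x ((tl js)[p := c]))"

text \<open>The curvature tensor fields (with their ranks) of the metric \<open>G\<close> on the open set \<open>U\<close> of
  coordinate space: first those obtained from the Riemann tensor by contractions and trace-free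
  projections, then covariant derivatives of these of any order.\<close>

inductive algebraic_curvature_tensor ::
    "('k::real_normed_field^'n::finite) set \<Rightarrow> ('k^'n \<Rightarrow> 'k^'n^'n) \<Rightarrow> nat \<Rightarrow> ('k^'n \<Rightarrow> 'n list \<Rightarrow> 'k) \<Rightarrow> bool"
  for U G where
  riemann: "algebraic_curvature_tensor U G 4 (riemann G)"
| contraction: "algebraic_curvature_tensor U G (r + 2) T \<Longrightarrow> p < q \<Longrightarrow> q < r + 2 \<Longrightarrow>
    algebraic_curvature_tensor U G r (\<lambda>x. contract (G x) p q (T x))"
| trace_free: "algebraic_curvature_tensor U G r T \<Longrightarrow>
    (\<And>x. x \<in> U \<Longrightarrow> trace_free_projection (G x) r (T x) (W x)) \<Longrightarrow>
    algebraic_curvature_tensor U G r W"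

inductive curvature_tensor ::
    "('k::real_normed_field^'n::finite) set \<Rightarrow> ('k^'n \<Rightarrow> 'k^'n^'n) \<Rightarrow> nat \<Rightarrow> ('k^'n \<Rightarrow> 'n list \<Rightarrow> 'k) \<Rightarrow> bool"
  for U G where
  algebraic: "algebraic_curvature_tensor U G r T \<Longrightarrow> curvature_tensor U G r T"
| derivative: "curvature_tensor U G r T \<Longrightarrow> curvature_tensor U G (Suc r) (cov_deriv G T)"

section \<open>Boost-weight classification\<close>

text \<open>A null frame is a frame \<open>F\<close> together with the two distinct indices \<open>a\<close>, \<open>b\<close> of its null vectors
  \<open>\<ell> = F a\<close> and \<open>k = F b\<close>.\<close>

definition null_frame :: "real^'n^'n \<Rightarrow> ('n::finite \<Rightarrow> real^'n) \<Rightarrow> 'n \<Rightarrow> 'n \<Rightarrow> bool" where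
  "null_frame G F a b \<longleftrightarrow> a \<noteq> b \<and>
     bilin G (F a) (F a) = 0 \<and> bilin G (F b) (F b) = 0 \<and> bilin G (F a) (F b) = 1 \<and>
     (\<forall>i. i \<notin> {a, b} \<longrightarrow> bilin G (F a) (F i) = 0 \<and> bilin G (F b) (F i) = 0) \<and>
     (\<forall>i j. i \<notin> {a, b} \<longrightarrow> j \<notin> {a, b} \<longrightarrow> bilin G (F i) (F j) = (if i = j then 1 else 0))"

text \<open>The component \<open>T(F\<^sub>i\<^sub>1, \<dots>, F\<^sub>i\<^sub>r)\<close>, where \<open>r\<close> is the length of \<open>js\<close>.\<close>

definition frame_component :: "('n::finite \<Rightarrow> real^'n) \<Rightarrow> ('n list \<Rightarrow> real) \<Rightarrow> 'n list \<Rightarrow> real" where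
  "frame_component F T js =
     (\<Sum>ks\<in>{ks. length ks = length js}. T ks * (\<Prod>p<length js. F (js ! p) $ (ks ! p)))"

definition boost :: "real \<Rightarrow> 'n \<Rightarrow> 'n \<Rightarrow> ('n::finite \<Rightarrow> real^'n) \<Rightarrow> 'n \<Rightarrow> real^'n" where
  "boost s a b F = F(a := exp s *\<^sub>R F a, b := exp (- s) *\<^sub>R F b)"

definition boost_weight :: "'n \<Rightarrow> 'n \<Rightarrow> 'n list \<Rightarrow> int" where
  "boost_weight a b js = int (count_list js a) - int (count_list js b)"

lemma frame_component_boost:
  assumes "a \<noteq> b"
  shows "frame_component (boost s a b F) T js =
    exp (of_int (boost_weight a b js) * s) * frame_component F T js"
proof -
  define c where "c = (\<lambda>i. if i = a then exp s else if i = b then exp (- s) else (1::real))"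
  have boost: "boost s a b F i = c i *\<^sub>R F i" for i
    using assms by (auto simp: boost_def c_def)
  have "(\<Prod>p<length js. c (js ! p)) = prod_list (map c js)"
    by (induction js) (simp_all add: prod.lessThan_Suc_shift del: prod.lessThan_Suc)
  also have "\<dots> = exp (of_int (boost_weight a b js) * s)"
    using assms by (induction js)
      (auto simp: c_def boost_weight_def algebra_simps simp flip: exp_add)
  finally have c: "(\<Prod>p<length js. c (js ! p)) = exp (of_int (boost_weight a b js) * s)" .
  show ?thesis
    by (simp add: frame_component_def boost prod.distrib c sum_distrib_left mult_ac)
qed

text \<open>\<open>(T)\<^sub>w = 0\<close> for the tensor \<open>T\<close> of rank \<open>r\<close>.\<close>

definition boost_part_zero ::
    "('n::finite \<Rightarrow> real^'n) \<Rightarrow> 'n \<Rightarrow> 'n \<Rightarrow> nat \<Rightarrow> ('n list \<Rightarrow> real) \<Rightarrow> int \<Rightarrow> bool" where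
  "boost_part_zero F a b r T w \<longleftrightarrow>
     (\<forall>js. length js = r \<longrightarrow> boost_weight a b js = w \<longrightarrow> frame_component F T js = 0)"

definition type_II :: "real^'n^'n \<Rightarrow> nat \<Rightarrow> ('n::finite list \<Rightarrow> real) \<Rightarrow> bool" where
  "type_II G r T \<longleftrightarrow> (\<exists>F a b. null_frame G F a b \<and> (\<forall>w>0. boost_part_zero F a b r T w))"

definition type_D :: "real^'n^'n \<Rightarrow> nat \<Rightarrow> ('n::finite list \<Rightarrow> real) \<Rightarrow> bool" where
  "type_D G r T \<longleftrightarrow> (\<exists>F a b. null_frame G F a b \<and> (\<forall>w. w \<noteq> 0 \<longrightarrow> boost_part_zero F a b r T w))"

definition type_III :: "real^'n^'n \<Rightarrow> nat \<Rightarrow> ('n::finite list \<Rightarrow> real) \<Rightarrow> bool" where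
  "type_III G r T \<longleftrightarrow> (\<exists>F a b. null_frame G F a b \<and> (\<forall>w\<ge>0. boost_part_zero F a b r T w))"

definition type_N :: "real^'n^'n \<Rightarrow> nat \<Rightarrow> ('n::finite list \<Rightarrow> real) \<Rightarrow> bool" where
  "type_N G r T \<longleftrightarrow> (\<exists>F a b. null_frame G F a b \<and> (\<forall>w\<ge>-1. boost_part_zero F a b r T w))"

definition type_O :: "nat \<Rightarrow> ('n list \<Rightarrow> real) \<Rightarrow> bool" where
  "type_O r T \<longleftrightarrow> (\<forall>js. length js = r \<longrightarrow> T js = 0)"

definition proper_type_II :: "real^'n^'n \<Rightarrow> nat \<Rightarrow> ('n::finite list \<Rightarrow> real) \<Rightarrow> bool" where
  "proper_type_II G r T \<longleftrightarrow>
     type_II G r T \<and> \<not> type_D G r T \<and> \<not> type_III G r T \<and> \<not> type_N G r T \<and> \<not> type_O r T"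

definition proper_type_III :: "real^'n^'n \<Rightarrow> nat \<Rightarrow> ('n::finite list \<Rightarrow> real) \<Rightarrow> bool" where
  "proper_type_III G r T \<longleftrightarrow> type_III G r T \<and> \<not> type_N G r T \<and> \<not> type_O r T"

definition proper_type_N :: "real^'n^'n \<Rightarrow> nat \<Rightarrow> ('n::finite list \<Rightarrow> real) \<Rightarrow> bool" where
  "proper_type_N G r T \<longleftrightarrow> type_N G r T \<and> \<not> type_O r T"

text \<open>Some curvature tensor of \<open>N\<close>, expressed in a chart around \<open>m\<close>, satisfies \<open>\<Phi>\<close> at \<open>m\<close>.
  For the tensorial properties above the choice of chart is immaterial.\<close>

definition some_curvature_tensor_at ::
    "('a, real, 'n::finite) metric_manifold \<Rightarrow> 'a \<Rightarrow>
     (real^'n^'n \<Rightarrow> nat \<Rightarrow> ('n list \<Rightarrow> real) \<Rightarrow> bool) \<Rightarrow> bool" where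
  "some_curvature_tensor_at N m \<Phi> \<longleftrightarrow>
     (\<exists>c\<in>charts N. m \<in> fst c \<and>
        (\<exists>r T. curvature_tensor (snd c ` fst c) (metric N c) r T \<and>
           \<Phi> (metric N c (snd c m)) r (T (snd c m))))"

end

(* Every curvature tensor of a real slice is the pull-back, along the tangent map of the slice, of
   the complex tensor that the same recipe yields for the ambient holomorphic metric. Hence a single
   complex tensor T at the common point is real on both real forms T_mP and T_mQ of the tangent space,
   and it is preserved, as is g, by the conjugation tau with respect to T_mQ. As g is positive definite
   on T_mQ, a null direction l of T_mP satisfies g(l, tau l) > 0, so l and tau l span a hyperbolic plane.
   If T has weights at most w0 <= 0 along l, then also along tau l; but passing from l to tau l reverses
   the sign of weights. So T = 0 in types III and N, while in type II only weight 0 survives: T is then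
   invariant under the complex boosts of the planes spanned by l and tau l, and by l and the complex
   conjugate of tau l, and a product of two of them takes tau l to a real vector, which shows type D. *)

theory Submission
  imports Defs "HOL-Complex_Analysis.Cauchy_Integral_Formula"
begin

section \<open>Multilinear evaluation of tensors\<close>

text \<open>The slices are merely smooth and curvature involves derivatives of the metric, so
  comparing tangent data at the common point alone would not be enough. The link is the equality of
  the real dimension of a slice with the complex dimension of the ambient manifold: an invertible
  Gram matrix makes the tangent vectors of a slice a complex frame, no normal directions remain, and
  covariant derivatives of every order pull back along the slice as long as the ambient tensor is
  holomorphic. The obstacle is the trace-free projection, which is only a relation between tensors.
  It is replaced by a polynomial in one operator built from the metric and its inverse. The
  coefficients depend on rank and dimension alone, so one recipe makes sense for P, M and Q; for P
  it agrees with the projection, for M and Q it is simply an operation. The inequality g(l, \<tau>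
  l) > 0 comes from writing l = x + i y with x, y in T_mQ, which gives g(x, x) + g(y, y).\<close>

primrec teval :: "('k::comm_ring_1^'n::finite) list \<Rightarrow> ('n list \<Rightarrow> 'k) \<Rightarrow> 'k" where
  "teval [] T = T []"
| "teval (v # vs) T = (\<Sum>i\<in>UNIV. v $ i * teval vs (\<lambda>ks. T (i # ks)))"

lemma teval_cong:
  "(\<And>ks. length ks = length vs \<Longrightarrow> T ks = T' ks) \<Longrightarrow> teval vs T = teval vs T'"
proof (induction vs arbitrary: T T')
  case (Cons v vs)
  have "teval vs (\<lambda>ks. T (i # ks)) = teval vs (\<lambda>ks. T' (i # ks))" for i
    by (rule Cons.IH) (simp add: Cons.prems)
  then show ?case by simp
qed simp

lemma teval_add: "teval vs (\<lambda>ks. T ks + T' ks) = teval vs T + teval vs T'"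
  by (induction vs arbitrary: T T') (simp_all add: sum.distrib algebra_simps)

lemma teval_mult: "teval vs (\<lambda>ks. c * T ks) = c * teval vs T"
  by (induction vs arbitrary: T) (simp_all add: sum_distrib_left mult_ac)

lemma teval_zero [simp]: "teval vs (\<lambda>ks. 0) = 0"
  by (induction vs) simp_all

lemma teval_diff: "teval vs (\<lambda>ks. T ks - T' ks) = teval vs T - teval vs T'"
  using teval_add[of vs T "\<lambda>ks. (-1) * T' ks"] teval_mult[of vs "-1" T'] by simp

lemma teval_sum: "teval vs (\<lambda>ks. \<Sum>i\<in>A. T i ks) = (\<Sum>i\<in>A. teval vs (T i))"
  by (induction A rule: infinite_finite_induct) (simp_all add: teval_add)

text \<open>Expanding a single argument in the standard basis is the source of all statements about
  linearity in one slot.\<close>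

lemma teval_slot:
  "teval (us @ v # vs) T = (\<Sum>i\<in>UNIV. v $ i * teval (us @ axis i 1 # vs) T)"
proof (induction us arbitrary: T)
  case Nil
  have "(\<Sum>k\<in>UNIV. axis i 1 $ k * f k) = (f i :: 'a)" for i :: 'b and f
    by (subst sum.remove[of _ i]) (auto simp: axis_def intro!: sum.neutral)
  then show ?case by simp
next
  case (Cons u us)
  show ?case
    by (simp add: sum_distrib_left, subst Cons, subst sum.swap)
       (simp add: sum_distrib_left mult_ac)
qed

lemma teval_slot_add: "teval (us @ (v + w) # vs) T = teval (us @ v # vs) T + teval (us @ w # vs) T"
  by (subst (1 2 3) teval_slot) (simp add: algebra_simps sum.distrib)

lemma teval_slot_scale: "teval (us @ (c *s v) # vs) T = c * teval (us @ v # vs) T"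
  by (subst (1 2) teval_slot) (simp add: sum_distrib_left mult_ac)

lemma teval_slot_zero: "teval (us @ 0 # vs) T = 0"
  by (subst teval_slot) simp

lemma teval_slot_sum:
  "teval (us @ (\<Sum>i\<in>A. f i) # vs) T = (\<Sum>i\<in>A. teval (us @ f i # vs) T)"
  by (induction A rule: infinite_finite_induct) (simp_all add: teval_slot_zero teval_slot_add)

lemma teval_axis [simp]: "teval (map (\<lambda>i. axis i 1) js) T = T js"
proof (induction js arbitrary: T)
  case (Cons j js)
  show ?case
    by (simp add: Cons, subst sum.remove[of _ j]) (auto simp: axis_def intro!: sum.neutral)
qed simp

lemma lists_length_Suc: "{ks. length ks = Suc n} = (\<lambda>(i, ks). i # ks) ` (UNIV \<times> {ks. length ks = n})"
  by (auto simp: length_Suc_conv image_iff)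

lemma sum_lists_Suc:
  "(\<Sum>ks\<in>{ks :: 'n::finite list. length ks = Suc n}. f ks)
    = (\<Sum>i\<in>UNIV. \<Sum>ks\<in>{ks. length ks = n}. f (i # ks))"
  unfolding lists_length_Suc
  by (subst sum.reindex) (auto simp: inj_on_def sum.cartesian_product case_prod_unfold)

text \<open>The bridge to \<open>frame_component\<close>, which sums over all index lists at once.
  The recursive form is the working one, because arguments can be treated slot by slot in
  it.\<close>

lemma teval_eq_sum:
  "teval vs T = (\<Sum>ks\<in>{ks. length ks = length vs}. T ks * (\<Prod>p<length vs. vs ! p $ (ks ! p)))"
proof (induction vs arbitrary: T)
  case (Cons v vs)
  show ?case
    by (simp add: Cons sum_lists_Suc sum_distrib_left prod.lessThan_Suc_shift mult_ac
        del: prod.lessThan_Suc)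
qed simp

lemma frame_component_eq_teval: "frame_component F T js = teval (map F js) T"
  by (simp add: frame_component_def teval_eq_sum)

text \<open>The pull-back of a tensor along the linear map that sends the \<open>i\<close>-th basis
  vector to \<open>J i\<close>. It plays two roles: \<open>J\<close> is a change of frame, or the
  tangent map of a slice. The linear map itself is \<open>frame_comb J\<close>.\<close>

definition pull :: "('n::finite \<Rightarrow> 'k::comm_ring_1^'n) \<Rightarrow> ('n list \<Rightarrow> 'k) \<Rightarrow> 'n list \<Rightarrow> 'k" where
  "pull J T js = teval (map J js) T"

definition frame_comb :: "('n::finite \<Rightarrow> 'k::comm_ring_1^'n) \<Rightarrow> 'k^'n \<Rightarrow> 'k^'n" where
  "frame_comb J v = (\<Sum>i\<in>UNIV. v $ i *s J i)"

lemma frame_comb_scale: "frame_comb J (c *s v) = c *s frame_comb J v"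
  by (simp add: frame_comb_def vec_eq_iff sum_distrib_left mult_ac)

lemma teval_pull: "teval vs (pull J T) = teval (map (frame_comb J) vs) T"
proof (induction vs arbitrary: T)
  case (Cons v vs)
  have *: "(\<lambda>ks. pull J T (i # ks)) = (\<lambda>ks. \<Sum>j\<in>UNIV. J i $ j * pull J (\<lambda>ks. T (j # ks)) ks)" for i
    by (simp add: pull_def)
  have "teval (v # vs) (pull J T) = (\<Sum>i\<in>UNIV. v $ i * (\<Sum>j\<in>UNIV. J i $ j *
      teval (map (frame_comb J) vs) (\<lambda>ks. T (j # ks))))"
    by (simp add: * teval_sum teval_mult Cons)
  also have "\<dots> = (\<Sum>j\<in>UNIV. frame_comb J v $ j * teval (map (frame_comb J) vs) (\<lambda>ks. T (j # ks)))"
    by (simp add: frame_comb_def sum_distrib_left sum_distrib_right, subst sum.swap) (simp add: mult_ac)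
  finally show ?case by simp
qed (simp add: pull_def)

text \<open>Contractions insert indices at arbitrary positions, whereas the recursion consumes
  arguments from the left; here an inserted argument is absorbed into the tensor first.\<close>

lemma teval_insert:
  "p \<le> length vs \<Longrightarrow> teval (insert_index p v vs) T
     = teval vs (\<lambda>ks. \<Sum>i\<in>UNIV. v $ i * T (insert_index p i ks))"
proof (induction p arbitrary: vs T)
  case 0
  then show ?case by (simp add: insert_index_def teval_sum teval_mult)
next
  case (Suc p)
  then obtain w ws where vs: "vs = w # ws" and p: "p \<le> length ws" by (cases vs) auto
  have "insert_index (Suc p) v vs = w # insert_index p v ws" by (simp add: insert_index_def vs)
  then show ?case
    by (simp add: Suc.IH[OF p] vs) (simp add: insert_index_def)
qed

lemma length_insert_index [simp]: "p \<le> length js \<Longrightarrow> length (insert_index p a js) = Suc (length js)"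
  by (simp add: insert_index_def)

lemma length_delete_index [simp]: "p < length js \<Longrightarrow> length (delete_index p js) = length js - 1"
  by (simp add: delete_index_def)

lemma insert_delete_index [simp]: "p < length js \<Longrightarrow> insert_index p (js ! p) (delete_index p js) = js"
  by (simp add: insert_index_def delete_index_def id_take_nth_drop[symmetric])

lemma delete_insert_index [simp]: "p \<le> length js \<Longrightarrow> delete_index p (insert_index p a js) = js"
  by (simp add: insert_index_def delete_index_def)

lemma nth_insert_index [simp]: "p \<le> length js \<Longrightarrow> insert_index p a js ! p = a"
  by (simp add: insert_index_def nth_append)

lemma nth_insert_index_less [simp]: "p < q \<Longrightarrow> q \<le> length js \<Longrightarrow> insert_index q a js ! p = js ! p"
  by (simp add: insert_index_def nth_append)

lemma nth_delete_index_less [simp]: "p < q \<Longrightarrow> q < length js \<Longrightarrow> delete_index q js ! p = js ! p"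
  by (simp add: delete_index_def nth_append)

lemma map_insert_index: "map f (insert_index p a js) = insert_index p (f a) (map f js)"
  by (simp add: insert_index_def take_map drop_map)

lemma map_delete_index: "map f (delete_index p js) = delete_index p (map f js)"
  by (simp add: delete_index_def take_map drop_map)

lemma teval_insert_expand:
  "teval (insert_index p v vs) T = (\<Sum>i\<in>UNIV. v $ i * teval (insert_index p (axis i 1) vs) T)"
  unfolding insert_index_def by (rule teval_slot)

lemma teval_delete:
  assumes "p < length vs"
  shows "teval vs T = teval (delete_index p vs) (\<lambda>ks. \<Sum>i\<in>UNIV. vs ! p $ i * T (insert_index p i ks))"
  using teval_insert[of p "delete_index p vs" "vs ! p" T] assms by simp

section \<open>Contractions and change of frame\<close>

definition pullm :: "('n::finite \<Rightarrow> 'k::comm_ring_1^'n) \<Rightarrow> 'k^'n^'n \<Rightarrow> 'k^'n^'n" where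
  "pullm J G = (\<chi> i j. bilin G (J i) (J j))"

lemma teval_contract:
  assumes "p \<le> length vs" "q \<le> Suc (length vs)"
  shows "teval vs (contract G p q T) = (\<Sum>a\<in>UNIV. \<Sum>b\<in>UNIV. matrix_inv G $ a $ b *
    teval (insert_index q (axis b 1) (insert_index p (axis a 1) vs)) T)"
proof -
  have [simp]: "(\<Sum>k\<in>UNIV. axis i 1 $ k * f k) = (f i :: 'a)" for i :: 'b and f
    by (subst sum.remove[of _ i]) (auto simp: axis_def intro!: sum.neutral)
  have "teval (insert_index q (axis b 1) (insert_index p (axis a 1) vs)) T
     = teval vs (\<lambda>ks. T (insert_index q b (insert_index p a ks)))" for a b
    using assms by (simp add: teval_insert)
  then show ?thesis
    unfolding contract_def by (simp add: teval_sum teval_mult)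
qed

definition frame_matrix :: "('n::finite \<Rightarrow> 'k^'n) \<Rightarrow> 'k^'n^'n" where
  "frame_matrix J = (\<chi> i j. J j $ i)"

lemma pullm_eq: "pullm J G = transpose (frame_matrix J) ** G ** frame_matrix J"
  by (simp add: pullm_def frame_matrix_def vec_eq_iff matrix_matrix_mult_def transpose_def bilin_def
      sum_distrib_left sum_distrib_right mult_ac)
     (subst sum.swap, simp)

lemma
  fixes A :: "'k::semiring_1^'n^'m"
  assumes "invertible A"
  shows matrix_inv_right: "A ** matrix_inv A = mat 1" and matrix_inv_left: "matrix_inv A ** A = mat 1"
  using someI_ex[OF assms[unfolded invertible_def]] by (simp_all add: matrix_inv_def)

lemma matrix_inv_unique:
  fixes A :: "'k::field^'n^'n"
  assumes "A ** B = mat 1"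
  shows "matrix_inv A = B"
proof -
  have BA: "B ** A = mat 1" using assms by (simp add: matrix_left_right_inverse)
  then have "invertible A" using assms unfolding invertible_def by blast
  then have "A ** matrix_inv A = mat 1" by (simp add: matrix_inv_right)
  then have "B ** (A ** matrix_inv A) = B" by simp
  then show ?thesis by (simp add: matrix_mul_assoc BA)
qed

text \<open>The inverse metric is contravariant: the inverse of the pulled-back metric pushes
  forward to the inverse of \<open>G\<close>. This is why contractions commute with
  pull-backs.\<close>

lemma matrix_inv_pullm:
  fixes G :: "'k::field^'n::finite^'n"
  assumes "invertible G" "invertible (frame_matrix J)"
  shows "frame_matrix J ** matrix_inv (pullm J G) ** transpose (frame_matrix J) = matrix_inv G"
proof -
  let ?F = "frame_matrix J"
  have F: "?F ** matrix_inv ?F = mat 1" "matrix_inv ?F ** ?F = mat 1"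
    using assms(2) by (simp_all add: matrix_inv_left matrix_inv_right)
  have G: "G ** matrix_inv G = mat 1"
    using assms(1) by (simp add: matrix_inv_right)
  have Ft: "transpose ?F ** transpose (matrix_inv ?F) = mat 1"
     "transpose (matrix_inv ?F) ** transpose ?F = mat 1"
    by (simp_all add: F flip: matrix_transpose_mul)
  have "pullm J G ** (matrix_inv ?F ** matrix_inv G ** transpose (matrix_inv ?F)) = mat 1"
    unfolding pullm_eq
    by (metis (no_types, lifting) F Ft G matrix_mul_assoc matrix_mul_rid)
  then have "matrix_inv (pullm J G) = matrix_inv ?F ** matrix_inv G ** transpose (matrix_inv ?F)"
    by (rule matrix_inv_unique)
  then show ?thesis
    by (metis (no_types, lifting) F Ft matrix_mul_assoc matrix_mul_rid matrix_mul_lid)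
qed

lemma sum_swap4:
  "(\<Sum>a\<in>A. \<Sum>b\<in>B. \<Sum>c\<in>C. \<Sum>d\<in>D. f a b c d) = (\<Sum>c\<in>C. \<Sum>d\<in>D. \<Sum>a\<in>A. \<Sum>b\<in>B. f a b c d)"
proof -
  have "(\<Sum>a\<in>A. \<Sum>b\<in>B. \<Sum>c\<in>C. \<Sum>d\<in>D. f a b c d) = (\<Sum>a\<in>A. \<Sum>c\<in>C. \<Sum>d\<in>D. \<Sum>b\<in>B. f a b c d)"
    by (intro sum.cong refl, subst sum.swap) (intro sum.cong refl sum.swap)
  also have "\<dots> = (\<Sum>c\<in>C. \<Sum>d\<in>D. \<Sum>a\<in>A. \<Sum>b\<in>B. f a b c d)"
    by (subst sum.swap) (intro sum.cong refl sum.swap)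
  finally show ?thesis .
qed

text \<open>Each contracted slot contributes one factor \<open>J\<close>, and the two factors
  convert the inverse of \<open>pullm J G\<close> into the inverse of \<open>G\<close>.\<close>

lemma contract_pull:
  fixes G :: "'k::real_normed_field^'n::finite^'n"
  assumes G: "invertible G" "invertible (frame_matrix J)"
    and pq: "p \<le> length js" "q \<le> Suc (length js)"
  shows "contract (pullm J G) p q (pull J T) js = pull J (contract G p q T) js"
proof -
  let ?v = "\<lambda>a b. teval (insert_index q (axis b 1) (insert_index p (axis a 1) (map J js))) T"
  let ?h = "matrix_inv (pullm J G)"
  have e: "teval (insert_index q (J b) (insert_index p (J a) (map J js))) T
     = (\<Sum>c\<in>UNIV. \<Sum>d\<in>UNIV. J a $ c * J b $ d * ?v c d)" for a b
  proof -
    have p: "teval (insert_index q (axis d 1) (insert_index p (J a) (map J js))) T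
         = (\<Sum>c\<in>UNIV. J a $ c * ?v c d)" for d
    proof -
      \<comment> \<open>The argument at position \<open>q\<close> is absorbed into the tensor, so
        that the one at position \<open>p\<close> can be expanded as if it were the only inserted
        argument.\<close>
      define T' where "T' = (\<lambda>ks. \<Sum>i\<in>UNIV. axis d 1 $ i * T (insert_index q i ks))"
      have "teval (insert_index q (axis d 1) (insert_index p u (map J js))) T
        = teval (insert_index p u (map J js)) T'" for u
        using pq unfolding T'_def by (intro teval_insert) simp
      then show ?thesis by (simp only: teval_insert_expand[of p "J a"])
    qed
    have "teval (insert_index q (J b) (insert_index p (J a) (map J js))) T
       = (\<Sum>d\<in>UNIV. J b $ d * (\<Sum>c\<in>UNIV. J a $ c * ?v c d))"
      by (simp only: teval_insert_expand[of q "J b"] p)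
    also have "\<dots> = (\<Sum>c\<in>UNIV. \<Sum>d\<in>UNIV. J a $ c * J b $ d * ?v c d)"
      by (simp only: sum_distrib_left, subst sum.swap) (simp only: mult_ac)
    finally show ?thesis .
  qed
  have "contract (pullm J G) p q (pull J T) js
     = (\<Sum>a\<in>UNIV. \<Sum>b\<in>UNIV. ?h $ a $ b * (\<Sum>c\<in>UNIV. \<Sum>d\<in>UNIV. J a $ c * J b $ d * ?v c d))"
    unfolding contract_def pull_def map_insert_index e ..
  also have "\<dots> = (\<Sum>c\<in>UNIV. \<Sum>d\<in>UNIV. (\<Sum>a\<in>UNIV. \<Sum>b\<in>UNIV. ?h $ a $ b * J a $ c * J b $ d) * ?v c d)"
  proof -
    have "(\<Sum>a\<in>UNIV. \<Sum>b\<in>UNIV. ?h $ a $ b * (\<Sum>c\<in>UNIV. \<Sum>d\<in>UNIV. J a $ c * J b $ d * ?v c d))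
      = (\<Sum>a\<in>UNIV. \<Sum>b\<in>UNIV. \<Sum>c\<in>UNIV. \<Sum>d\<in>UNIV. ?h $ a $ b * J a $ c * J b $ d * ?v c d)"
      by (simp add: sum_distrib_left mult_ac)
    also have "\<dots> = (\<Sum>c\<in>UNIV. \<Sum>d\<in>UNIV. \<Sum>a\<in>UNIV. \<Sum>b\<in>UNIV. ?h $ a $ b * J a $ c * J b $ d * ?v c d)"
      by (rule sum_swap4)
    finally show ?thesis by (simp add: sum_distrib_right)
  qed
  also have "\<dots> = (\<Sum>c\<in>UNIV. \<Sum>d\<in>UNIV. matrix_inv G $ c $ d * ?v c d)"
  proof (intro sum.cong refl arg_cong[of _ _ "\<lambda>x. x * _"])
    fix c d
    have "matrix_inv G $ c $ d = (frame_matrix J ** ?h ** transpose (frame_matrix J)) $ c $ d"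
      using G by (simp add: matrix_inv_pullm)
    also have "\<dots> = (\<Sum>a\<in>UNIV. \<Sum>b\<in>UNIV. ?h $ a $ b * J a $ c * J b $ d)"
      by (simp add: matrix_matrix_mult_def transpose_def frame_matrix_def sum_distrib_right sum_distrib_left)
         (subst sum.swap, simp only: mult_ac)
    finally show "(\<Sum>a\<in>UNIV. \<Sum>b\<in>UNIV. ?h $ a $ b * J a $ c * J b $ d) = matrix_inv G $ c $ d" ..
  qed
  also have "\<dots> = pull J (contract G p q T) js"
    unfolding pull_def using pq by (simp add: teval_contract)
  finally show ?thesis .
qed

text \<open>All traces are taken and put back with a factor of the metric. In the Euclidean case
  multiplication by the metric is adjoint to contraction, so this is the operator
  \<open>C\<close>-adjoint times \<open>C\<close>, where \<open>C\<close> collects all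
  contractions.\<close>

definition trace_part :: "'k::real_normed_field^'n^'n \<Rightarrow> nat \<Rightarrow> ('n::finite list \<Rightarrow> 'k) \<Rightarrow> 'n list \<Rightarrow> 'k" where
  "trace_part G r T js = (\<Sum>q<r. \<Sum>p<q. G $ (js ! p) $ (js ! q) *
     contract G p q T (delete_index p (delete_index q js)))"

lemma teval_metric_times:
  assumes pq: "p < q" "q < length vs"
  shows "teval vs (\<lambda>js. G $ (js ! p) $ (js ! q) * S (delete_index p (delete_index q js)))
     = bilin G (vs ! p) (vs ! q) * teval (delete_index p (delete_index q vs)) S"
proof -
  have "teval vs (\<lambda>js. G $ (js ! p) $ (js ! q) * S (delete_index p (delete_index q js)))
     = teval (delete_index p (delete_index q vs)) (\<lambda>ks. \<Sum>i\<in>UNIV. vs ! p $ i * (\<Sum>j\<in>UNIV. vs ! q $ j *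
        (G $ (insert_index q j (insert_index p i ks) ! p) $ (insert_index q j (insert_index p i ks) ! q)
       * S (delete_index p (delete_index q (insert_index q j (insert_index p i ks)))))))"
    using pq by (subst teval_delete[of q], simp, subst teval_delete[of p]) simp_all
  also have "\<dots> = teval (delete_index p (delete_index q vs)) (\<lambda>ks. bilin G (vs ! p) (vs ! q) * S ks)"
    using pq by (intro teval_cong) (simp add: bilin_def sum_distrib_left sum_distrib_right mult_ac)
  finally show ?thesis by (simp add: teval_mult)
qed

lemma trace_part_pull:
  fixes G :: "'k::real_normed_field^'n::finite^'n"
  assumes G: "invertible G" "invertible (frame_matrix J)" and "length js = r"
  shows "trace_part (pullm J G) r (pull J T) js = pull J (trace_part G r T) js"
proof -
  have "pull J (trace_part G r T) js = (\<Sum>q<r. \<Sum>p<q. teval (map J js) (\<lambda>js. G $ (js ! p) $ (js ! q) *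
     contract G p q T (delete_index p (delete_index q js))))"
    unfolding pull_def trace_part_def[abs_def] by (simp add: teval_sum)
  also have "\<dots> = trace_part (pullm J G) r (pull J T) js"
    unfolding trace_part_def
  proof (intro sum.cong refl)
    fix q p assume "q \<in> {..<r}" "p \<in> {..<q}"
    then have pq: "p < q" "q < r" by auto
    then have "contract (pullm J G) p q (pull J T) (delete_index p (delete_index q js))
       = pull J (contract G p q T) (delete_index p (delete_index q js))"
      using assms by (intro contract_pull) auto
    then show "teval (map J js) (\<lambda>js. G $ (js ! p) $ (js ! q) *
         contract G p q T (delete_index p (delete_index q js)))
      = pullm J G $ (js ! p) $ (js ! q) *
         contract (pullm J G) p q (pull J T) (delete_index p (delete_index q js))"
      using pq assms(3)
      by (subst teval_metric_times) (auto simp: pullm_def pull_def map_delete_index)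
  qed
  finally show ?thesis ..
qed

text \<open>Horner form of a polynomial in the operator \<open>trace_part G r\<close>, constant term
  first. The coefficients are real, so that one list can be used for real and for complex
  metrics.\<close>

primrec trace_poly :: "'k::real_normed_field^'n^'n \<Rightarrow> nat \<Rightarrow> real list \<Rightarrow> ('n::finite list \<Rightarrow> 'k) \<Rightarrow> 'n list \<Rightarrow> 'k" where
  "trace_poly G r [] T = (\<lambda>js. 0)"
| "trace_poly G r (c # cs) T = (\<lambda>js. of_real c * T js + trace_part G r (trace_poly G r cs T) js)"

lemma contract_cong:
  "(\<And>ks. length ks = Suc (Suc (length js)) \<Longrightarrow> T ks = T' ks) \<Longrightarrow> p \<le> length js \<Longrightarrow> q \<le> Suc (length js) \<Longrightarrow>
    contract G p q T js = contract G p q T' js"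
  by (simp add: contract_def)

lemma trace_part_cong:
  "(\<And>ks. length ks = r \<Longrightarrow> T ks = T' ks) \<Longrightarrow> length js = r \<Longrightarrow> trace_part G r T js = trace_part G r T' js"
  unfolding trace_part_def
  by (intro sum.cong refl arg_cong[of _ _ "(*) _"] contract_cong) auto

lemma trace_poly_cong:
  "(\<And>ks. length ks = r \<Longrightarrow> T ks = T' ks) \<Longrightarrow> length js = r \<Longrightarrow> trace_poly G r cs T js = trace_poly G r cs T' js"
  by (induction cs arbitrary: js) (simp_all cong: trace_part_cong)

lemma trace_poly_pull:
  fixes G :: "'k::real_normed_field^'n::finite^'n"
  assumes G: "invertible G" "invertible (frame_matrix J)" and "length js = r"
  shows "trace_poly (pullm J G) r cs (pull J T) js = pull J (trace_poly G r cs T) js"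
  using assms(3)
proof (induction cs arbitrary: js)
  case Nil
  then show ?case by (simp add: pull_def)
next
  case (Cons c cs)
  have "trace_part (pullm J G) r (trace_poly (pullm J G) r cs (pull J T)) js
     = trace_part (pullm J G) r (pull J (trace_poly G r cs T)) js"
    using Cons by (intro trace_part_cong) auto
  then show ?case
    using Cons.prems by (simp add: trace_part_pull[OF G]) (simp add: pull_def teval_add teval_mult)
qed

section \<open>Real structures and boost weights\<close>

lemma bilin_add_left: "bilin G (u + v) w = bilin G u w + bilin G v w"
  by (simp add: bilin_def algebra_simps sum.distrib)

lemma bilin_add_right: "bilin G w (u + v) = bilin G w u + bilin G w v"
  by (simp add: bilin_def algebra_simps sum.distrib)

lemma bilin_scale_left: "bilin G (c *s u) w = c * bilin G u w"
  by (simp add: bilin_def sum_distrib_left mult_ac)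

lemma bilin_scale_right: "bilin G w (c *s u) = c * bilin G w u"
  by (simp add: bilin_def sum_distrib_left mult_ac)

lemma bilin_sum_left: "bilin G (\<Sum>i\<in>A. f i) w = (\<Sum>i\<in>A. bilin G (f i) w)"
proof (induction A rule: infinite_finite_induct)
  case (insert x F) then show ?case by (simp add: bilin_add_left)
qed (simp_all add: bilin_def)

lemma bilin_sum_right: "bilin G w (\<Sum>i\<in>A. f i) = (\<Sum>i\<in>A. bilin G w (f i))"
proof (induction A rule: infinite_finite_induct)
  case (insert x F) then show ?case by (simp add: bilin_add_right)
qed (simp_all add: bilin_def)

lemmas bilin_linear = bilin_add_left bilin_add_right bilin_scale_left bilin_scale_right

lemma frame_comb_eq_mult: "frame_comb J v = frame_matrix J *v v"
  by (simp add: frame_comb_def frame_matrix_def matrix_vector_mult_def vec_eq_iff mult.commute)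

lemma bilin_eq_mult: "bilin G u v = (\<Sum>i\<in>UNIV. u $ i * (G *v v) $ i)"
  by (simp add: bilin_def matrix_vector_mult_def sum_distrib_left mult_ac)

lemma bilin_frame_comb: "bilin G (frame_comb J u) (frame_comb J v) = bilin (pullm J G) u v"
  by (simp add: frame_comb_def bilin_sum_left bilin_sum_right bilin_scale_left bilin_scale_right)
     (unfold bilin_def[of "pullm J G"], subst sum.swap, simp add: pullm_def sum_distrib_left mult_ac)

text \<open>The Gram matrices of orthonormal and of null frames that occur here are their own
  inverses, so \<open>N\<close> times the transposed frame matrix times \<open>G\<close> is a left
  inverse of the frame matrix. Its rows are the dual frame.\<close>

lemma frame_expand:
  fixes G :: "'k::field^'n::finite^'n"
  assumes "pullm E G = N" "N ** N = mat 1"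
  shows "v = (\<Sum>i\<in>UNIV. (\<Sum>j\<in>UNIV. N $ i $ j * bilin G (E j) v) *s E i)"
    and "invertible (frame_matrix E)"
proof -
  have l: "(N ** transpose (frame_matrix E) ** G) ** frame_matrix E = mat 1"
    using assms by (simp add: pullm_eq matrix_mul_assoc[symmetric])
  then show "invertible (frame_matrix E)"
    using invertible_left_inverse by blast
  have "frame_matrix E ** (N ** transpose (frame_matrix E) ** G) = mat 1"
    using l by (simp add: matrix_left_right_inverse)
  then have "v = frame_matrix E *v ((N ** transpose (frame_matrix E) ** G) *v v)"
    by (simp add: matrix_vector_mul_assoc)
  also have "\<dots> = frame_comb E (N *v (transpose (frame_matrix E) *v (G *v v)))"
    by (simp add: frame_comb_eq_mult matrix_vector_mul_assoc matrix_mul_assoc)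
  also have "transpose (frame_matrix E) *v (G *v v) = (\<chi> j. bilin G (E j) v)"
    by (simp add: vec_eq_iff bilin_eq_mult del: transpose_matrix_vector)
       (simp add: matrix_vector_mult_def transpose_def frame_matrix_def del: transpose_matrix_vector)
  finally show "v = (\<Sum>i\<in>UNIV. (\<Sum>j\<in>UNIV. N $ i $ j * bilin G (E j) v) *s E i)"
    by (simp add: frame_comb_def matrix_vector_mult_def)
qed

section \<open>Complexification of vectors, metrics and tensors, and complex conjugation\<close>

definition cvec :: "real^'n \<Rightarrow> complex^'n::finite" where "cvec v = (\<chi> i. of_real (v $ i))"
definition cmat :: "real^'n^'n \<Rightarrow> complex^'n^'n::finite" where "cmat G = (\<chi> i j. of_real (G $ i $ j))"
definition cten :: "('n list \<Rightarrow> real) \<Rightarrow> 'n::finite list \<Rightarrow> complex" where "cten T = (\<lambda>ks. of_real (T ks))"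
definition cnjv :: "complex^'n \<Rightarrow> complex^'n::finite" where "cnjv v = (\<chi> i. cnj (v $ i))"

lemma bilin_cmat: "bilin (cmat G) (cvec u) (cvec v) = of_real (bilin G u v)"
  by (simp add: bilin_def cvec_def cmat_def)

lemma bilin_cmat_cnj: "bilin (cmat G) (cnjv u) (cnjv v) = cnj (bilin (cmat G) u v)"
  by (simp add: bilin_def cnjv_def cmat_def)

lemma teval_cvec: "teval (map cvec vs) (cten T) = of_real (teval vs T)"
  by (induction vs arbitrary: T) (simp_all add: cten_def cvec_def)

lemma teval_cnjv: "teval (map cnjv vs) (cten T) = cnj (teval vs (cten T))"
  by (induction vs arbitrary: T) (simp_all add: cten_def cnjv_def)

lemma cnjv_cnjv [simp]: "cnjv (cnjv v) = v"
  by (simp add: cnjv_def vec_eq_iff)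

lemma cnjv_scale: "cnjv (c *s v) = cnj c *s cnjv v"
  by (simp add: cnjv_def vec_eq_iff)

lemma cnjv_cvec [simp]: "cnjv (cvec v) = cvec v"
  by (simp add: cnjv_def cvec_def vec_eq_iff)

lemma bilin_axis: "bilin G (axis i 1) (axis j 1) = G $ i $ j"
proof -
  have "bilin G (axis i 1) (axis j 1) = (\<Sum>k\<in>UNIV. \<Sum>l\<in>UNIV. if l = j then if k = i then G $ k $ l else 0 else 0)"
    unfolding bilin_def by (intro sum.cong refl) (auto simp: axis_def)
  then show ?thesis by simp
qed

lemma bilin_cmat_sym:
  assumes "\<And>u v. bilin G u v = bilin G v u"
  shows "bilin (cmat G) u v = bilin (cmat G) v u"
proof -
  have "G $ i $ j = G $ j $ i" for i j
    using assms[of "axis i 1" "axis j 1"] by (simp add: bilin_axis)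
  then show ?thesis
    unfolding bilin_def cmat_def
    by (subst sum.swap) (simp add: mult_ac)
qed

text \<open>Arguments are replaced by generators one at a time. The function \<open>f\<close> need
  not be a tensor; below it is also a difference of two of them.\<close>

lemma multilinear_zero_on_span:
  fixes f :: "('k::field^'n) list \<Rightarrow> 'k"
  assumes lin: "\<And>us c v w vs. f (us @ (c *s v + w) # vs) = c * f (us @ v # vs) + f (us @ w # vs)"
    and base: "\<And>us. list_all2 (\<in>) us Ss \<Longrightarrow> f us = 0"
    and vs: "list_all2 (\<lambda>v S. v \<in> vec.span S) vs Ss"
  shows "f vs = 0"
proof -
  have f0: "f (us @ 0 # vs) = 0" for us vs
    using lin[of us "-1" 0 0 vs] by simp
  \<comment> \<open>Strengthened for the induction: the slots in \<open>us\<close> already hold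
    generators, while those in \<open>vs\<close> hold arbitrary elements of the spans.\<close>
  have "f (us @ vs) = 0"
    if "list_all2 (\<lambda>v S. v \<in> vec.span S) vs Ss2" "list_all2 (\<in>) us Ss1"
       "\<And>us. list_all2 (\<in>) us (Ss1 @ Ss2) \<Longrightarrow> f us = 0" for us Ss1 Ss2
    using that
  proof (induction vs arbitrary: us Ss1 Ss2)
    case Nil
    then show ?case by simp
  next
    case (Cons v vs)
    then obtain S Ss' where Ss2: "Ss2 = S # Ss'" "v \<in> vec.span S"
      "list_all2 (\<lambda>v S. v \<in> vec.span S) vs Ss'" by (auto simp: list_all2_Cons1)
    from Ss2(2) show ?case
    proof (induction rule: vec.span_induct_alt)
      case base
      show ?case by (rule f0)
    next
      case (step c x y)
      have "f ((us @ [x]) @ vs) = 0"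
      proof (rule Cons.IH[OF Ss2(3)])
        show "list_all2 (\<in>) (us @ [x]) (Ss1 @ [S])"
          using Cons.prems(2) step.hyps by (simp add: list_all2_appendI)
        show "f us' = 0" if "list_all2 (\<in>) us' ((Ss1 @ [S]) @ Ss')" for us'
          using Cons.prems(3)[of us'] that Ss2(1) by simp
      qed
      then show ?case using step by (simp add: lin)
    qed
  qed
  from this[of Ss "[]" "[]"] show ?thesis using base vs by simp
qed

lemma teval_slot_linear:
  "teval (us @ (c *s v + w) # vs) T = c * teval (us @ v # vs) T + teval (us @ w # vs) T"
  by (simp add: teval_slot_add teval_slot_scale)

text \<open>The tensors whose components of weight \<open>> w\<^sub>0\<close> vanish depend on the null direction \<open>l\<close> alone
  and not on the rest of the null frame: \<open>weight_space\<close> is the filtration \<open>l \<subseteq> l\<^sup>\<bottom> \<subseteq> V\<close>.\<close>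

definition weight_space :: "'k::field^'n^'n \<Rightarrow> 'k^'n::finite \<Rightarrow> int \<Rightarrow> ('k^'n) set" where
  "weight_space G l w = (if w = 1 then range (\<lambda>c. c *s l) else if w = 0 then {v. bilin G l v = 0}
     else if w = -1 then UNIV else {})"

text \<open>The weights in \<open>ws\<close> effectively range over -1, 0 and 1, since the other
  weight spaces are empty.\<close>

definition weight_le :: "'k::field^'n^'n \<Rightarrow> 'k^'n::finite \<Rightarrow> nat \<Rightarrow> ('n list \<Rightarrow> 'k) \<Rightarrow> int \<Rightarrow> bool" where
  "weight_le G l r T w0 \<longleftrightarrow> (\<forall>vs ws. length vs = r \<longrightarrow> list_all2 (\<lambda>v w. v \<in> weight_space G l w) vs ws \<longrightarrow>
     sum_list ws > w0 \<longrightarrow> teval vs T = 0)"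

text \<open>The Gram matrix of a null frame, over any field because it is used for a real frame and
  for its complexification.\<close>

definition null_gram :: "'n \<Rightarrow> 'n \<Rightarrow> 'k::field^'n^'n::finite" where
  "null_gram a b = (\<chi> i j. if i = a then of_bool (j = b) else if i = b then of_bool (j = a) else of_bool (i = j))"

lemma null_gram_mult:
  assumes "a \<noteq> b"
  shows "(\<Sum>j\<in>UNIV. (null_gram a b :: 'k::field^'n^'n::finite) $ i $ j * f j)
    = (if i = a then f b else if i = b then f a else f i)"
proof -
  have "(\<Sum>j\<in>UNIV. of_bool (j = k) * f j) = f k" for k
  proof -
    have "(\<Sum>j\<in>UNIV. of_bool (j = k) * f j) = (\<Sum>j\<in>UNIV. if j = k then f j else 0)"
      by (rule sum.cong) auto
    then show ?thesis by simp
  qed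
  then show ?thesis by (simp add: null_gram_def eq_commute[of i])
qed

lemma null_gram_square:
  assumes "a \<noteq> b"
  shows "null_gram a b ** null_gram a b = (mat 1 :: 'k::field^'n::finite^'n)"
  using assms by (simp add: vec_eq_iff matrix_matrix_mult_def null_gram_mult)
    (simp add: null_gram_def mat_def)

lemma null_frame_iff:
  assumes "\<And>u v. bilin G u v = bilin G v u"
  shows "null_frame G F a b \<longleftrightarrow> a \<noteq> b \<and> pullm F G = null_gram a b"
proof
  assume *: "null_frame G F a b"
  then have "bilin G (F i) (F j) = null_gram a b $ i $ j" for i j
    using assms[of "F b" "F a"] assms[of "F i" "F a"] assms[of "F i" "F b"]
    by (auto simp: null_frame_def null_gram_def)
  with * show "a \<noteq> b \<and> pullm F G = null_gram a b"
    by (simp add: vec_eq_iff pullm_def null_frame_def)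
next
  assume *: "a \<noteq> b \<and> pullm F G = null_gram a b"
  then have "bilin G (F i) (F j) = null_gram a b $ i $ j" for i j
    by (simp add: vec_eq_iff pullm_def)
  then show "null_frame G F a b"
    using * by (auto simp: null_frame_def null_gram_def)
qed

definition frame_weight :: "'n \<Rightarrow> 'n \<Rightarrow> 'n \<Rightarrow> int" where
  "frame_weight a b i = (if i = a then 1 else if i = b then -1 else 0)"

lemma boost_weight_eq: "a \<noteq> b \<Longrightarrow> boost_weight a b js = sum_list (map (frame_weight a b) js)"
  by (induction js) (auto simp: boost_weight_def frame_weight_def)

text \<open>A vector in the filtration step \<open>w\<close> is a combination of frame vectors of
  weight at least \<open>w\<close>. Expanding all arguments therefore produces only components whose
  boost weight is at least the sum of the prescribed weights.\<close>

lemma weight_le_null_frame: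
  fixes G :: "real^'n::finite^'n"
  assumes sym: "\<And>u v. bilin G u v = bilin G v u" and F: "null_frame G F a b"
    and T: "\<And>js. length js = r \<Longrightarrow> boost_weight a b js > w0 \<Longrightarrow> frame_component F T js = 0"
  shows "weight_le (cmat G) (cvec (F a)) r (cten T) w0"
  unfolding weight_le_def
proof (intro allI impI)
  fix vs ws
  assume len: "length vs = r" and vs: "list_all2 (\<lambda>v w. v \<in> weight_space (cmat G) (cvec (F a)) w) vs ws"
    and ws: "sum_list ws > w0"
  have ab: "a \<noteq> b" using F by (simp add: null_frame_def)
  let ?E = "\<lambda>i. cvec (F i)"
  \<comment> \<open>The frame vectors of weight at least \<open>w\<close>; they generate the step
    \<open>w\<close> of the filtration.\<close>
  define S where "S w = ?E ` {i. frame_weight a b i \<ge> w}" for w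
  have gram: "pullm ?E (cmat G) = null_gram a b"
  proof -
    have "pullm F G = null_gram a b" using F null_frame_iff[OF sym] by blast
    then have "bilin G (F i) (F j) = null_gram a b $ i $ j" for i j
      by (simp add: vec_eq_iff pullm_def)
    then show ?thesis
      by (simp add: vec_eq_iff pullm_def bilin_cmat null_gram_def of_bool_def)
  qed
  have sp: "v \<in> vec.span (S w)" if "v \<in> weight_space (cmat G) (?E a) w" for v w
  proof -
    \<comment> \<open>The two null vectors are dual to each other, hence the exchange of
      \<open>a\<close> and \<open>b\<close> in the coefficients: the coefficient of
      \<open>F b\<close> is the product with \<open>F a\<close>, which vanishes on the orthogonal
      complement of \<open>F a\<close>.\<close>
    define co where "co i = (if i = a then bilin (cmat G) (?E b) v else
        if i = b then bilin (cmat G) (?E a) v else bilin (cmat G) (?E i) v)" for i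
    have v: "v = (\<Sum>i\<in>UNIV. co i *s ?E i)"
      using frame_expand(1)[OF gram null_gram_square[OF ab], of v] unfolding null_gram_mult[OF ab] co_def .
    have *: "v \<in> vec.span (S w)" if "\<And>i. frame_weight a b i < w \<Longrightarrow> co i = 0"
    proof -
      have "co i *s ?E i \<in> vec.span (S w)" for i
      proof (cases "frame_weight a b i < w")
        case True
        then show ?thesis using that[OF True] by (simp add: vec.span_zero)
      next
        case False
        then have "?E i \<in> S w" unfolding S_def by (intro imageI) simp
        then show ?thesis by (rule vec.span_scale[OF vec.span_base])
      qed
      then have "(\<Sum>i\<in>UNIV. co i *s ?E i) \<in> vec.span (S w)" by (rule vec.span_sum)
      then show ?thesis unfolding v[symmetric] .
    qed
    consider "w = 1" | "w = 0" | "w = -1"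
      using \<open>v \<in> _\<close> by (auto simp: weight_space_def split: if_splits)
    then show ?thesis
    proof cases
      case 1
      then obtain c where "v = c *s ?E a" using \<open>v \<in> _\<close> by (auto simp: weight_space_def)
      moreover have "?E a \<in> S w" unfolding S_def by (intro imageI) (simp add: frame_weight_def 1)
      ultimately show ?thesis using vec.span_scale[OF vec.span_base] by metis
    next
      case 2
      then have "bilin (cmat G) (?E a) v = 0" using \<open>v \<in> _\<close> by (auto simp: weight_space_def)
      then show ?thesis
        using ab by (intro *) (simp add: 2 co_def frame_weight_def split: if_splits)
    next
      case 3
      show ?thesis by (intro *) (simp add: 3 frame_weight_def split: if_splits)
    qed
  qed
  show "teval vs (cten T) = 0"
  proof (rule multilinear_zero_on_span[where Ss = "map S ws"])
    show "list_all2 (\<lambda>v S. v \<in> vec.span S) vs (map S ws)"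
      using vs sp by (auto simp: list_all2_conv_all_nth)
  next
    fix us assume us: "list_all2 (\<in>) us (map S ws)"
    have "\<forall>p<length ws. \<exists>i. us ! p = ?E i \<and> frame_weight a b i \<ge> ws ! p"
    proof (intro allI impI)
      fix p assume "p < length ws"
      then have "us ! p \<in> S (ws ! p)" using us by (auto simp: list_all2_conv_all_nth)
      then show "\<exists>i. us ! p = ?E i \<and> frame_weight a b i \<ge> ws ! p" by (auto simp: S_def)
    qed
    then obtain j where j: "\<And>p. p < length ws \<Longrightarrow> us ! p = ?E (j p) \<and> frame_weight a b (j p) \<ge> ws ! p"
      by metis
    define js where "js = map j [0..<length ws]"
    have lw: "length ws = r" using list_all2_lengthD[OF vs] len by simp
    have us': "us = map cvec (map F js)"
    proof (rule nth_equalityI)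
      show "length us = length (map cvec (map F js))" using list_all2_lengthD[OF us] by (simp add: js_def)
      fix p assume "p < length us"
      then have "p < length ws" using list_all2_lengthD[OF us] by simp
      then show "us ! p = map cvec (map F js) ! p" using j[of p] by (simp add: js_def)
    qed
    have "sum_list ws = sum_list (map (\<lambda>p. ws ! p) [0..<length ws])" by (simp add: map_nth)
    also have "\<dots> \<le> sum_list (map (\<lambda>p. frame_weight a b (j p)) [0..<length ws])"
      by (rule sum_list_mono) (use j in auto)
    also have "\<dots> = boost_weight a b js" by (simp add: boost_weight_eq[OF ab] js_def comp_def)
    finally have "boost_weight a b js > w0" using ws by simp
    then have "frame_component F T js = 0" by (intro T) (simp_all add: js_def lw)
    then show "teval us (cten T) = 0" unfolding us' teval_cvec by (simp add: frame_component_eq_teval)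
  qed (rule teval_slot_linear)
qed

text \<open>An antilinear involution that is compatible with the metric and the tensor carries the
  filtration of \<open>\<tau> l\<close> into that of \<open>l\<close>. It is applied to the
  conjugations of both real forms.\<close>

lemma weight_le_conjugate:
  fixes \<tau> :: "complex^'n::finite \<Rightarrow> complex^'n"
  assumes g: "\<And>u v. bilin G (\<tau> u) (\<tau> v) = cnj (bilin G u v)" and inv: "\<And>v. \<tau> (\<tau> v) = v"
    and scale: "\<And>c v. \<tau> (c *s v) = cnj c *s \<tau> v"
    and T: "\<And>vs. length vs = r \<Longrightarrow> teval (map \<tau> vs) T = cnj (teval vs T)"
    and l: "weight_le G l r T w0"
  shows "weight_le G (\<tau> l) r T w0"
  unfolding weight_le_def
proof (intro allI impI)
  fix vs ws
  assume len: "length vs = r" and vs: "list_all2 (\<lambda>v w. v \<in> weight_space G (\<tau> l) w) vs ws"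
    and ws: "sum_list ws > w0"
  have "\<tau> v \<in> weight_space G l w" if "v \<in> weight_space G (\<tau> l) w" for v w
  proof -
    have "bilin G l (\<tau> v) = cnj (bilin G (\<tau> l) v)" using g[of "\<tau> l" v] by (simp add: inv)
    then show ?thesis using that by (auto simp: weight_space_def scale inv split: if_splits)
  qed
  then have "list_all2 (\<lambda>v w. v \<in> weight_space G l w) (map \<tau> vs) ws"
    using vs by (auto simp: list_all2_conv_all_nth)
  then have "teval (map \<tau> vs) T = 0" using l ws len by (auto simp: weight_le_def)
  then show "teval vs T = 0" using T[OF len] by simp
qed

lemma weight_le_scale:
  assumes "weight_le G l r T w0" "c \<noteq> 0"
  shows "weight_le G (c *s l) r T w0"
proof -
  have "weight_space G (c *s l) w \<subseteq> weight_space G l w" for w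
    using assms(2) by (auto simp: weight_space_def bilin_scale_left)
  then have "list_all2 (\<lambda>v w. v \<in> weight_space G (c *s l) w) vs ws
    \<Longrightarrow> list_all2 (\<lambda>v w. v \<in> weight_space G l w) vs ws" for vs ws
    unfolding list_all2_conv_all_nth by blast
  then show ?thesis using assms(1) unfolding weight_le_def by blast
qed

text \<open>The grading given by a hyperbolic plane with null vectors \<open>l\<close> and
  \<open>k\<close>. It refines the filtration of \<open>l\<close> and, after reversing the sign of
  the weights, also that of \<open>k\<close>.\<close>

definition pair_space :: "'k::field^'n^'n \<Rightarrow> 'k^'n \<Rightarrow> 'k^'n::finite \<Rightarrow> int \<Rightarrow> ('k^'n) set" where
  "pair_space G l k w = (if w = 1 then range (\<lambda>c. c *s l) else if w = -1 then range (\<lambda>c. c *s k)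
     else if w = 0 then {v. bilin G l v = 0 \<and> bilin G k v = 0} else {})"

text \<open>Weight \<open>w\<close> with respect to \<open>l\<close> is weight \<open>-w\<close>
  with respect to \<open>k\<close>, so both bounds apply to the same list of homogeneous
  arguments.\<close>

lemma teval_pair_space_zero:
  assumes "weight_le G l r T w0" "weight_le G k r T w0" "length vs = r"
    and vs: "list_all2 (\<lambda>v w. v \<in> pair_space G l k w) vs ws"
    and w: "sum_list ws > w0 \<or> - sum_list ws > w0"
  shows "teval vs T = 0"
  using w
proof
  assume "sum_list ws > w0"
  moreover have "list_all2 (\<lambda>v w. v \<in> weight_space G l w) vs ws"
    using vs by (rule list_all2_mono) (auto simp: pair_space_def weight_space_def split: if_splits)
  ultimately show ?thesis using assms by (auto simp: weight_le_def)
next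
  assume "- sum_list ws > w0"
  moreover have "list_all2 (\<lambda>v w. v \<in> weight_space G k w) vs (map uminus ws)"
    using vs by (auto simp: list_all2_conv_all_nth pair_space_def weight_space_def split: if_splits)
  moreover have "sum_list (map uminus ws) = - sum_list ws" by (induction ws) auto
  ultimately show ?thesis using assms unfolding weight_le_def by metis
qed

text \<open>For a null pair with product 1 this multiplies \<open>l\<close> by \<open>c\<close>,
  divides \<open>k\<close> by \<open>c\<close> and fixes the orthogonal complement of their plane.
  The formula involves no frame, and \<open>c\<close> may be complex.\<close>

definition boost_map :: "'k::field^'n^'n \<Rightarrow> 'k^'n \<Rightarrow> 'k^'n::finite \<Rightarrow> 'k \<Rightarrow> 'k^'n \<Rightarrow> 'k^'n" where
  "boost_map G l k c v = v + ((c - 1) * bilin G k v) *s l + ((1 / c - 1) * bilin G l v) *s k"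

lemma teval_scale_all:
  "length cs = length vs \<Longrightarrow> teval (map2 (*s) cs vs) T = prod_list cs * teval vs T"
proof (induction vs arbitrary: cs T)
  case (Cons v vs)
  then obtain c cs' where "cs = c # cs'" "length cs' = length vs" by (cases cs) auto
  then show ?case using Cons.IH by (simp add: sum_distrib_left mult_ac)
qed simp

lemma prod_list_powi: "c \<noteq> 0 \<Longrightarrow> prod_list (map (\<lambda>w. c powi w) ws) = (c::'k::field) powi sum_list ws"
  by (induction ws) (simp_all add: power_int_add)

locale null_pair =
  fixes G :: "'k::field^'n^'n::finite" and l k
  assumes sym: "\<And>u v. bilin G u v = bilin G v u"
    and ll [simp]: "bilin G l l = 0" and kk [simp]: "bilin G k k = 0" and lk [simp]: "bilin G l k = 1"
begin

lemma kl [simp]: "bilin G k l = 1"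
  by (simp add: sym[of k])

lemma boost_map_isometry:
  assumes "c \<noteq> 0"
  shows "bilin G (boost_map G l k c u) (boost_map G l k c v) = bilin G u v"
proof -
  have "bilin G (boost_map G l k c u) (boost_map G l k c v) = bilin G u v
    + ((c - 1) + (1 / c - 1) + (c - 1) * (1 / c - 1)) * (bilin G l u * bilin G k v + bilin G k u * bilin G l v)"
    unfolding boost_map_def bilin_linear ll kk lk kl sym[of u l] sym[of u k] by algebra
  moreover have "(c - 1) + (1 / c - 1) + (c - 1) * (1 / c - 1) = 0"
    using assms by (simp add: field_simps)
  ultimately show ?thesis by simp
qed

lemma boost_map_add: "boost_map G l k c (u + v) = boost_map G l k c u + boost_map G l k c v"
  by (simp add: boost_map_def bilin_linear vec_eq_iff algebra_simps)

lemma boost_map_scale: "boost_map G l k c (a *s u) = a *s boost_map G l k c u"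
  by (simp add: boost_map_def bilin_linear vec_eq_iff algebra_simps)

lemma boost_map_pair_space:
  assumes "c \<noteq> 0" "v \<in> pair_space G l k w"
  shows "boost_map G l k c v = c powi w *s v"
proof -
  consider a where "w = 1" "v = a *s l" | a where "w = -1" "v = a *s k"
    | "w = 0" "bilin G l v = 0" "bilin G k v = 0"
    using assms(2) by (auto simp: pair_space_def split: if_splits)
  then show ?thesis
  proof cases
    case 1
    show ?thesis unfolding 1 boost_map_def bilin_linear by (simp add: vec_eq_iff algebra_simps)
  next
    case 2
    show ?thesis unfolding 2 boost_map_def bilin_linear
      by (simp add: vec_eq_iff algebra_simps power_int_minus divide_inverse)
  next
    case 3
    then show ?thesis by (simp add: boost_map_def)
  qed
qed

text \<open>On homogeneous arguments of total weight \<open>s\<close> the boost multiplies the value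
  by \<open>c powi s\<close>. As \<open>w0 \<le> 0\<close>, the two bounds leave only the values
  with \<open>s = 0\<close>, on which this factor is 1.\<close>

lemma teval_boost_map:
  assumes "weight_le G l r T w0" "weight_le G k r T w0" "w0 \<le> 0" "c \<noteq> 0" and "length vs = r"
  shows "teval (map (boost_map G l k c) vs) T = teval vs T"
proof -
  \<comment> \<open>Homogeneous vectors of any weight; they span the whole space.\<close>
  define S where "S = (\<Union>w. pair_space G l k w)"
  have "teval (map (boost_map G l k c) vs) T - teval vs T = 0"
  proof (rule multilinear_zero_on_span[where Ss = "replicate r S"])
    fix us d v w vs
    show "teval (map (boost_map G l k c) (us @ (d *s v + w) # vs)) T - teval (us @ (d *s v + w) # vs) T =
       d * (teval (map (boost_map G l k c) (us @ v # vs)) T - teval (us @ v # vs) T) +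
       (teval (map (boost_map G l k c) (us @ w # vs)) T - teval (us @ w # vs) T)"
      unfolding map_append list.map boost_map_add boost_map_scale teval_slot_linear right_diff_distrib
      by simp
  next
    have "v \<in> vec.span S" for v
    proof -
      define u where "u = v - bilin G k v *s l - bilin G l v *s k"
      have u: "v = u + bilin G k v *s l + bilin G l v *s k" by (simp add: u_def)
      have "bilin G l v = bilin G l u + bilin G l v" "bilin G k v = bilin G k u + bilin G k v"
        by (subst u, simp add: bilin_linear)+
      then have "u \<in> pair_space G l k 0" by (simp add: pair_space_def)
      moreover have "x *s l \<in> pair_space G l k 1" "x *s k \<in> pair_space G l k (-1)" for x
        by (auto simp: pair_space_def)
      ultimately have "u \<in> S" "bilin G k v *s l \<in> S" "bilin G l v *s k \<in> S"
        unfolding S_def by blast+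
      then show ?thesis by (subst u) (intro vec.span_add vec.span_base)
    qed
    then show "list_all2 (\<lambda>v S. v \<in> vec.span S) vs (replicate r S)"
      using assms(5) by (simp add: list_all2_conv_all_nth)
  next
    fix us assume us: "list_all2 (\<in>) us (replicate r S)"
    then have "\<forall>p<r. \<exists>w. us ! p \<in> pair_space G l k w" and lu: "length us = r"
      by (auto simp: list_all2_conv_all_nth S_def)
    then obtain w where w: "\<And>p. p < r \<Longrightarrow> us ! p \<in> pair_space G l k (w p)" by metis
    define ws where "ws = map w [0..<r]"
    have ws: "list_all2 (\<lambda>v w. v \<in> pair_space G l k w) us ws"
      using w lu by (simp add: list_all2_conv_all_nth ws_def)
    have "map (boost_map G l k c) us = map2 (*s) (map (\<lambda>w. c powi w) ws) us"
      using ws \<open>c \<noteq> 0\<close> by (auto simp: list_eq_iff_nth_eq list_all2_conv_all_nth boost_map_pair_space)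
    then have "teval (map (boost_map G l k c) us) T = c powi sum_list ws * teval us T"
      using list_all2_lengthD[OF ws] \<open>c \<noteq> 0\<close> by (simp add: teval_scale_all prod_list_powi)
    moreover have "teval us T = 0" if "sum_list ws \<noteq> 0"
      using assms(1,2) lu ws by (rule teval_pair_space_zero) (use that assms(3) in linarith)
    ultimately show "teval (map (boost_map G l k c) us) T - teval us T = 0"
      by (cases "sum_list ws = 0") auto
  qed
  then show ?thesis by simp
qed

end

text \<open>Let \<open>l\<close> be the null direction of the given frame, \<open>\<tau>\<close> the conjugation with respect to the real
  form spanned by \<open>L\<close>, and \<open>\<kappa> = \<tau> l / g(l, \<tau> l)\<close>. As \<open>\<tau>\<close> interchanges the directions of \<open>l\<close> and
  \<open>\<kappa>\<close>, the tensor is bounded in weight along both, and hence invariant under the boosts of the planes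
  \<open>(l, \<kappa>)\<close> and \<open>(l, cnj \<kappa>)\<close>. Composing a boost of the first with the inverse boost of the second
  maps \<open>\<kappa>\<close> to the real null vector \<open>k' = Re \<kappa> - g(\<kappa>, cnj \<kappa>) l / 4\<close>.\<close>

lemma null_frame_two_sided:
  fixes G :: "real^'n::finite^'n"
  assumes sym: "\<And>u v. bilin G u v = bilin G v u" and F: "null_frame G F a b"
    and T: "\<And>js. length js = r \<Longrightarrow> boost_weight a b js > w0 \<Longrightarrow> frame_component F T js = 0"
    and w0: "w0 \<le> 0"
    and gram: "\<And>i j. bilin (cmat G) (L i) (L j) = of_real (H $ i $ j)"
    and pos: "\<And>u. u \<noteq> 0 \<Longrightarrow> bilin H u u > 0"
    and L: "invertible (frame_matrix L)"
    and real: "\<And>js. length js = r \<Longrightarrow> teval (map L js) (cten T) \<in> \<real>"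
  obtains F' where "null_frame G F' a b"
    "\<And>js. length js = r \<Longrightarrow> boost_weight a b js > w0 \<or> - boost_weight a b js > w0 \<Longrightarrow>
       frame_component F' T js = 0"
proof -
  let ?G = "cmat G"
  have csym: "bilin ?G u v = bilin ?G v u" for u v by (rule bilin_cmat_sym[OF sym])
  define co where "co v = matrix_inv (frame_matrix L) *v v" for v
  have L_co [simp]: "frame_comb L (co v) = v" for v
    by (simp add: co_def frame_comb_eq_mult matrix_vector_mul_assoc matrix_inv_right[OF L])
  have co_L [simp]: "co (frame_comb L v) = v" for v
    by (simp add: co_def frame_comb_eq_mult matrix_vector_mul_assoc matrix_inv_left[OF L])
  define \<tau> where "\<tau> v = frame_comb L (cnjv (co v))" for v
  have pH: "pullm L ?G = cmat H"
    by (simp add: vec_eq_iff pullm_def gram) (simp add: cmat_def)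
  have b\<tau>: "bilin ?G (\<tau> u) (\<tau> v) = cnj (bilin ?G u v)" for u v
  proof -
    have "bilin ?G (\<tau> u) (\<tau> v) = cnj (bilin (cmat H) (co u) (co v))"
      by (simp add: \<tau>_def bilin_frame_comb pH bilin_cmat_cnj)
    also have "bilin (cmat H) (co u) (co v) = bilin ?G u v"
      using bilin_frame_comb[of ?G L "co u" "co v"] by (simp add: pH)
    finally show ?thesis .
  qed
  have \<tau>\<tau>: "\<tau> (\<tau> v) = v" for v by (simp add: \<tau>_def)
  have \<tau>_scale: "\<tau> (c *s v) = cnj c *s \<tau> v" for c v
  proof -
    have "co (c *s v) = c *s co v"
      by (simp add: co_def matrix_vector_mult_def vec_eq_iff sum_distrib_left mult_ac)
    then show ?thesis by (simp add: \<tau>_def cnjv_scale frame_comb_scale)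
  qed
  have \<tau>T: "teval (map \<tau> vs) (cten T) = cnj (teval vs (cten T))" if len: "length vs = r" for vs
  proof -
    \<comment> \<open>In the coordinates of \<open>L\<close> the tensor is the complexification of
      the real tensor \<open>R\<close>, and \<tau> is ordinary complex conjugation.\<close>
    define R where "R js = Re (teval (map L js) (cten T))" for js
    have R: "pull L (cten T) js = cten R js" if "length js = r" for js
      using real[OF that] by (auto simp: pull_def R_def cten_def complex_is_Real_iff complex_eq_iff)
    have e: "teval (map (frame_comb L) us) (cten T) = teval us (cten R)" if "length us = r" for us
      unfolding teval_pull[symmetric] using that by (intro teval_cong R) simp
    have "teval (map \<tau> vs) (cten T) = teval (map (frame_comb L) (map cnjv (map co vs))) (cten T)"
      by (simp add: \<tau>_def[abs_def] comp_def)
    also have "\<dots> = teval (map cnjv (map co vs)) (cten R)" using len by (intro e) simp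
    also have "\<dots> = cnj (teval (map co vs) (cten R))" by (rule teval_cnjv)
    also have "teval (map co vs) (cten R) = teval (map (frame_comb L) (map co vs)) (cten T)"
      using len by (intro e[symmetric]) simp
    finally show ?thesis by (simp add: comp_def)
  qed
  have ab: "a \<noteq> b" and Faa: "bilin G (F a) (F a) = 0" and Fab: "bilin G (F a) (F b) = 1"
    using F by (simp_all add: null_frame_def)
  define l where "l = cvec (F a)"
  define h where "h = bilin ?G l (\<tau> l)"
  have ll: "bilin ?G l l = 0" by (simp add: l_def bilin_cmat Faa)
  have cnj_l: "cnjv l = l" by (simp add: l_def)
  have h: "h \<noteq> 0"
  proof -
    \<comment> \<open>In the coordinates of \<open>L\<close>, \<open>l\<close> is
      \<open>x + i y\<close> and \<open>\<tau> l\<close> is \<open>x - i y\<close>, so the real part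
      of \<open>h\<close> is the sum of the squares of \<open>x\<close> and \<open>y\<close> in the
      positive definite metric \<open>H\<close>.\<close>
    define u where "u = co l"
    define x where "x = (\<chi> i. Re (u $ i))"
    define y where "y = (\<chi> i. Im (u $ i))"
    have u: "u = cvec x + \<i> *s cvec y" and cu: "cnjv u = cvec x + (- \<i>) *s cvec y"
      by (simp_all add: vec_eq_iff cvec_def x_def y_def cnjv_def complex_eq_iff)
    have "F a \<noteq> 0" using Fab by (auto simp: bilin_def)
    then have "l \<noteq> 0" by (simp add: l_def cvec_def vec_eq_iff)
    then have "u \<noteq> 0" using L_co[of l] by (auto simp: u_def frame_comb_def)
    then have "x \<noteq> 0 \<or> y \<noteq> 0" using u by (auto simp: cvec_def vec_eq_iff)
    then have "bilin H x x + bilin H y y > 0"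
      using pos[of x] pos[of y] by (cases "x = 0"; cases "y = 0") (auto simp: bilin_def[of _ 0])
    moreover have "h = bilin (cmat H) u (cnjv u)"
      using bilin_frame_comb[of ?G L u "cnjv u"] by (simp add: h_def \<tau>_def u_def pH)
    then have "h = bilin (cmat H) (cvec x + \<i> *s cvec y) (cvec x + (- \<i>) *s cvec y)"
      unfolding cu unfolding u .
    then have "Re h = bilin H x x + bilin H y y"
      unfolding bilin_linear bilin_cmat by simp
    ultimately show ?thesis by auto
  qed
  define \<kappa> where "\<kappa> = (1 / h) *s \<tau> l"
  define \<kappa>' where "\<kappa>' = cnjv \<kappa>"
  have "bilin ?G \<kappa> \<kappa> = 0" "bilin ?G l \<kappa> = 1"
    using h b\<tau>[of l l] by (simp_all add: \<kappa>_def bilin_linear ll) (simp add: h_def)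
  then interpret K: null_pair ?G l \<kappa> using csym ll by unfold_locales auto
  have k'k': "bilin ?G \<kappa>' \<kappa>' = 0" and lk': "bilin ?G l \<kappa>' = 1"
    using bilin_cmat_cnj[of G \<kappa> \<kappa>] bilin_cmat_cnj[of G l \<kappa>] by (simp_all add: \<kappa>'_def cnj_l)
  then interpret K': null_pair ?G l \<kappa>' using csym ll by unfold_locales auto
  have wl: "weight_le ?G l r (cten T) w0"
    unfolding l_def using sym F T by (rule weight_le_null_frame)
  have "weight_le ?G (\<tau> l) r (cten T) w0"
    by (rule weight_le_conjugate[OF b\<tau> \<tau>\<tau> \<tau>_scale \<tau>T wl])
  then have wk: "weight_le ?G \<kappa> r (cten T) w0"
    unfolding \<kappa>_def using h by (intro weight_le_scale) simp_all
  have wk': "weight_le ?G \<kappa>' r (cten T) w0"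
    unfolding \<kappa>'_def by (rule weight_le_conjugate[OF bilin_cmat_cnj cnjv_cnjv cnjv_scale teval_cnjv wk])
  \<comment> \<open>A null vector \<open>n\<close> with \<open>g(l, n) = 1\<close> is determined by
    its class modulo \<open>l\<close>. Up to scale, the boost of the plane of \<open>l\<close> and
    \<open>\<kappa>\<close> with factor \<open>c\<close> acts on these classes as the homothety of
    ratio \<open>c\<close> centred at \<open>\<kappa>\<close>. Ratio 2 about
    \<open>\<kappa>'\<close> sends the midpoint of \<open>\<kappa>\<close> and
    \<open>\<kappa>'\<close> to \<open>\<kappa>\<close>; the factor 1/2 about
    \<open>\<kappa>\<close> keeps that direction and undoes the rescaling, that of \<open>l\<close>
    included.\<close>
  define A where "A v = boost_map ?G l \<kappa> (1/2) (boost_map ?G l \<kappa>' 2 v)" for v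
  have A_iso: "bilin ?G (A u) (A v) = bilin ?G u v" for u v
    by (simp add: A_def K.boost_map_isometry K'.boost_map_isometry)
  have A_T: "teval (map A vs) (cten T) = teval vs (cten T)" if "length vs = r" for vs
  proof -
    have "teval (map A vs) (cten T) = teval (map (boost_map ?G l \<kappa> (1/2)) (map (boost_map ?G l \<kappa>' 2) vs)) (cten T)"
      by (simp add: A_def[abs_def] comp_def)
    also have "\<dots> = teval (map (boost_map ?G l \<kappa>' 2) vs) (cten T)"
      using that by (intro K.teval_boost_map[OF wl wk w0]) simp_all
    also have "\<dots> = teval vs (cten T)"
      using that by (intro K'.teval_boost_map[OF wl wk' w0]) simp_all
    finally show ?thesis .
  qed
  define c where "c = bilin ?G \<kappa> \<kappa>'"
  have "cnj c = c" using bilin_cmat_cnj[of G \<kappa> \<kappa>'] csym[of \<kappa> \<kappa>'] by (simp add: c_def \<kappa>'_def)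
  then have c: "of_real (Re c) = c" by (simp add: complex_eq_iff)
  \<comment> \<open>The midpoint of \<open>\<kappa>\<close> and its conjugate has square
    \<open>c / 2\<close> and product 1 with \<open>l\<close>. Subtracting \<open>c / 4\<close> times
    \<open>l\<close> makes it null, and the result stays real because \<open>c\<close> is
    real.\<close>
  define k where "k = (\<chi> i. Re (\<kappa> $ i)) - (Re c / 4) *s F a"
  have ck: "cvec k = (1/2) *s \<kappa> + (1/2) *s \<kappa>' + (- c / 4) *s l"
  proof (rule vec_eq_iff[THEN iffD2], rule allI)
    fix i
    have "\<kappa> $ i + cnj (\<kappa> $ i) = 2 * of_real (Re (\<kappa> $ i))" by (simp add: complex_eq_iff)
    then show "cvec k $ i = ((1/2) *s \<kappa> + (1/2) *s \<kappa>' + (- c / 4) *s l) $ i"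
      using c by (simp add: k_def cvec_def \<kappa>'_def cnjv_def l_def field_simps)
  qed
  have lk: "bilin G (F a) k = 1"
  proof -
    have "bilin ?G l (cvec k) = 1" unfolding ck bilin_linear by (simp add: field_simps)
    then show ?thesis by (simp add: l_def bilin_cmat)
  qed
  have kk: "bilin G k k = 0"
  proof -
    have "bilin ?G (cvec k) (cvec k) = 0"
      unfolding ck bilin_linear by (simp add: csym[of \<kappa>' \<kappa>] c_def[symmetric] field_simps)
    then show ?thesis by (simp add: bilin_cmat)
  qed
  have A_l: "A l = l"
  proof -
    have "boost_map ?G l \<kappa>' 2 l = 2 *s l" by (simp add: boost_map_def vec_eq_iff)
    then show ?thesis
      unfolding A_def by (simp add: K.boost_map_scale) (simp add: boost_map_def vec_eq_iff)
  qed
  have A_k: "A (cvec k) = \<kappa>"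
  proof -
    have 1: "bilin ?G l (cvec k) = 1" using lk by (simp add: l_def bilin_cmat)
    have 2: "bilin ?G \<kappa>' (cvec k) = c / 4"
      unfolding ck bilin_linear by (simp add: csym[of \<kappa>' \<kappa>] c_def[symmetric] field_simps)
    have "boost_map ?G l \<kappa>' 2 (cvec k) = (1/2) *s \<kappa>"
      unfolding boost_map_def 1 2 unfolding ck by (simp add: vec_eq_iff field_simps)
    then show ?thesis
      unfolding A_def by (simp add: K.boost_map_scale) (simp add: boost_map_def vec_eq_iff)
  qed
  \<comment> \<open>The remaining vectors are shifted along \<open>l\<close> to become orthogonal to
    the new \<open>k\<close>. Their mutual products do not change, since \<open>l\<close> is null
    and orthogonal to them.\<close>
  define F' where "F' i = (if i = a then F a else if i = b then k else F i + (- bilin G k (F i)) *s F a)" for i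
  have F'i: "F' i = F i + (- bilin G k (F i)) *s F a"
    if "i \<noteq> a" "i \<noteq> b" for i using that by (simp add: F'_def)
  have Fai: "bilin G (F a) (F i) = 0" "bilin G (F i) (F a) = 0" if "i \<noteq> a" "i \<noteq> b" for i
    using F that sym[of "F i" "F a"] by (simp_all add: null_frame_def)
  have Fij: "bilin G (F i) (F j) = (if i = j then 1 else 0)" if "i \<noteq> a" "i \<noteq> b" "j \<noteq> a" "j \<noteq> b" for i j
    using F that by (simp add: null_frame_def)
  have F': "null_frame G F' a b"
    unfolding null_frame_def
  proof (intro conjI allI impI)
    have [simp]: "F' a = F a" "F' b = k" using ab by (simp_all add: F'_def)
    show "a \<noteq> b" "bilin G (F' a) (F' a) = 0" "bilin G (F' b) (F' b) = 0" "bilin G (F' a) (F' b) = 1"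
      using ab Faa kk lk by simp_all
    fix i assume "i \<notin> {a, b}"
    then have i: "i \<noteq> a" "i \<noteq> b" by auto
    show "bilin G (F' a) (F' i) = 0"
      unfolding F'i[OF i] bilin_linear by (simp add: Fai[OF i] Faa)
    show "bilin G (F' b) (F' i) = 0"
      unfolding F'i[OF i] bilin_linear by (simp add: sym[of k "F a"] lk)
    fix j assume "j \<notin> {a, b}"
    then have j: "j \<noteq> a" "j \<noteq> b" by auto
    show "bilin G (F' i) (F' j) = (if i = j then 1 else 0)"
      unfolding F'i[OF i] F'i[OF j] bilin_linear Fai[OF i] Fai[OF j] Faa Fij[OF i j] by simp
  qed
  show thesis
  proof (rule that[OF F'])
    fix js :: "'n list"
    assume len: "length js = r" and w: "boost_weight a b js > w0 \<or> - boost_weight a b js > w0"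
    \<comment> \<open>The isometry \<open>A\<close> carries the plane of \<open>l\<close> and
      \<open>k\<close> to that of \<open>l\<close> and \<open>\<kappa>\<close>, hence also the
      orthogonal complements. As \<open>A\<close> preserves the tensor, its components in the real
      frame \<open>F'\<close> inherit the vanishing known for the pair \<open>l\<close>,
      \<open>\<kappa>\<close>.\<close>
    have "A (cvec (F' i)) \<in> pair_space ?G l \<kappa> (frame_weight a b i)" for i
    proof -
      consider "i = a" | "i = b" | "i \<noteq> a" "i \<noteq> b" by blast
      then show ?thesis
      proof cases
        case 1
        have "l \<in> range (\<lambda>c. c *s l)" by (rule range_eqI[of _ _ 1]) simp
        then show ?thesis using 1 A_l unfolding pair_space_def
          by (simp add: F'_def frame_weight_def l_def[symmetric])
      next
        case 2
        have "\<kappa> \<in> range (\<lambda>c. c *s \<kappa>)" by (rule range_eqI[of _ _ 1]) simp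
        then show ?thesis using 2 A_k ab unfolding pair_space_def
          by (simp add: F'_def frame_weight_def)
      next
        case 3
        have "bilin ?G l (A (cvec (F' i))) = bilin ?G (A l) (A (cvec (F' i)))" by (simp add: A_l)
        also have "\<dots> = of_real (bilin G (F' a) (F' i))"
          unfolding A_iso by (simp add: l_def bilin_cmat F'_def)
        finally have 1: "bilin ?G l (A (cvec (F' i))) = 0" using F' 3 by (simp add: null_frame_def)
        have "bilin ?G \<kappa> (A (cvec (F' i))) = bilin ?G (A (cvec k)) (A (cvec (F' i)))" by (simp add: A_k)
        also have "\<dots> = of_real (bilin G (F' b) (F' i))"
          unfolding A_iso using ab by (simp add: bilin_cmat F'_def)
        finally have 2: "bilin ?G \<kappa> (A (cvec (F' i))) = 0" using F' 3 by (simp add: null_frame_def)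
        show ?thesis using 1 2 3 by (simp add: pair_space_def frame_weight_def)
      qed
    qed
    then have "list_all2 (\<lambda>v w. v \<in> pair_space ?G l \<kappa> w)
        (map (\<lambda>i. A (cvec (F' i))) js) (map (frame_weight a b) js)"
      by (simp add: list_all2_conv_all_nth)
    then have "teval (map (\<lambda>i. A (cvec (F' i))) js) (cten T) = 0"
      using w len by (intro teval_pair_space_zero[OF wl wk]) (auto simp: boost_weight_eq[OF ab])
    moreover have "teval (map (\<lambda>i. A (cvec (F' i))) js) (cten T) = teval (map cvec (map F' js)) (cten T)"
      using A_T[of "map cvec (map F' js)"] len by (simp add: comp_def)
    ultimately show "frame_component F' T js = 0"
      unfolding teval_cvec frame_component_eq_teval by simp
  qed
qed

text \<open>The components of the tensors are recovered by evaluating the pull-backs on the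
  preimages of the basis vectors.\<close>

lemma pull_inject:
  fixes E :: "'n::finite \<Rightarrow> 'k::field^'n"
  assumes E: "invertible (frame_matrix E)"
    and eq: "\<And>js. length js = r \<Longrightarrow> pull E T js = pull E T' js" and js: "length js = r"
  shows "T js = T' js"
proof -
  define co where "co v = matrix_inv (frame_matrix E) *v v" for v
  have co: "frame_comb E (co v) = v" for v
    by (simp add: co_def frame_comb_eq_mult matrix_vector_mul_assoc matrix_inv_right[OF E])
  let ?vs = "map (\<lambda>i. co (axis i 1)) js"
  have "teval ?vs (pull E T) = teval ?vs (pull E T')"
    using js by (intro teval_cong eq) simp
  then show ?thesis by (simp add: teval_pull comp_def co)
qed

lemma type_O_if_frame_components_zero:
  fixes G :: "real^'n::finite^'n"
  assumes sym: "\<And>u v. bilin G u v = bilin G v u" and F: "null_frame G F a b"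
    and T: "\<And>js. length js = r \<Longrightarrow> frame_component F T js = 0"
  shows "type_O r T"
  unfolding type_O_def
proof (intro allI impI)
  fix js :: "'n list" assume len: "length js = r"
  have ab: "a \<noteq> b" and gram: "pullm F G = null_gram a b"
    using F null_frame_iff[OF sym, of F a b] by auto
  have "pull F T js = pull F (\<lambda>_. 0) js" if "length js = r" for js
    using T[OF that] by (simp add: pull_def frame_component_eq_teval)
  then show "T js = 0"
    by (rule pull_inject[OF frame_expand(2)[OF gram null_gram_square[OF ab]] _ len])
qed

text \<open>For type II the bound 0 in both directions leaves weight 0 only, which is type D. Types
  III and N both give the bound -1; since every integer \<open>w\<close> satisfies
  \<open>w > -1\<close> or \<open>- w > -1\<close>, no component is left.\<close>

lemma not_proper_type:
  fixes G :: "real^'n::finite^'n"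
  assumes sym: "\<And>u v. bilin G u v = bilin G v u"
    and gram: "\<And>i j. bilin (cmat G) (L i) (L j) = of_real (H $ i $ j)"
    and pos: "\<And>u. u \<noteq> 0 \<Longrightarrow> bilin H u u > 0"
    and L: "invertible (frame_matrix L)"
    and real: "\<And>js. length js = r \<Longrightarrow> teval (map L js) (cten T) \<in> \<real>"
  shows "\<not> (proper_type_II G r T \<or> proper_type_III G r T \<or> proper_type_N G r T)"
proof -
  have D: "type_D G r T" if "type_II G r T"
  proof -
    from that obtain F a b where F: "null_frame G F a b" and T: "\<And>w. w > 0 \<Longrightarrow> boost_part_zero F a b r T w"
      by (auto simp: type_II_def)
    have "frame_component F T js = 0" if "length js = r" "boost_weight a b js > 0" for js
      using T[OF that(2)] that(1) by (simp add: boost_part_zero_def)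
    from null_frame_two_sided[OF sym F this order_refl gram pos L real]
    obtain F' where F': "null_frame G F' a b"
      "\<And>js. length js = r \<Longrightarrow> boost_weight a b js > 0 \<or> - boost_weight a b js > 0 \<Longrightarrow>
       frame_component F' T js = 0" by metis
    have "boost_part_zero F' a b r T w" if "w \<noteq> 0" for w
      unfolding boost_part_zero_def
    proof (intro allI impI)
      fix js :: "'n list" assume "length js = r" "boost_weight a b js = w"
      then show "frame_component F' T js = 0" using that by (intro F'(2)) linarith+
    qed
    then show ?thesis using F'(1) unfolding type_D_def by blast
  qed
  have neg_one_le_0: "- 1 \<le> (0::int)" by simp
  have O: "type_O r T" if "type_III G r T \<or> type_N G r T"
  proof -
    from that obtain F a b where F: "null_frame G F a b" and T: "\<And>w. w \<ge> 0 \<Longrightarrow> boost_part_zero F a b r T w"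
      unfolding type_III_def type_N_def by force
    have "frame_component F T js = 0" if "length js = r" "boost_weight a b js > -1" for js
      using T[of "boost_weight a b js"] that by (simp add: boost_part_zero_def)
    from null_frame_two_sided[OF sym F this neg_one_le_0 gram pos L real]
    obtain F' where F': "null_frame G F' a b"
      "\<And>js. length js = r \<Longrightarrow> boost_weight a b js > -1 \<or> - boost_weight a b js > -1 \<Longrightarrow>
       frame_component F' T js = 0" by metis
    show ?thesis
    proof (rule type_O_if_frame_components_zero[OF sym F'(1)])
      fix js :: "'n list" assume "length js = r"
      then show "frame_component F' T js = 0" by (intro F'(2)) linarith+
    qed
  qed
  show ?thesis
    using D O unfolding proper_type_II_def proper_type_III_def proper_type_N_def by blast
qed

section \<open>The trace-free projection as a polynomial\<close>

lemma sum_lists_insert: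
  "p \<le> n \<Longrightarrow> (\<Sum>js\<in>{js :: 'n::finite list. length js = Suc n}. f js)
     = (\<Sum>ks\<in>{ks. length ks = n}. \<Sum>i\<in>UNIV. f (insert_index p i ks))"
proof (induction p arbitrary: n f)
  case 0
  show ?case by (simp add: sum_lists_Suc insert_index_def) (rule sum.swap)
next
  case (Suc p)
  then obtain m where m: "n = Suc m" "p \<le> m" by (cases n) auto
  have "(\<Sum>js\<in>{js. length js = Suc n}. f js)
    = (\<Sum>a\<in>UNIV. \<Sum>ks\<in>{ks. length ks = m}. \<Sum>i\<in>UNIV. f (a # insert_index p i ks))"
    unfolding sum_lists_Suc[of _ n] unfolding m(1) Suc.IH[OF m(2)] ..
  also have "\<dots> = (\<Sum>ks\<in>{ks. length ks = n}. \<Sum>i\<in>UNIV. f (insert_index (Suc p) i ks))"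
    unfolding m(1) sum_lists_Suc by (simp add: insert_index_def)
  finally show ?case .
qed

lemma matrix_inv_mat_1 [simp]: "matrix_inv (mat 1 :: 'k::field^'n^'n) = mat 1"
  by (rule matrix_inv_unique) simp

lemma sum_mat_1:
  "(\<Sum>j\<in>UNIV. (mat 1 :: 'k::semiring_1^'n^'n::finite) $ i $ j * f j) = f i"
proof -
  have "(\<Sum>j\<in>UNIV. (mat 1 :: 'k^'n^'n) $ i $ j * f j) = (\<Sum>j\<in>UNIV. if j = i then f j else 0)"
    by (rule sum.cong) (auto simp: mat_def)
  then show ?thesis by simp
qed

lemma contract_mat_1:
  "contract (mat 1) p q T js = (\<Sum>a\<in>UNIV. T (insert_index q a (insert_index p a js)))"
  by (simp add: contract_def sum_mat_1)

section \<open>The Euclidean inner product of tensors, for which \<open>trace_part\<close> is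
  self-adjoint\<close>

definition tensor_inner :: "nat \<Rightarrow> ('n::finite list \<Rightarrow> real) \<Rightarrow> ('n list \<Rightarrow> real) \<Rightarrow> real" where
  "tensor_inner r S T = (\<Sum>js\<in>{js. length js = r}. S js * T js)"

lemma finite_lists_length: "finite {js :: 'n::finite list. length js = r}"
  using finite_lists_length_eq[of "UNIV :: 'n set" r] by simp

lemma tensor_inner_self_eq_0:
  assumes "tensor_inner r T T = 0" "length js = r"
  shows "T js = 0"
proof -
  have "\<forall>js\<in>{js. length js = r}. T js * T js = 0"
    using assms(1) unfolding tensor_inner_def
    by (subst (asm) sum_nonneg_eq_0_iff) (simp_all add: finite_lists_length)
  then show ?thesis using assms(2) by simp
qed

text \<open>Multiplication by the metric in the slots \<open>p\<close> and \<open>q\<close> is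
  adjoint to contraction of these slots.\<close>

lemma tensor_inner_metric:
  assumes "p < q" "q < r"
  shows "tensor_inner r (\<lambda>js. mat 1 $ (js ! p) $ (js ! q) * S (delete_index p (delete_index q js))) T
     = tensor_inner (r - 2) S (contract (mat 1) p q T)"
proof -
  obtain m where r: "r = Suc (Suc m)" "p \<le> m" "q \<le> Suc m"
  proof (rule that)
    show "r = Suc (Suc (r - 2))" "p \<le> r - 2" "q \<le> Suc (r - 2)" using assms by auto
  qed
  let ?f = "\<lambda>js. mat 1 $ (js ! p) $ (js ! q) * S (delete_index p (delete_index q js)) * T js"
  have "tensor_inner r (\<lambda>js. mat 1 $ (js ! p) $ (js ! q) * S (delete_index p (delete_index q js))) T
     = (\<Sum>ks\<in>{ks. length ks = m}. \<Sum>i\<in>UNIV. \<Sum>j\<in>UNIV. ?f (insert_index q j (insert_index p i ks)))"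
    unfolding tensor_inner_def r(1) sum_lists_insert[OF r(3)] sum_lists_insert[OF r(2)] ..
  also have "\<dots> = (\<Sum>ks\<in>{ks. length ks = m}. \<Sum>i\<in>UNIV. \<Sum>j\<in>UNIV. mat 1 $ i $ j *
       (S ks * T (insert_index q j (insert_index p i ks))))"
    using assms(1) r by (intro sum.cong refl) simp
  also have "\<dots> = (\<Sum>ks\<in>{ks. length ks = m}. S ks * contract (mat 1) p q T ks)"
    unfolding sum_mat_1 contract_mat_1 by (simp add: sum_distrib_left)
  finally show ?thesis by (simp add: tensor_inner_def r(1))
qed

lemma tensor_inner_sum_metric:
  "tensor_inner r (\<lambda>js. \<Sum>q<r. \<Sum>p<q. mat 1 $ (js ! p) $ (js ! q) * S p q (delete_index p (delete_index q js))) T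
     = (\<Sum>q<r. \<Sum>p<q. tensor_inner (r - 2) (S p q) (contract (mat 1) p q T))"
proof -
  have sum: "tensor_inner r (\<lambda>js. \<Sum>i\<in>A. f i js) T = (\<Sum>i\<in>A. tensor_inner r (f i) T)"
    for A :: "nat set" and f
    unfolding tensor_inner_def sum_distrib_right by (rule sum.swap)
  show ?thesis
    unfolding sum by (intro sum.cong refl tensor_inner_metric) auto
qed

lemma tensor_inner_trace_part:
  "tensor_inner r (trace_part (mat 1) r S) T
     = (\<Sum>q<r. \<Sum>p<q. tensor_inner (r - 2) (contract (mat 1) p q S) (contract (mat 1) p q T))"
  unfolding trace_part_def[abs_def] by (rule tensor_inner_sum_metric)

lemma tensor_inner_commute: "tensor_inner r S T = tensor_inner r T S"
  by (simp add: tensor_inner_def mult.commute)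

lemma tensor_inner_trace_part_commute:
  "tensor_inner r (trace_part (mat 1) r S) T = tensor_inner r (trace_part (mat 1) r T) S"
  unfolding tensor_inner_trace_part by (intro sum.cong refl tensor_inner_commute)

lemma tensor_inner_zero:
  "(\<And>js. length js = r \<Longrightarrow> S js = 0) \<Longrightarrow> tensor_inner r S T = 0"
  by (simp add: tensor_inner_def)

lemma tensor_inner_nonneg: "tensor_inner r S S \<ge> 0"
  by (simp add: tensor_inner_def sum_nonneg)

text \<open>The inner product of \<open>trace_part T\<close> with \<open>T\<close> is the sum of the
  squared norms of all contractions of \<open>T\<close>.\<close>

lemma contract_zero_if_trace_part_zero:
  assumes "\<And>js. length js = r \<Longrightarrow> trace_part (mat 1) r T js = 0"
    and "p < q" "q < r" "length js = r - 2"
  shows "contract (mat 1) p q T js = (0::real)"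
proof -
  let ?i = "\<lambda>p q. tensor_inner (r - 2) (contract (mat 1) p q T) (contract (mat 1) p q T)"
  have "(\<Sum>q<r. \<Sum>p<q. ?i p q) = 0"
    using tensor_inner_zero[OF assms(1)] by (simp add: tensor_inner_trace_part[symmetric])
  then have "(\<Sum>p<q. ?i p q) = 0"
    using \<open>q < r\<close> by (subst (asm) sum_nonneg_eq_0_iff) (auto intro!: sum_nonneg tensor_inner_nonneg)
  then have "?i p q = 0"
    using \<open>p < q\<close> by (subst (asm) sum_nonneg_eq_0_iff) (auto intro!: tensor_inner_nonneg)
  then show ?thesis using assms(4) by (rule tensor_inner_self_eq_0)
qed

lemma trace_part_zero:
  "(\<And>p q js. p < q \<Longrightarrow> q < r \<Longrightarrow> length js = r - 2 \<Longrightarrow> contract G p q T js = 0) \<Longrightarrow> length js = r \<Longrightarrow>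
    trace_part G r T js = 0"
  unfolding trace_part_def by (intro sum.neutral ballI) simp

lemma trace_part_add: "trace_part G r (\<lambda>ks. S ks + T ks) js = trace_part G r S js + trace_part G r T js"
  by (simp add: trace_part_def contract_def sum.distrib algebra_simps)

lemma trace_part_mult: "trace_part G r (\<lambda>ks. c * T ks) js = c * trace_part G r T js"
  by (simp add: trace_part_def contract_def sum_distrib_left mult_ac)

text \<open>A self-adjoint operator has the same kernel as its square.\<close>

lemma trace_part_square_zero:
  assumes "\<And>js. length js = r \<Longrightarrow> trace_part (mat 1) r (trace_part (mat 1) r T) js = 0"
    and "length js = r"
  shows "trace_part (mat 1) r T js = (0::real)"
proof -
  have "tensor_inner r (trace_part (mat 1) r T) (trace_part (mat 1) r T)
      = tensor_inner r (trace_part (mat 1) r (trace_part (mat 1) r T)) T"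
    by (rule tensor_inner_trace_part_commute)
  also have "\<dots> = 0" using assms(1) by (rule tensor_inner_zero)
  finally show ?thesis using assms(2) by (rule tensor_inner_self_eq_0)
qed

text \<open>Gaussian elimination: a vector \<open>b0\<close> with nonzero entry at \<open>x\<close>
  clears this coordinate in the other vectors, which leaves one coordinate and one vector
  fewer.\<close>

lemma linear_dependence:
  fixes a :: "'b \<Rightarrow> 'a \<Rightarrow> real"
  assumes "finite A" "finite B" "card A < card B"
  shows "\<exists>c. (\<exists>b\<in>B. c b \<noteq> 0) \<and> (\<forall>x\<in>A. (\<Sum>b\<in>B. c b * a b x) = 0)"
  using assms
proof (induction A arbitrary: B a rule: finite_induct)
  case empty
  then obtain b where "b \<in> B" by fastforce
  then show ?case by (intro exI[of _ "\<lambda>_. 1"]) auto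
next
  case (insert x A)
  show ?case
  proof (cases "\<forall>b\<in>B. a b x = 0")
    case True
    have "card A < card B" using insert by simp
    from insert.IH[OF insert.prems(1) this, of a] obtain c
      where "\<exists>b\<in>B. c b \<noteq> 0" "\<forall>x\<in>A. (\<Sum>b\<in>B. c b * a b x) = 0" by blast
    then show ?thesis using True by (intro exI[of _ c]) auto
  next
    case False
    then obtain b0 where b0: "b0 \<in> B" "a b0 x \<noteq> 0" by blast
    define B' where "B' = B - {b0}"
    have B: "B = insert b0 B'" "b0 \<notin> B'" "finite B'" using b0 insert.prems by (auto simp: B'_def)
    have "card A < card B'" using insert B by simp
    from insert.IH[OF B(3) this, of "\<lambda>b y. a b y - a b x / a b0 x * a b0 y"] obtain c
      where c: "\<exists>b\<in>B'. c b \<noteq> 0" "\<And>y. y \<in> A \<Longrightarrow> (\<Sum>b\<in>B'. c b * (a b y - a b x / a b0 x * a b0 y)) = 0"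
      by blast
    \<comment> \<open>The coefficient of the pivot that makes the combination vanish at
      \<open>x\<close>; it also restores the multiples of the pivot subtracted at the other
      coordinates.\<close>
    define d where "d = - (\<Sum>b\<in>B'. c b * a b x) / a b0 x"
    have s: "(\<Sum>b\<in>B. (c(b0 := d)) b * a b y) = d * a b0 y + (\<Sum>b\<in>B'. c b * a b y)" for y
    proof -
      have "(\<Sum>b\<in>B'. (c(b0 := d)) b * a b y) = (\<Sum>b\<in>B'. c b * a b y)"
        using B(2) by (intro sum.cong) auto
      then show ?thesis using B(2,3) unfolding B(1) by simp
    qed
    have "(\<Sum>b\<in>B. (c(b0 := d)) b * a b y) = 0" if "y \<in> insert x A" for y
    proof (cases "y = x")
      case True
      then show ?thesis unfolding s using b0(2) by (simp add: d_def)
    next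
      case False
      then have "0 = (\<Sum>b\<in>B'. c b * (a b y - a b x / a b0 x * a b0 y))" using c(2) that by simp
      also have "\<dots> = (\<Sum>b\<in>B'. c b * a b y) - (\<Sum>b\<in>B'. c b * a b x) / a b0 x * a b0 y"
        by (simp add: right_diff_distrib sum_subtractf sum_divide_distrib sum_distrib_right sum_distrib_left mult_ac)
      finally show ?thesis unfolding s by (simp add: d_def)
    qed
    moreover have "\<exists>b\<in>B. (c(b0 := d)) b \<noteq> 0" using c(1) B by auto
    ultimately show ?thesis by blast
  qed
qed

lemma funpow_trace_part_sum:
  "length js = r \<Longrightarrow> (trace_part G r ^^ k) (\<lambda>js. \<Sum>i\<in>A. c i * T i js) js
     = (\<Sum>i\<in>A. c i * (trace_part G r ^^ k) (T i) js)"
proof (induction k arbitrary: js)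
  case (Suc k)
  have "trace_part G r ((trace_part G r ^^ k) (\<lambda>js. \<Sum>i\<in>A. c i * T i js)) js
      = trace_part G r (\<lambda>js. \<Sum>i\<in>A. c i * (trace_part G r ^^ k) (T i) js) js"
    using Suc by (intro trace_part_cong) auto
  also have "\<dots> = (\<Sum>i\<in>A. c i * trace_part G r ((trace_part G r ^^ k) (T i)) js)"
  proof (induction A rule: infinite_finite_induct)
    case (insert x F)
    then show ?case by (simp add: trace_part_add trace_part_mult)
  qed (simp_all add: trace_part_def contract_def)
  finally show ?case by simp
qed simp

lemma trace_poly_eq_sum:
  "length js = r \<Longrightarrow> trace_poly G r cs T js = (\<Sum>k<length cs. of_real (cs ! k) * (trace_part G r ^^ k) T js)"
proof (induction cs arbitrary: js)
  case (Cons c cs)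
  have "trace_part G r (trace_poly G r cs T) js
     = trace_part G r (\<lambda>js. \<Sum>k<length cs. of_real (cs ! k) * (trace_part G r ^^ k) T js) js"
    using Cons by (intro trace_part_cong) auto
  also have "\<dots> = (trace_part G r ^^ 1) (\<lambda>js. \<Sum>k<length cs. of_real (cs ! k) * (trace_part G r ^^ k) T js) js"
    by simp
  also have "\<dots> = (\<Sum>k<length cs. of_real (cs ! k) * (trace_part G r ^^ Suc k) T js)"
    using Cons.prems by (subst funpow_trace_part_sum) simp_all
  finally show ?case by (simp add: sum.lessThan_Suc_shift del: sum.lessThan_Suc)
qed simp

text \<open>In the basis of index lists an operator has as many matrix entries as there are pairs of
  lists, so one more power than this number must be linearly dependent.\<close>

lemma trace_poly_annihilator:
  "\<exists>cs. (\<exists>c\<in>set cs. c \<noteq> 0) \<and> (\<forall>T js. length js = r \<longrightarrow> trace_poly (mat 1 :: real^'n::finite^'n) r cs T js = 0)"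
proof -
  let ?I = "{js :: 'n list. length js = r}"
  let ?C = "trace_part (mat 1 :: real^'n^'n) r"
  \<comment> \<open>The basis tensors: the values of the powers on them are the matrix entries of
    the powers.\<close>
  define e where "e ks js = (of_bool (js = ks) :: real)" for ks js :: "'n list"
  let ?N = "Suc (card (?I \<times> ?I))"
  obtain c where c: "\<exists>k\<in>{..<?N}. c k \<noteq> 0"
      "\<forall>x\<in>?I \<times> ?I. (\<Sum>k<?N. c k * (case x of (ks, js) \<Rightarrow> (?C ^^ k) (e ks) js)) = 0"
    using linear_dependence[of "?I \<times> ?I" "{..<?N}" "\<lambda>k (ks, js). (?C ^^ k) (e ks) js"]
      finite_lists_length[of r, where 'n = 'n] by auto
  define cs where "cs = map c [0..<?N]"
  have "trace_poly (mat 1) r cs T js = 0" if js: "length js = r" for T :: "'n list \<Rightarrow> real" and js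
  proof -
    have T: "T ks' = (\<Sum>ks\<in>?I. T ks * e ks ks')" if "length ks' = r" for ks' :: "'n list"
    proof -
      have "(\<Sum>ks\<in>?I. T ks * e ks ks') = (\<Sum>ks\<in>?I. if ks = ks' then T ks else 0)"
        by (rule sum.cong) (auto simp: e_def)
      then show ?thesis using that finite_lists_length[of r, where 'n = 'n] by simp
    qed
    have "trace_poly (mat 1) r cs T js = trace_poly (mat 1) r cs (\<lambda>ks'. \<Sum>ks\<in>?I. T ks * e ks ks') js"
      using js by (intro trace_poly_cong T)
    also have "\<dots> = (\<Sum>k<?N. c k * (\<Sum>ks\<in>?I. T ks * (?C ^^ k) (e ks) js))"
      using js by (simp only: trace_poly_eq_sum funpow_trace_part_sum) (simp add: cs_def del: upt_Suc)
    also have "\<dots> = (\<Sum>ks\<in>?I. T ks * (\<Sum>k<?N. c k * (?C ^^ k) (e ks) js))"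
      unfolding sum_distrib_left by (subst sum.swap) (simp only: mult_ac)
    also have "\<dots> = 0" using c(2) js by (intro sum.neutral) force
    finally show ?thesis .
  qed
  moreover have "\<exists>c\<in>set cs. c \<noteq> 0" using c(1) by (simp add: cs_def atLeast0LessThan del: upt_Suc)
  ultimately show ?thesis by blast
qed

lemma trace_poly_scale:
  "trace_poly G r (map ((*) c) cs) T js = of_real c * trace_poly G r cs T js"
proof (induction cs arbitrary: js)
  case (Cons d cs)
  have "trace_poly G r (map ((*) c) cs) T = (\<lambda>js. of_real c * trace_poly G r cs T js)"
    using Cons by (intro ext)
  then show ?case unfolding list.map trace_poly.simps by (simp add: trace_part_mult ring_distribs)
qed simp

text \<open>In the Euclidean case \<open>trace_part\<close> is symmetric and positive semidefinite, so the factor \<open>x\<^sup>k\<close> of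
  an annihilating polynomial can be lowered to \<open>x\<close>; the cofactor, normalised to have constant term \<open>1\<close>,
  is then the projection onto the kernel of \<open>trace_part\<close>, which consists of the trace-free tensors.\<close>

lemma trace_poly_normalized_annihilator:
  "\<exists>ds. \<forall>T js. length js = r \<longrightarrow>
     trace_part (mat 1 :: real^'n::finite^'n) r (trace_poly (mat 1) r (1 # ds) T) js = 0"
proof -
  \<comment> \<open>The assumption carries an additional factor \<open>trace_part\<close>, which
    makes it stable under the removal of a vanishing constant term.\<close>
  have "\<exists>ds. \<forall>T js. length js = r \<longrightarrow> trace_part (mat 1 :: real^'n^'n) r (trace_poly (mat 1) r (1 # ds) T) js = 0"
    if "\<exists>c\<in>set cs. c \<noteq> 0"
      "\<And>T js. length js = r \<Longrightarrow> trace_part (mat 1 :: real^'n^'n) r (trace_poly (mat 1) r cs T) js = 0" for cs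
    using that
  proof (induction cs)
    case (Cons c cs)
    show ?case
    proof (cases "c = 0")
      \<comment> \<open>The polynomial is \<open>x\<close> times a shorter one. The operator is then
        applied twice to the latter, and one application already gives zero because the square has
        the same kernel.\<close>
      case True
      have *: "trace_part (mat 1 :: real^'n^'n) r (trace_part (mat 1) r (trace_poly (mat 1) r cs T)) js = 0"
        if "length js = r" for T js
        using Cons.prems(2)[OF that, of T] True by simp
      have "trace_part (mat 1 :: real^'n^'n) r (trace_poly (mat 1) r cs T) js = 0"
        if "length js = r" for T js
        using trace_part_square_zero[OF * that] .
      then show ?thesis using Cons.prems(1) True by (intro Cons.IH) simp_all
    next
      case False
      have "trace_part (mat 1 :: real^'n^'n) r (trace_poly (mat 1) r (1 # map ((*) (1 / c)) cs) T) js = 0"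
        if "length js = r" for T js
      proof -
        have "1 # map ((*) (1 / c)) cs = map ((*) (1 / c)) (c # cs)" using False by simp
        then have "trace_poly (mat 1) r (1 # map ((*) (1 / c)) cs) T
            = (\<lambda>js. 1 / c * trace_poly (mat 1 :: real^'n^'n) r (c # cs) T js)"
          by (simp add: trace_poly_scale fun_eq_iff del: list.map trace_poly.simps)
        then show ?thesis
          using Cons.prems(2)[OF that, of T] by (simp only: trace_part_mult)
      qed
      then show ?thesis by blast
    qed
  qed simp
  moreover obtain cs where cs: "\<exists>c\<in>set cs. c \<noteq> 0"
    "\<And>T js. length js = r \<Longrightarrow> trace_poly (mat 1 :: real^'n^'n) r cs T js = 0"
    using trace_poly_annihilator by metis
  moreover have "trace_part (mat 1 :: real^'n^'n) r (trace_poly (mat 1) r cs T) js = 0" if "length js = r" for T js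
  proof -
    have "trace_part (mat 1 :: real^'n^'n) r (trace_poly (mat 1) r cs T) js
       = trace_part (mat 1 :: real^'n^'n) r (\<lambda>_. 0) js"
      using that cs(2) by (intro trace_part_cong) auto
    then show ?thesis by (simp add: trace_part_def contract_def)
  qed
  ultimately show ?thesis by blast
qed

section \<open>Trace polynomials and the trace-free projection over the complex numbers\<close>

lemma matrix_inv_cmat:
  assumes "invertible G"
  shows "invertible (cmat G)" and "matrix_inv (cmat G) = cmat (matrix_inv G)"
proof -
  have m: "cmat A ** cmat B = cmat (A ** B)" for A B :: "real^'n^'n"
    by (simp add: vec_eq_iff cmat_def matrix_matrix_mult_def)
  have 1: "cmat (mat 1) = mat 1" by (simp add: vec_eq_iff cmat_def mat_def)
  have *: "cmat G ** cmat (matrix_inv G) = mat 1" "cmat (matrix_inv G) ** cmat G = mat 1"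
    using matrix_inv_right[OF assms] matrix_inv_left[OF assms] by (simp_all add: m 1)
  show "matrix_inv (cmat G) = cmat (matrix_inv G)"
    using *(1) by (rule matrix_inv_unique)
  show "invertible (cmat G)" using * unfolding invertible_def by blast
qed

lemma contract_cten:
  assumes "invertible G"
  shows "contract (cmat G) p q (cten T) js = of_real (contract G p q T js)"
  by (simp add: contract_def matrix_inv_cmat[OF assms]) (simp add: cmat_def cten_def)

lemma trace_part_cten:
  assumes "invertible G"
  shows "trace_part (cmat G) r (cten T) js = of_real (trace_part G r T js)"
  by (simp add: trace_part_def contract_cten[OF assms]) (simp add: cmat_def)

lemma trace_poly_cten:
  assumes "invertible G"
  shows "trace_poly (cmat G) r cs (cten T) js = of_real (trace_poly G r cs T js)"
proof (induction cs arbitrary: js)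
  case (Cons c cs)
  have "trace_poly (cmat G) r cs (cten T) = cten (trace_poly G r cs T)"
    using Cons by (auto simp: cten_def)
  then show ?case by (simp add: trace_part_cten[OF assms]) (simp add: cten_def)
qed simp

text \<open>With the entries 0 and 1 of the metric worked out, the coefficients are visibly real, so
  that real and imaginary parts can be taken inside.\<close>

lemma trace_part_mat_1:
  "trace_part (mat 1) r T js = (\<Sum>q<r. \<Sum>p<q. if js ! p = js ! q then
     \<Sum>a\<in>UNIV. T (insert_index q a (insert_index p a (delete_index p (delete_index q js)))) else 0)"
  unfolding trace_part_def contract_mat_1 by (intro sum.cong refl) (simp add: mat_def)

lemma Re_trace_poly_mat_1:
  fixes T :: "'n::finite list \<Rightarrow> complex"
  shows "Re (trace_poly (mat 1) r cs T js) = trace_poly (mat 1) r cs (\<lambda>js. Re (T js)) js"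
proof (induction cs arbitrary: js)
  case (Cons c cs)
  have "Re (trace_part (mat 1) r X js) = trace_part (mat 1) r (\<lambda>js. Re (X js)) js"
    for X :: "'n list \<Rightarrow> complex" and js
    unfolding trace_part_mat_1 Re_sum by (intro sum.cong refl) simp
  then show ?case by (simp add: Cons)
qed simp

lemma Im_trace_poly_mat_1:
  fixes T :: "'n::finite list \<Rightarrow> complex"
  shows "Im (trace_poly (mat 1) r cs T js) = trace_poly (mat 1) r cs (\<lambda>js. Im (T js)) js"
proof (induction cs arbitrary: js)
  case (Cons c cs)
  have "Im (trace_part (mat 1) r X js) = trace_part (mat 1) r (\<lambda>js. Im (X js)) js"
    for X :: "'n list \<Rightarrow> complex" and js
    unfolding trace_part_mat_1 Im_sum by (intro sum.cong refl) simp
  then show ?case by (simp add: Cons)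
qed simp

text \<open>The difference of the two candidates is trace-free and also a sum of products with the
  metric. These two spaces are orthogonal, so the difference is orthogonal to itself.\<close>

lemma trace_poly_eq_trace_free_euclidean:
  assumes ds: "\<And>T js. length js = r \<Longrightarrow> trace_part (mat 1 :: real^'n::finite^'n) r (trace_poly (mat 1) r (1 # ds) T) js = 0"
    and tf: "trace_free_projection (mat 1 :: real^'n^'n) r T W" and js: "length js = r"
  shows "W js = trace_poly (mat 1) r (1 # ds) T js"
proof -
  from tf obtain S where tr: "\<And>p q js. p < q \<Longrightarrow> q < r \<Longrightarrow> length js = r - 2 \<Longrightarrow> contract (mat 1) p q W js = 0"
    and S: "\<And>js. length js = r \<Longrightarrow> T js - W js =
      (\<Sum>q<r. \<Sum>p<q. mat 1 $ (js ! p) $ (js ! q) * S p q (delete_index p (delete_index q js)))"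
    by (auto simp: trace_free_projection_def)
  define Y where "Y = trace_poly (mat 1) r ds T"
  define Z where "Z js = trace_poly (mat 1) r (1 # ds) T js - W js" for js
  have Z: "Z js = (\<Sum>q<r. \<Sum>p<q. mat 1 $ (js ! p) $ (js ! q) *
      (S p q (delete_index p (delete_index q js)) + contract (mat 1) p q Y (delete_index p (delete_index q js))))"
    if "length js = r" for js
  proof -
    have "Z js = (T js - W js) + trace_part (mat 1) r Y js" by (simp add: Z_def Y_def)
    then show ?thesis unfolding S[OF that] trace_part_def by (simp add: sum.distrib ring_distribs)
  qed
  have trZ: "trace_part (mat 1) r Z js = 0" if "length js = r" for js
  proof -
    have "trace_part (mat 1) r Z js
        = trace_part (mat 1) r (trace_poly (mat 1) r (1 # ds) T) js + (-1) * trace_part (mat 1) r W js"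
      unfolding trace_part_mult[symmetric] trace_part_add[symmetric] by (simp add: Z_def[abs_def])
    also have "trace_part (mat 1) r W js = 0" using tr that by (rule trace_part_zero)
    finally show ?thesis using ds[OF that] by simp
  qed
  let ?S' = "\<lambda>p q ks. S p q ks + contract (mat 1) p q Y ks"
  have "tensor_inner r Z Z = tensor_inner r (\<lambda>js. \<Sum>q<r. \<Sum>p<q. mat 1 $ (js ! p) $ (js ! q) *
      ?S' p q (delete_index p (delete_index q js))) Z"
    unfolding tensor_inner_def using Z by (intro sum.cong refl) simp
  also have "\<dots> = (\<Sum>q<r. \<Sum>p<q. tensor_inner (r - 2) (?S' p q) (contract (mat 1) p q Z))"
    by (rule tensor_inner_sum_metric)
  also have "\<dots> = 0"
  proof (intro sum.neutral ballI)
    fix q p assume "q \<in> {..<r}" "p \<in> {..<q}"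
    then show "tensor_inner (r - 2) (?S' p q) (contract (mat 1) p q Z) = 0"
      using contract_zero_if_trace_part_zero[OF trZ]
      by (subst tensor_inner_commute, intro tensor_inner_zero) auto
  qed
  finally have "Z js = 0" using js by (rule tensor_inner_self_eq_0)
  then show ?thesis by (simp add: Z_def)
qed

lemma trace_poly_eq_trace_free_euclidean_complex:
  assumes ds: "\<And>T js. length js = r \<Longrightarrow> trace_part (mat 1 :: real^'n::finite^'n) r (trace_poly (mat 1) r (1 # ds) T) js = 0"
    and tf: "trace_free_projection (mat 1 :: complex^'n^'n) r T W" and js: "length js = r"
  shows "W js = trace_poly (mat 1) r (1 # ds) T js"
proof -
  from tf obtain S where tr: "\<And>p q js. p < q \<Longrightarrow> q < r \<Longrightarrow> length js = r - 2 \<Longrightarrow> contract (mat 1) p q W js = 0"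
    and S: "\<And>js. length js = r \<Longrightarrow> T js - W js =
      (\<Sum>q<r. \<Sum>p<q. mat 1 $ (js ! p) $ (js ! q) * S p q (delete_index p (delete_index q js)))"
    by (auto simp: trace_free_projection_def)
  have real_part: "trace_free_projection (mat 1) r (\<lambda>js. f (T js)) (\<lambda>js. f (W js))"
    if "f = Re \<or> f = Im" for f
  proof -
    have f: "f (x - y) = f x - f y" "f 0 = 0" "f (sum g A) = (\<Sum>i\<in>A. f (g i))" for x y g and A :: "'x set"
      using that by auto
    have fm: "f (mat 1 $ i $ j * x) = mat 1 $ i $ j * f x" for i j :: 'n and x
      using that by (auto simp: mat_def)
    show ?thesis
      unfolding trace_free_projection_def
    proof (intro conjI allI impI exI[of _ "\<lambda>p q js. f (S p q js)"])
      fix p q and js :: "'n list" assume "p < q" "q < r" "length js = r - 2"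
      from tr[OF this] show "contract (mat 1) p q (\<lambda>js. f (W js)) js = 0"
        unfolding contract_mat_1 using that by (auto simp: complex_eq_iff)
    next
      fix js :: "'n list" assume "length js = r"
      have "f (T js) - f (W js) = f (T js - W js)" using that by auto
      also have "\<dots> = (\<Sum>q<r. \<Sum>p<q. f (mat 1 $ (js ! p) $ (js ! q) * S p q (delete_index p (delete_index q js))))"
        unfolding S[OF \<open>length js = r\<close>] using that by auto
      finally show "f (T js) - f (W js) =
         (\<Sum>q<r. \<Sum>p<q. mat 1 $ (js ! p) $ (js ! q) * f (S p q (delete_index p (delete_index q js))))"
        unfolding fm .
    qed
  qed
  show ?thesis
    using trace_poly_eq_trace_free_euclidean[OF ds real_part[of Re] js]
      trace_poly_eq_trace_free_euclidean[OF ds real_part[of Im] js]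
    by (auto simp: complex_eq_iff Re_trace_poly_mat_1 Im_trace_poly_mat_1 simp del: trace_poly.simps)
qed

lemma trace_free_projection_pull:
  fixes G :: "'k::real_normed_field^'n::finite^'n"
  assumes G: "invertible G" and E: "invertible (frame_matrix E)"
    and tf: "trace_free_projection G r T W"
  shows "trace_free_projection (pullm E G) r (pull E T) (pull E W)"
proof -
  from tf obtain S where tr: "\<And>p q js. p < q \<Longrightarrow> q < r \<Longrightarrow> length js = r - 2 \<Longrightarrow> contract G p q W js = 0"
    and S: "\<And>js. length js = r \<Longrightarrow> T js - W js =
      (\<Sum>q<r. \<Sum>p<q. G $ (js ! p) $ (js ! q) * S p q (delete_index p (delete_index q js)))"
    by (auto simp: trace_free_projection_def)
  show ?thesis
    unfolding trace_free_projection_def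
  proof (intro conjI allI impI exI[of _ "\<lambda>p q. pull E (S p q)"])
    fix p q and js :: "'n list" assume pq: "p < q" "q < r" and js: "length js = r - 2"
    have "contract (pullm E G) p q (pull E W) js = pull E (contract G p q W) js"
      using G E by (rule contract_pull) (use pq js in auto)
    also have "\<dots> = teval (map E js) (\<lambda>_. 0)"
      unfolding pull_def using js by (intro teval_cong tr pq) simp
    finally show "contract (pullm E G) p q (pull E W) js = 0" by simp
  next
    fix js :: "'n list" assume js: "length js = r"
    have "pull E T js - pull E W js = teval (map E js) (\<lambda>js. T js - W js)"
      by (simp add: pull_def teval_diff)
    also have "\<dots> = teval (map E js) (\<lambda>js. \<Sum>q<r. \<Sum>p<q. G $ (js ! p) $ (js ! q) *
        S p q (delete_index p (delete_index q js)))"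
      using js by (intro teval_cong S) simp
    also have "\<dots> = (\<Sum>q<r. \<Sum>p<q. pullm E G $ (js ! p) $ (js ! q) * pull E (S p q) (delete_index p (delete_index q js)))"
      unfolding teval_sum
    proof (intro sum.cong refl)
      fix q p assume "q \<in> {..<r}" "p \<in> {..<q}"
      then have "p < q" "q < length (map E js)" using js by auto
      then show "teval (map E js) (\<lambda>js. G $ (js ! p) $ (js ! q) * S p q (delete_index p (delete_index q js)))
        = pullm E G $ (js ! p) $ (js ! q) * pull E (S p q) (delete_index p (delete_index q js))"
        by (subst teval_metric_times) (simp_all add: pullm_def pull_def map_delete_index)
    qed
    finally show "pull E T js - pull E W js = (\<Sum>q<r. \<Sum>p<q. pullm E G $ (js ! p) $ (js ! q) *
       pull E (S p q) (delete_index p (delete_index q js)))" .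
  qed
qed

lemma trace_free_projection_cten:
  fixes G :: "real^'n::finite^'n"
  assumes G: "invertible G" and tf: "trace_free_projection G r T W"
  shows "trace_free_projection (cmat G) r (cten T) (cten W)"
proof -
  from tf obtain S where tr: "\<And>p q js. p < q \<Longrightarrow> q < r \<Longrightarrow> length js = r - 2 \<Longrightarrow> contract G p q W js = 0"
    and S: "\<And>js. length js = r \<Longrightarrow> T js - W js =
      (\<Sum>q<r. \<Sum>p<q. G $ (js ! p) $ (js ! q) * S p q (delete_index p (delete_index q js)))"
    by (auto simp: trace_free_projection_def)
  show ?thesis
    unfolding trace_free_projection_def
  proof (intro conjI allI impI exI[of _ "\<lambda>p q. cten (S p q)"])
    fix js :: "'n list" assume "length js = r"
    have "cten T js - cten W js = of_real (T js - W js)" by (simp add: cten_def)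
    then show "cten T js - cten W js = (\<Sum>q<r. \<Sum>p<q. cmat G $ (js ! p) $ (js ! q) *
        cten (S p q) (delete_index p (delete_index q js)))"
      unfolding S[OF \<open>length js = r\<close>] by (simp add: cten_def cmat_def)
  qed (simp add: contract_cten[OF G] tr)
qed

text \<open>Over the complex numbers a Lorentzian metric has an orthonormal frame, which reduces the claim to
  the Euclidean metric.\<close>

lemma trace_free_projection_eq_trace_poly:
  "\<exists>cs. \<forall>(G :: real^'n::finite^'n) T W js. lorentzian_form G \<longrightarrow> trace_free_projection G r T W \<longrightarrow>
     length js = r \<longrightarrow> W js = trace_poly G r cs T js"
proof -
  obtain ds where ds: "\<And>T js. length js = r \<Longrightarrow> trace_part (mat 1 :: real^'n^'n) r (trace_poly (mat 1) r (1 # ds) T) js = 0"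
    using trace_poly_normalized_annihilator by blast
  have "W js = trace_poly G r (1 # ds) T js"
    if "lorentzian_form G" and tf: "trace_free_projection G r T W" and js: "length js = r"
    for G :: "real^'n^'n" and T W js
  proof -
    obtain F :: "'n \<Rightarrow> real^'n" and t where F: "\<And>i j. bilin G (F i) (F j) = (if i \<noteq> j then 0 else if i = t then - 1 else 1)"
      using \<open>lorentzian_form G\<close> by (auto simp: lorentzian_form_def)
    \<comment> \<open>The factor \<i> turns the square -1 of the timelike vector into 1.\<close>
    define E where "E i = (if i = t then \<i> else 1) *s cvec (F i)" for i
    have "pullm E (cmat G) = mat 1"
      by (simp add: vec_eq_iff pullm_def E_def bilin_scale_left bilin_scale_right bilin_cmat F mat_def)
    then have E: "pullm E (cmat G) = mat 1" "invertible (frame_matrix E)"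
      using frame_expand(2)[of E "cmat G" "mat 1"] by simp_all
    have G: "invertible G"
    proof -
      have "pullm F G ** pullm F G = mat 1"
      proof -
        have "pullm F G = (\<chi> i j. if j = i then (if i = t then - 1 else 1) else 0)"
          by (simp add: vec_eq_iff pullm_def F)
        then show ?thesis
          by (simp add: vec_eq_iff matrix_matrix_mult_def mat_def if_distrib[of "\<lambda>x. x * _"] cong: if_cong)
      qed
      then have "(pullm F G ** transpose (frame_matrix F)) ** G ** frame_matrix F = mat 1"
        by (simp add: pullm_eq matrix_mul_assoc)
      then have "frame_matrix F ** (pullm F G ** transpose (frame_matrix F) ** G) = mat 1"
        by (simp add: matrix_left_right_inverse)
      then have r: "frame_matrix F ** (pullm F G ** transpose (frame_matrix F)) ** G = mat 1"
        by (simp add: matrix_mul_assoc)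
      then show ?thesis using invertible_left_inverse by blast
    qed
    note Gc = matrix_inv_cmat(1)[OF G]
    have "trace_free_projection (mat 1) r (pull E (cten T)) (pull E (cten W))"
      using trace_free_projection_pull[OF Gc E(2) trace_free_projection_cten[OF G tf]] by (simp add: E)
    \<comment> \<open>In the frame \<open>E\<close> the metric is Euclidean, where the polynomial is
      known to give the projection; both sides are natural, so the equality descends to the original
      coordinates.\<close>
    then have "pull E (cten W) js = pull E (trace_poly (cmat G) r (1 # ds) (cten T)) js" if "length js = r" for js
      using trace_poly_eq_trace_free_euclidean_complex[OF ds _ that] trace_poly_pull[OF Gc E(2) that, of "1 # ds" "cten T"]
      by (simp only: E(1))
    from pull_inject[OF E(2) this js] show ?thesis
      by (simp only: trace_poly_cten[OF G]) (simp only: cten_def of_real_eq_iff)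
  qed
  then show ?thesis by blast
qed

section \<open>Holomorphic functions of several variables\<close>

lemma holomorphic_several_onI:
  assumes "\<And>z. z \<in> S \<Longrightarrow> \<exists>D. (f has_derivative D) (at z) \<and> (\<forall>c v. D (c *s v) = c * D v)"
  shows "holomorphic_several_on S f"
  using assms by (simp add: holomorphic_several_on_def)

lemma holomorphic_several_on_frechet:
  assumes "holomorphic_several_on S f" "z \<in> S"
  shows "(f has_derivative frechet_derivative f (at z)) (at z)"
    and "frechet_derivative f (at z) (c *s v) = c * frechet_derivative f (at z) v"
proof -
  obtain D where D: "(f has_derivative D) (at z)" "\<And>c v. D (c *s v) = c * D v"
    using assms unfolding holomorphic_several_on_def by blast
  have "frechet_derivative f (at z) = D" using frechet_derivative_at[OF D(1)] by simp
  then show "(f has_derivative frechet_derivative f (at z)) (at z)"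
    and "frechet_derivative f (at z) (c *s v) = c * frechet_derivative f (at z) v"
    using D by auto
qed

lemma holomorphic_several_on_frechet_expand:
  assumes "holomorphic_several_on S f" "z \<in> S"
  shows "frechet_derivative f (at z) v = (\<Sum>i\<in>UNIV. v $ i * partial_deriv i f z)"
proof -
  have lin: "linear (frechet_derivative f (at z))"
    using holomorphic_several_on_frechet(1)[OF assms] has_derivative_linear by blast
  have "frechet_derivative f (at z) v = frechet_derivative f (at z) (\<Sum>i\<in>UNIV. v $ i *s axis i 1)"
    by (simp add: basis_expansion)
  also have "\<dots> = (\<Sum>i\<in>UNIV. v $ i * partial_deriv i f z)"
    by (simp add: linear_sum[OF lin] holomorphic_several_on_frechet(2)[OF assms] partial_deriv_def)
  finally show ?thesis .
qed

lemma holomorphic_several_on_cong: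
  assumes "open S" "\<And>z. z \<in> S \<Longrightarrow> f z = g z"
  shows "holomorphic_several_on S f = holomorphic_several_on S g"
proof -
  have "holomorphic_several_on S g" if f: "holomorphic_several_on S f" and eq: "\<And>z. z \<in> S \<Longrightarrow> f z = g z" for f g
  proof (rule holomorphic_several_onI)
    fix z assume z: "z \<in> S"
    then obtain D where "(f has_derivative D) (at z)" "\<forall>c v. D (c *s v) = c * D v"
      using f unfolding holomorphic_several_on_def by blast
    moreover from this(1) have "(g has_derivative D) (at z)"
      by (rule has_derivative_transform_within_open[OF _ assms(1) z]) (rule eq)
    ultimately show "\<exists>D. (g has_derivative D) (at z) \<and> (\<forall>c v. D (c *s v) = c * D v)" by blast
  qed
  from this[of f g] this[of g f] assms(2) show ?thesis by metis
qed

lemma holomorphic_several_on_const: "holomorphic_several_on S (\<lambda>z. c)"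
  by (rule holomorphic_several_onI) (auto intro!: exI[of _ "\<lambda>_. 0"])

lemma holomorphic_several_on_add:
  assumes "holomorphic_several_on S f" "holomorphic_several_on S g"
  shows "holomorphic_several_on S (\<lambda>z. f z + g z)"
proof (rule holomorphic_several_onI)
  fix z assume "z \<in> S"
  note f = holomorphic_several_on_frechet[OF assms(1) this] and g = holomorphic_several_on_frechet[OF assms(2) this]
  show "\<exists>D. ((\<lambda>z. f z + g z) has_derivative D) (at z) \<and> (\<forall>c v. D (c *s v) = c * D v)"
    by (rule exI, rule conjI, rule has_derivative_add[OF f(1) g(1)]) (simp add: f(2) g(2) algebra_simps)
qed

lemma holomorphic_several_on_mult:
  assumes "holomorphic_several_on S f" "holomorphic_several_on S g"
  shows "holomorphic_several_on S (\<lambda>z. f z * g z)"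
proof (rule holomorphic_several_onI)
  fix z assume "z \<in> S"
  note f = holomorphic_several_on_frechet[OF assms(1) this] and g = holomorphic_several_on_frechet[OF assms(2) this]
  show "\<exists>D. ((\<lambda>z. f z * g z) has_derivative D) (at z) \<and> (\<forall>c v. D (c *s v) = c * D v)"
    by (rule exI, rule conjI, rule has_derivative_mult[OF f(1) g(1)]) (simp add: f(2) g(2) algebra_simps)
qed

lemma holomorphic_several_on_inverse:
  assumes "holomorphic_several_on S f" "\<And>z. z \<in> S \<Longrightarrow> f z \<noteq> 0"
  shows "holomorphic_several_on S (\<lambda>z. inverse (f z))"
proof (rule holomorphic_several_onI)
  fix z assume z: "z \<in> S"
  note f = holomorphic_several_on_frechet[OF assms(1) this]
  show "\<exists>D. ((\<lambda>z. inverse (f z)) has_derivative D) (at z) \<and> (\<forall>c v. D (c *s v) = c * D v)"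
    by (rule exI, rule conjI, rule Deriv.has_derivative_inverse[OF assms(2)[OF z] f(1)]) (simp add: f(2))
qed

lemma holomorphic_several_on_sum:
  "(\<And>i. i \<in> A \<Longrightarrow> holomorphic_several_on S (f i)) \<Longrightarrow> holomorphic_several_on S (\<lambda>z. \<Sum>i\<in>A. f i z)"
  by (induction A rule: infinite_finite_induct)
     (simp_all add: holomorphic_several_on_const holomorphic_several_on_add)

lemma holomorphic_several_on_prod:
  "(\<And>i. i \<in> A \<Longrightarrow> holomorphic_several_on S (f i)) \<Longrightarrow> holomorphic_several_on S (\<lambda>z. \<Prod>i\<in>A. f i z)"
  by (induction A rule: infinite_finite_induct)
     (simp_all add: holomorphic_several_on_const holomorphic_several_on_mult)

lemma holomorphic_several_on_diff:
  assumes "holomorphic_several_on S f" "holomorphic_several_on S g"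
  shows "holomorphic_several_on S (\<lambda>z. f z - g z)"
proof -
  have "holomorphic_several_on S (\<lambda>z. f z + (-1) * g z)"
    by (intro holomorphic_several_on_add holomorphic_several_on_mult holomorphic_several_on_const assms)
  then show ?thesis by simp
qed

lemma holomorphic_several_on_divide:
  assumes "holomorphic_several_on S f" "holomorphic_several_on S g" "\<And>z. z \<in> S \<Longrightarrow> g z \<noteq> 0"
  shows "holomorphic_several_on S (\<lambda>z. f z / g z)"
  unfolding divide_inverse
  by (intro holomorphic_several_on_mult holomorphic_several_on_inverse assms)

lemma holomorphic_several_on_imp_continuous_on:
  "holomorphic_several_on S f \<Longrightarrow> continuous_on S f"
  by (meson holomorphic_several_on_frechet(1) has_derivative_continuous continuous_at_imp_continuous_on)

text \<open>Cauchy's formula for the first derivative at the centre of a circle. With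
  \<open>u = r exp(2 pi i t)\<close> one has \<open>du = 2 pi i u dt\<close>, which turns the kernel
  \<open>u^-2\<close> into \<open>u^-1\<close> and cancels the prefactor. The point \<open>z\<close>
  enters only through \<open>f\<close>, and the domain of integration is a fixed interval.\<close>

lemma partial_deriv_Cauchy:
  fixes z :: "complex^'n::finite"
  assumes f: "holomorphic_several_on S f" and r: "r > 0"
    and S: "\<And>w. norm w < 2 * r \<Longrightarrow> z + w *s axis i 1 \<in> S"
  shows "partial_deriv i f z = integral (cbox 0 1)
     (\<lambda>t. f (z + (of_real r * exp (2 * of_real pi * \<i> * of_real t)) *s axis i 1)
       * inverse (of_real r * exp (2 * of_real pi * \<i> * of_real t)))"
proof -
  define g where "g w = f (z + w *s axis i 1)" for w
  have lin: "bounded_linear (\<lambda>w::complex. w *s (axis i 1 :: complex^'n))"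
    by (rule linear_conv_bounded_linear[THEN iffD1])
       (auto intro!: linearI simp: vec_eq_iff algebra_simps)
  have dg: "(g has_field_derivative partial_deriv i f (z + w *s axis i 1)) (at w)" if "norm w < 2 * r" for w
  proof -
    note D = holomorphic_several_on_frechet[OF f S[OF that]]
    have "((\<lambda>w. z + w *s axis i 1) has_derivative (\<lambda>h. h *s axis i 1)) (at w)"
      by (rule has_derivative_eq_rhs, rule has_derivative_add[OF has_derivative_const bounded_linear_imp_has_derivative[OF lin]]) simp
    from diff_chain_at[OF this D(1)]
    have "(g has_derivative (\<lambda>h. h * partial_deriv i f (z + w *s axis i 1))) (at w)"
      by (simp add: o_def g_def[abs_def] D(2) partial_deriv_def)
    then show ?thesis by (simp add: has_field_derivative_def mult.commute[of _ "partial_deriv _ _ _"])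
  qed
  have hol: "g holomorphic_on ball 0 (2 * r)"
    by (rule holomorphic_onI) (use dg in \<open>auto simp: field_differentiable_def intro: has_field_derivative_at_within\<close>)
  have c: "continuous_on (cball 0 r) g"
    using r by (intro continuous_on_subset[OF holomorphic_on_imp_continuous_on[OF hol]]) auto
  have h: "g holomorphic_on ball 0 r"
    using r by (intro holomorphic_on_subset[OF hol]) auto
  have "deriv g 0 = partial_deriv i f z"
    using DERIV_imp_deriv[OF dg[of 0]] r by simp
  moreover have "contour_integral (circlepath 0 r) (\<lambda>u. g u / (u - 0)^2) = (2 * pi * \<i>) * deriv g 0"
    using r by (intro Cauchy_contour_integral_circlepath_2 c h) simp
  ultimately have "partial_deriv i f z = 1 / (2 * pi * \<i>) * contour_integral (circlepath 0 r) (\<lambda>u. g u / u^2)"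
    by simp
  also have "contour_integral (circlepath 0 r) (\<lambda>u. g u / u^2)
     = integral (cbox 0 1) (\<lambda>t. (2 * pi * \<i>) * (f (z + (of_real r * exp (2 * of_real pi * \<i> * of_real t)) *s axis i 1)
       * inverse (of_real r * exp (2 * of_real pi * \<i> * of_real t))))"
    unfolding contour_integral_integral vector_derivative_circlepath unfolding circlepath g_def box_real
    using r by (intro Henstock_Kurzweil_Integration.integral_cong) (simp add: field_simps power2_eq_square)
  finally show ?thesis by (simp add: integral_mult_right)
qed

text \<open>Cauchy's formula in the \<open>i\<close>-th variable is differentiated under the integral sign. Leibniz's rule
  needs continuous first partial derivatives; these come from Cauchy's formula as well.\<close>

lemma holomorphic_several_on_partial_deriv:
  fixes f :: "complex^'n::finite \<Rightarrow> complex"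
  assumes f: "holomorphic_several_on S f" and S: "open S"
  shows "holomorphic_several_on S (partial_deriv i f)"
proof -
  \<comment> \<open>One radius for the motion of \<open>z\<close> around \<open>z0\<close> and two
    for the disc around \<open>z\<close> on which Cauchy's formula is applied.\<close>
  have "\<exists>r>0. ball z0 (3 * r) \<subseteq> S" if z0: "z0 \<in> S" for z0
  proof -
    obtain e where "e > 0" "ball z0 e \<subseteq> S" using S z0 open_contains_ball by blast
    then show ?thesis by (intro exI[of _ "e / 3"]) simp
  qed
  then obtain \<rho> where \<rho>: "\<And>z0. z0 \<in> S \<Longrightarrow> \<rho> z0 > 0" "\<And>z0. z0 \<in> S \<Longrightarrow> ball z0 (3 * \<rho> z0) \<subseteq> S" by metis
  define w where "w z0 t = of_real (\<rho> z0) * exp (2 * of_real pi * \<i> * of_real t)" for z0 t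
  define h where "h z0 t = inverse (w z0 t)" for z0 t
  have axis: "norm (c *s axis i 1 :: complex^'n) \<le> norm c" for c :: complex and i :: 'n
  proof -
    have "norm (c *s axis i 1 :: complex^'n) \<le> (\<Sum>j\<in>UNIV. norm ((c *s axis i 1 :: complex^'n) $ j))"
      unfolding norm_vec_def by (rule L2_set_le_sum) simp
    also have "\<dots> = (\<Sum>j\<in>UNIV. if j = i then norm c else 0)"
      by (rule sum.cong) (auto simp: axis_def)
    finally show ?thesis by simp
  qed
  have in_S: "z + c *s axis i 1 \<in> S" if "z0 \<in> S" "z \<in> ball z0 (\<rho> z0)" "norm c < 2 * \<rho> z0" for z0 z c i
  proof -
    have "dist z0 (z + c *s axis i 1) \<le> dist z0 z + norm (c *s axis i 1 :: complex^'n)"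
      using dist_triangle[of z0 "z + c *s axis i 1" z] by (simp add: dist_norm)
    then have "z + c *s axis i 1 \<in> ball z0 (3 * \<rho> z0)" using that axis[of c i] by simp
    then show ?thesis using \<rho>(2)[OF that(1)] by blast
  qed
  have norm_w: "norm (w z0 t) = \<rho> z0" if "z0 \<in> S" for z0 t
    using \<rho>(1)[OF that] by (simp add: w_def norm_mult norm_exp_eq_Re)
  have w_S: "z + w z0 t *s axis i 1 \<in> S" if "z0 \<in> S" "z \<in> ball z0 (\<rho> z0)" for z0 z t i
    using in_S[OF that, of "w z0 t"] norm_w[OF that(1)] \<rho>(1)[OF that(1)] by simp
  have w_nz: "w z0 t \<noteq> 0" if "z0 \<in> S" for z0 t
    using norm_w[OF that] \<rho>(1)[OF that] by (metis norm_zero less_irrefl)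
  have cw: "continuous_on X (w z0)" for X z0
    unfolding w_def by (intro continuous_intros)
  have ch: "continuous_on X (h z0)" if "z0 \<in> S" for X z0
    unfolding h_def using w_nz[OF that] by (intro continuous_intros cw) auto
  \<comment> \<open>The same radius serves for all \<open>z\<close> near \<open>z0\<close>, so
    \<open>z\<close> is a parameter in an integral over a fixed interval.\<close>
  have Cauchy: "partial_deriv i f z = integral (cbox 0 1) (\<lambda>t. f (z + w z0 t *s axis i 1) * h z0 t)"
    if "z0 \<in> S" "z \<in> ball z0 (\<rho> z0)" for i z z0
    unfolding w_def h_def by (rule partial_deriv_Cauchy[OF f \<rho>(1)[OF that(1)] in_S[OF that]])
  have c_arg: "continuous_on (ball z0 (\<rho> z0) \<times> cbox 0 1) (\<lambda>x. g (fst x + w z0 (snd x) *s axis i 1))"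
    if z0: "z0 \<in> S" and g: "continuous_on S g" for z0 i and g :: "complex^'n \<Rightarrow> complex"
  proof (rule continuous_on_compose2[OF g])
    have "continuous_on (ball z0 (\<rho> z0) \<times> cbox 0 1) (\<lambda>x. w z0 (snd x))"
      by (rule continuous_on_compose2[OF cw[of UNIV]]) (auto intro: continuous_intros)
    then have "continuous_on (ball z0 (\<rho> z0) \<times> cbox 0 1) (\<lambda>x. if j = i then w z0 (snd x) else 0)" for j
      by (cases "j = i") simp_all
    then have "continuous_on (ball z0 (\<rho> z0) \<times> cbox 0 1) (\<lambda>x. fst x + axis i (w z0 (snd x)) :: complex^'n)"
      unfolding axis_def by (intro continuous_intros continuous_on_vec_lambda)
    moreover have "c *s axis i 1 = (axis i c :: complex^'n)" for c by (simp add: vec_eq_iff axis_def)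
    ultimately show "continuous_on (ball z0 (\<rho> z0) \<times> cbox 0 1) (\<lambda>x. fst x + w z0 (snd x) *s axis i 1 :: complex^'n)"
      by simp
  qed (use w_S[OF z0] in auto)
  have c_h: "continuous_on (ball z0 (\<rho> z0) \<times> cbox 0 1) (\<lambda>x. h z0 (snd x))" if "z0 \<in> S" for z0
    by (intro continuous_on_compose2[OF ch[OF that, of UNIV]] continuous_intros) auto
  have c_f: "continuous_on S f" by (rule holomorphic_several_on_imp_continuous_on[OF f])
  have c_pd: "continuous_on S (partial_deriv i f)" for i
  proof (rule continuous_at_imp_continuous_on, rule ballI)
    fix z0 assume z0: "z0 \<in> S"
    have "continuous_on (ball z0 (\<rho> z0)) (\<lambda>z. integral (cbox 0 1) (\<lambda>t. f (z + w z0 t *s axis i 1) * h z0 t))"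
      by (rule integral_continuous_on_param)
         (simp only: case_prod_unfold, intro continuous_intros c_arg c_f c_h z0)
    then have "continuous_on (ball z0 (\<rho> z0)) (partial_deriv i f)"
      by (rule continuous_on_eq) (rule Cauchy[OF z0, symmetric])
    then show "isCont (partial_deriv i f) z0"
      using \<rho>(1)[OF z0] by (simp add: continuous_on_eq_continuous_at)
  qed
  show ?thesis
  proof (rule holomorphic_several_onI)
    fix z0 assume z0: "z0 \<in> S"
    define D where "D z t v = (\<Sum>j\<in>UNIV. v $ j * partial_deriv j f (z + w z0 t *s axis i 1)) * h z0 t" for z t v
    have bl: "bounded_linear (D z t)" for z t
      by (rule linear_conv_bounded_linear[THEN iffD1])
         (auto intro!: linearI simp: D_def ring_distribs sum.distrib sum_distrib_left sum_distrib_right scaleR_sum_right mult_ac)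
    \<comment> \<open>Leibniz's rule takes the derivatives in the parameter as bounded linear
      operators and integrates them as such.\<close>
    define B where "B z t = Blinfun (D z t)" for z t
    have B: "blinfun_apply (B z t) = D z t" for z t
      unfolding B_def by (rule bounded_linear_Blinfun_apply[OF bl])
    have cB: "continuous_on (ball z0 (\<rho> z0) \<times> cbox 0 1) (\<lambda>(z, t). B z t)"
      unfolding case_prod_unfold
      by (rule continuous_on_blinfun_componentwise)
         (simp only: B D_def, intro continuous_intros c_arg c_pd c_h z0)
    have "((\<lambda>z. integral (cbox 0 1) (\<lambda>t. f (z + w z0 t *s axis i 1) * h z0 t)) has_derivative
        integral (cbox 0 1) (B z0)) (at z0 within ball z0 (\<rho> z0))"
    proof (rule leibniz_rule[where fx = B])
      fix z and t :: real assume z: "z \<in> ball z0 (\<rho> z0)"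
      note Df = holomorphic_several_on_frechet(1)[OF f w_S[OF z0 z, of t i]]
      have "((\<lambda>z. z + w z0 t *s axis i 1) has_derivative (\<lambda>v. v)) (at z)"
        by (rule has_derivative_eq_rhs, rule has_derivative_add[OF has_derivative_ident has_derivative_const]) simp
      from diff_chain_at[OF this Df]
      have "((\<lambda>z. f (z + w z0 t *s axis i 1)) has_derivative frechet_derivative f (at (z + w z0 t *s axis i 1))) (at z)"
        by (simp add: o_def)
      then have "((\<lambda>z. f (z + w z0 t *s axis i 1) * h z0 t) has_derivative
          (\<lambda>v. frechet_derivative f (at (z + w z0 t *s axis i 1)) v * h z0 t)) (at z)"
        by (rule has_derivative_mult_left)
      then show "((\<lambda>z. f (z + w z0 t *s axis i 1) * h z0 t) has_derivative blinfun_apply (B z t)) (at z within ball z0 (\<rho> z0))"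
        unfolding B D_def holomorphic_several_on_frechet_expand[OF f w_S[OF z0 z, of t i]]
        by (rule has_derivative_at_withinI)
    next
      fix z assume z: "z \<in> ball z0 (\<rho> z0)"
      have "continuous_on (ball z0 (\<rho> z0) \<times> cbox 0 1) (\<lambda>x. f (fst x + w z0 (snd x) *s axis i 1) * h z0 (snd x))"
        by (intro continuous_intros c_arg c_f c_h z0)
      moreover have "continuous_on (cbox 0 1) (\<lambda>t::real. (z, t))" by (intro continuous_intros)
      moreover have "(\<lambda>t. (z, t)) ` cbox 0 1 \<subseteq> ball z0 (\<rho> z0) \<times> cbox 0 1" using z by auto
      ultimately have "continuous_on (cbox 0 1) (\<lambda>t. f (fst (z, t) + w z0 (snd (z, t)) *s axis i 1) * h z0 (snd (z, t)))"
        by (rule continuous_on_compose2)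
      then show "(\<lambda>t. f (z + w z0 t *s axis i 1) * h z0 t) integrable_on cbox 0 1"
        by (intro integrable_continuous) simp
    qed (use cB \<rho>(1)[OF z0] in auto)
    then have "(partial_deriv i f has_derivative integral (cbox 0 1) (B z0)) (at z0)"
      using \<rho>(1)[OF z0] Cauchy[OF z0]
      by (subst (asm) at_within_open) (auto intro: has_derivative_transform_within_open[of _ _ _ _ "ball z0 (\<rho> z0)"])
    moreover have "blinfun_apply (integral (cbox 0 1) (B z0)) (c *s v) = c * blinfun_apply (integral (cbox 0 1) (B z0)) v" for c v
    proof -
      have "continuous_on (cbox 0 1) (\<lambda>t. (\<lambda>(z, t). B z t) (z0, t))"
        by (rule continuous_on_compose2[OF cB]) (use \<rho>(1)[OF z0] in \<open>auto intro!: continuous_intros\<close>)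
      then have i: "B z0 integrable_on cbox 0 1" by (intro integrable_continuous) simp
      have "D z0 t (c *s v) = c * D z0 t v" for t
        by (simp add: D_def sum_distrib_left mult_ac)
      then show ?thesis
        unfolding blinfun_apply_integral[OF i] B by (simp add: integral_mult_right)
    qed
    ultimately show "\<exists>D. (partial_deriv i f has_derivative D) (at z0) \<and> (\<forall>c v. D (c *s v) = c * D v)"
      by blast
  qed
qed

section \<open>Symmetry of second derivatives\<close>

text \<open>The mean value theorem in the direction \<open>u\<close>, applied to the difference of
  \<open>f\<close> along two parallel segments, reduces the second difference to increments of the
  function \<open>D y u\<close>. Its differentiability at \<open>x\<close> then gives the
  limit.\<close>

lemma second_difference_tendsto:
  fixes f :: "'a::real_normed_vector \<Rightarrow> real"
  assumes A: "open A" "x \<in> A" and f: "\<And>y. y \<in> A \<Longrightarrow> (f has_derivative D y) (at y)"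
    and P: "((\<lambda>y. D y u) has_derivative P) (at x)"
  shows "((\<lambda>h. (f (x + h *\<^sub>R u + h *\<^sub>R v) - f (x + h *\<^sub>R u) - f (x + h *\<^sub>R v) + f x) / h\<^sup>2) \<longlongrightarrow> P v) (at_right 0)"
proof (rule tendstoI)
  fix e :: real assume e: "e > 0"
  \<comment> \<open>The two displacements whose errors are added have norms at most
    \<open>h * (norm u + norm v)\<close> and \<open>h * norm u\<close>. The summand 1 keeps
    \<open>K\<close> positive, and the factor 2 in \<open>e / (2 * K)\<close> makes the final
    estimate strict.\<close>
  define K where "K = 2 * norm u + norm v + 1"
  have K: "K > 0" by (simp add: K_def add_nonneg_pos)
  have linP: "linear P" using P by (rule has_derivative_linear)
  obtain d1 where d1: "d1 > 0" "\<And>y. norm (y - x) < d1 \<Longrightarrow> norm (D y u - D x u - P (y - x)) \<le> e / (2 * K) * norm (y - x)"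
    using has_derivative_at_alt[THEN iffD1, OF P] e K by (metis divide_pos_pos mult_pos_pos zero_less_numeral)
  obtain d2 where d2: "d2 > 0" "ball x d2 \<subseteq> A" using A open_contains_ball by blast
  define d where "d = min d1 d2 / K"
  have d: "d > 0" using d1(1) d2(1) K by (simp add: d_def)
  show "\<forall>\<^sub>F h in at_right 0. dist ((f (x + h *\<^sub>R u + h *\<^sub>R v) - f (x + h *\<^sub>R u) - f (x + h *\<^sub>R v) + f x) / h\<^sup>2) (P v) < e"
  proof (rule eventually_at_rightI[OF _ d])
    fix h assume "h \<in> {0<..<d}"
    then have h: "0 < h" "h * K < min d1 d2" using K by (auto simp: d_def pos_less_divide_eq)
    have small: "norm (s *\<^sub>R u + t *\<^sub>R v) \<le> h * (norm u + norm v)" "norm (s *\<^sub>R u + t *\<^sub>R v) < min d1 d2"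
      if "0 \<le> s" "s \<le> h" "0 \<le> t" "t \<le> h" for s t
    proof -
      have "norm (s *\<^sub>R u + t *\<^sub>R v) \<le> s * norm u + t * norm v"
        using norm_triangle_ineq[of "s *\<^sub>R u" "t *\<^sub>R v"] that by simp
      also have "\<dots> \<le> h * norm u + h * norm v"
        using that by (intro add_mono mult_right_mono) auto
      finally show 1: "norm (s *\<^sub>R u + t *\<^sub>R v) \<le> h * (norm u + norm v)" by (simp add: algebra_simps)
      have "h * (norm u + norm v) \<le> h * K" using h by (intro mult_left_mono) (simp_all add: K_def)
      then show "norm (s *\<^sub>R u + t *\<^sub>R v) < min d1 d2" using 1 h by linarith
    qed
    have in_A: "x + s *\<^sub>R u + t *\<^sub>R v \<in> A" if "0 \<le> s" "s \<le> h" "0 \<le> t" "t \<le> h" for s t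
      using small(2)[OF that] d2(2) by (auto simp: dist_norm norm_minus_commute algebra_simps)
    define \<phi> where "\<phi> s = f (x + s *\<^sub>R u + h *\<^sub>R v) - f (x + s *\<^sub>R u + 0 *\<^sub>R v)" for s
    define \<phi>' where "\<phi>' s = D (x + s *\<^sub>R u + h *\<^sub>R v) u - D (x + s *\<^sub>R u + 0 *\<^sub>R v) u" for s
    have der: "(\<phi> has_derivative (\<lambda>k. k * \<phi>' s)) (at s)" if "0 \<le> s" "s \<le> h" for s
    proof -
      have 1: "((\<lambda>s. f (x + s *\<^sub>R u + t *\<^sub>R v)) has_derivative (\<lambda>k. k * D (x + s *\<^sub>R u + t *\<^sub>R v) u)) (at s)"
        if t: "0 \<le> t" "t \<le> h" for t
      proof -
        note Df = f[OF in_A[OF \<open>0 \<le> s\<close> \<open>s \<le> h\<close> t]]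
        have "((\<lambda>s. x + s *\<^sub>R u + t *\<^sub>R v) has_derivative (\<lambda>k. k *\<^sub>R u)) (at s)"
          by (auto intro!: derivative_eq_intros)
        from diff_chain_at[OF this Df]
        have "((\<lambda>s. f (x + s *\<^sub>R u + t *\<^sub>R v)) has_derivative (\<lambda>k. D (x + s *\<^sub>R u + t *\<^sub>R v) (k *\<^sub>R u))) (at s)"
          by (simp add: o_def)
        then show ?thesis using linear_scale[OF has_derivative_linear[OF Df]] by simp
      qed
      show ?thesis unfolding \<phi>_def[abs_def] \<phi>'_def right_diff_distrib
        using h by (intro has_derivative_diff 1) auto
    qed
    obtain s where s: "0 < s" "s < h" "\<phi> h - \<phi> 0 = h * \<phi>' s"
    proof -
      have "\<exists>s\<in>{0<..<h}. \<phi> h - \<phi> 0 = (h - 0) * \<phi>' s"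
        by (rule mvt_simple[OF h(1)]) (auto intro: has_derivative_at_withinI der)
      then show thesis using that by auto
    qed
    have 1: "norm (D (x + s *\<^sub>R u + t *\<^sub>R v) u - D x u - P (s *\<^sub>R u + t *\<^sub>R v)) \<le> e / (2 * K) * norm (s *\<^sub>R u + t *\<^sub>R v)"
      if "0 \<le> t" "t \<le> h" for t
      using d1(2)[of "x + s *\<^sub>R u + t *\<^sub>R v"] small(2)[of s t] s that by (simp add: add.assoc)
    have P': "P (s *\<^sub>R u + h *\<^sub>R v) = P (s *\<^sub>R u) + h * P v"
      using linear_add[OF linP] linear_scale[OF linP] by simp
    have "norm (\<phi>' s - h * P v) \<le> e / (2 * K) * norm (s *\<^sub>R u + h *\<^sub>R v) + e / (2 * K) * norm (s *\<^sub>R u + 0 *\<^sub>R v)"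
      using 1[of h] 1[of 0] h unfolding \<phi>'_def P' by simp
    also have "\<dots> \<le> e / (2 * K) * (h * (2 * norm u + norm v))"
    proof -
      have "norm (s *\<^sub>R u + h *\<^sub>R v) \<le> h * (norm u + norm v)" using small(1)[of s h] s by simp
      moreover have "norm (s *\<^sub>R u + 0 *\<^sub>R v) \<le> h * norm u"
        using s by (simp add: mult_right_mono)
      ultimately have "norm (s *\<^sub>R u + h *\<^sub>R v) + norm (s *\<^sub>R u + 0 *\<^sub>R v) \<le> h * (2 * norm u + norm v)"
        by (simp add: algebra_simps)
      then show ?thesis unfolding distrib_left[symmetric] using e K by (intro mult_left_mono) auto
    qed
    also have "\<dots> < e * h"
    proof -
      have "2 * norm u + norm v < 2 * K"
        unfolding K_def distrib_left using norm_ge_zero[of u] norm_ge_zero[of v] by linarith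
      then have "(2 * norm u + norm v) / (2 * K) < 1" using K by simp
      then have "(e * h) * ((2 * norm u + norm v) / (2 * K)) < (e * h) * 1"
        using e h by (intro mult_strict_left_mono) auto
      then show ?thesis by (simp add: mult_ac)
    qed
    finally have "norm (\<phi>' s - h * P v) < e * h" .
    then have "norm (\<phi>' s - h * P v) / h < e" using h by (simp add: pos_divide_less_eq)
    moreover have "(f (x + h *\<^sub>R u + h *\<^sub>R v) - f (x + h *\<^sub>R u) - f (x + h *\<^sub>R v) + f x) / h\<^sup>2 - P v
        = (\<phi>' s - h * P v) / h"
    proof -
      have "f (x + h *\<^sub>R u + h *\<^sub>R v) - f (x + h *\<^sub>R u) - f (x + h *\<^sub>R v) + f x = h * \<phi>' s"
        using s(3) by (simp add: \<phi>_def)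
      then show ?thesis using h by (simp add: field_simps power2_eq_square)
    qed
    ultimately show "dist ((f (x + h *\<^sub>R u + h *\<^sub>R v) - f (x + h *\<^sub>R u) - f (x + h *\<^sub>R v) + f x) / h\<^sup>2) (P v) < e"
      using h by (simp add: dist_norm)
  qed
qed

text \<open>Both mixed derivatives are the limit of the same second difference quotient.\<close>

lemma symmetric_second_derivative:
  fixes f :: "'a::real_normed_vector \<Rightarrow> 'b::euclidean_space"
  assumes A: "open A" "x \<in> A" and f: "\<And>y. y \<in> A \<Longrightarrow> (f has_derivative D y) (at y)"
    and P: "((\<lambda>y. D y u) has_derivative P) (at x)" and Q: "((\<lambda>y. D y v) has_derivative Q) (at x)"
  shows "P v = Q u"
proof (rule euclidean_eqI)
  fix b :: 'b
  let ?f = "\<lambda>y. f y \<bullet> b"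
  have f': "(?f has_derivative (\<lambda>w. D y w \<bullet> b)) (at y)" if "y \<in> A" for y
    using f[OF that] by (rule has_derivative_inner_left)
  have 1: "((\<lambda>h. (?f (x + h *\<^sub>R u + h *\<^sub>R v) - ?f (x + h *\<^sub>R u) - ?f (x + h *\<^sub>R v) + ?f x) / h\<^sup>2) \<longlongrightarrow> P v \<bullet> b) (at_right 0)"
    by (rule second_difference_tendsto[OF A f' has_derivative_inner_left[OF P]])
  have 2: "((\<lambda>h. (?f (x + h *\<^sub>R v + h *\<^sub>R u) - ?f (x + h *\<^sub>R v) - ?f (x + h *\<^sub>R u) + ?f x) / h\<^sup>2) \<longlongrightarrow> Q u \<bullet> b) (at_right 0)"
    by (rule second_difference_tendsto[OF A f' has_derivative_inner_left[OF Q]])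
  have "(\<lambda>h. (?f (x + h *\<^sub>R v + h *\<^sub>R u) - ?f (x + h *\<^sub>R v) - ?f (x + h *\<^sub>R u) + ?f x) / h\<^sup>2)
     = (\<lambda>h. (?f (x + h *\<^sub>R u + h *\<^sub>R v) - ?f (x + h *\<^sub>R u) - ?f (x + h *\<^sub>R v) + ?f x) / h\<^sup>2)"
    by (simp add: algebra_simps)
  with 2 show "P v \<bullet> b = Q u \<bullet> b"
    by (intro tendsto_unique[OF _ 1]) simp_all
qed

section \<open>Natural tensor expressions in the metric\<close>

text \<open>By Cramer's rule the entries of the inverse are quotients of polynomials in the entries
  of the matrix, which settles both holomorphy and differentiability of the inverse metric.\<close>

lemma matrix_inv_entry:
  fixes A :: "'k::field^'n::finite^'n"
  assumes "invertible A"
  shows "matrix_inv A $ k $ l = det (\<chi> i j. if j = k then axis l 1 $ i else A $ i $ j) / det A"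
proof -
  have "det A \<noteq> 0" using assms by (simp add: invertible_det_nz)
  moreover have "A *v (matrix_inv A *v axis l 1) = axis l 1"
    by (simp add: matrix_vector_mul_assoc matrix_inv_right[OF assms])
  ultimately have "matrix_inv A *v axis l 1
     = (\<chi> k. det (\<chi> i j. if j = k then axis l 1 $ i else A $ i $ j) / det A)"
    using cramer by blast
  moreover have "(matrix_inv A *v axis l 1) $ k = (\<Sum>j\<in>UNIV. if j = l then matrix_inv A $ k $ j else 0)"
    unfolding matrix_vector_mult_def vec_lambda_beta by (rule sum.cong) (auto simp: axis_def)
  ultimately show ?thesis by simp
qed

lemma holomorphic_several_on_det:
  assumes "\<And>i j. holomorphic_several_on S (\<lambda>z. F z $ i $ j)"
  shows "holomorphic_several_on S (\<lambda>z. det (F z :: complex^'m::finite^'m))"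
  unfolding det_def
  by (intro holomorphic_several_on_sum holomorphic_several_on_mult holomorphic_several_on_const
      holomorphic_several_on_prod assms)

lemma holomorphic_several_on_matrix_inv:
  assumes "open S" "\<And>i j. holomorphic_several_on S (\<lambda>z. F z $ i $ j)" "\<And>z. z \<in> S \<Longrightarrow> invertible (F z)"
  shows "holomorphic_several_on S (\<lambda>z. matrix_inv (F z :: complex^'m::finite^'m) $ k $ l)"
proof -
  have e: "holomorphic_several_on S (\<lambda>z. (\<chi> i j. if j = k then axis l 1 $ i else F z $ i $ j :: complex^'m^'m) $ i $ j)" for i j
    using assms(2) by (cases "j = k") (simp_all add: holomorphic_several_on_const)
  have "holomorphic_several_on S (\<lambda>z. det (\<chi> i j. if j = k then axis l 1 $ i else F z $ i $ j) / det (F z))"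
    using assms(3)
    by (intro holomorphic_several_on_divide holomorphic_several_on_det assms e) (simp_all add: invertible_det_nz)
  then show ?thesis
    by (rule holomorphic_several_on_cong[OF assms(1), THEN iffD2, rotated]) (rule matrix_inv_entry[OF assms(3)])
qed

lemma differentiable_prod:
  fixes f :: "'i \<Rightarrow> 'a::real_normed_vector \<Rightarrow> 'b::real_normed_field"
  shows "(\<And>i. i \<in> I \<Longrightarrow> f i differentiable (at x)) \<Longrightarrow> (\<lambda>y. \<Prod>i\<in>I. f i y) differentiable (at x)"
  by (induction I rule: infinite_finite_induct) (simp_all add: differentiable_mult)

lemma differentiable_det:
  fixes F :: "'a::real_normed_vector \<Rightarrow> 'k::real_normed_field^'m::finite^'m"
  assumes "\<And>i j. (\<lambda>y. F y $ i $ j) differentiable (at x)"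
  shows "(\<lambda>y. det (F y)) differentiable (at x)"
  unfolding det_def
  by (intro differentiable_sum finite_permutations finite ballI differentiable_mult differentiable_const
      differentiable_prod assms)

lemma differentiable_transform_open:
  assumes "f differentiable (at x)" "open S" "x \<in> S" "\<And>y. y \<in> S \<Longrightarrow> f y = g y"
  shows "g differentiable (at x)"
  using assms has_derivative_transform_within_open unfolding differentiable_def by blast

lemma differentiable_matrix_inv:
  fixes F :: "'a::real_normed_vector \<Rightarrow> 'k::real_normed_field^'m::finite^'m"
  assumes "open S" "x \<in> S" "\<And>i j. (\<lambda>y. F y $ i $ j) differentiable (at x)" "\<And>y. y \<in> S \<Longrightarrow> invertible (F y)"
  shows "(\<lambda>y. matrix_inv (F y) $ k $ l) differentiable (at x)"
proof -
  have e: "(\<lambda>y. (\<chi> i j. if j = k then axis l 1 $ i else F y $ i $ j :: 'k^'m^'m) $ i $ j) differentiable (at x)" for i j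
    using assms(3) by (cases "j = k") simp_all
  have "(\<lambda>y. det (\<chi> i j. if j = k then axis l 1 $ i else F y $ i $ j) / det (F y)) differentiable (at x)"
    using assms(4)[OF assms(2)]
    by (intro differentiable_divide differentiable_det assms e) (simp_all add: invertible_det_nz)
  then show ?thesis
    by (rule differentiable_transform_open[OF _ assms(1,2)]) (simp add: matrix_inv_entry[OF assms(4)])
qed

text \<open>Both functions have the same set of derivatives at \<open>x\<close>, so the choice
  operator returns the same value, even if this set is empty. Hence arbitrary tensor fields can be
  exchanged inside \<open>cov_deriv\<close>.\<close>

lemma frechet_derivative_cong:
  assumes "open S" "x \<in> S" "\<And>y. y \<in> S \<Longrightarrow> f y = g y"
  shows "frechet_derivative f (at x) = frechet_derivative g (at x)"
proof -
  have "(f has_derivative D) (at x) \<longleftrightarrow> (g has_derivative D) (at x)" for D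
    using has_derivative_transform_within_open[OF _ assms(1,2), where f = f and g = g]
      has_derivative_transform_within_open[OF _ assms(1,2), where f = g and g = f] assms(3) by metis
  then show ?thesis by (simp add: frechet_derivative_def)
qed

lemma partial_deriv_cong:
  "open S \<Longrightarrow> x \<in> S \<Longrightarrow> (\<And>y. y \<in> S \<Longrightarrow> f y = g y) \<Longrightarrow> partial_deriv i f x = partial_deriv i g x"
  unfolding partial_deriv_def using frechet_derivative_cong[of S x f g] by simp

text \<open>A recipe that can be evaluated for the metrics of both slices and of the ambient manifold. The
  trace-free projection, in the definitions only a relation, appears as a polynomial in
  \<open>trace_part\<close>: this makes it an operation, which preserves holomorphy and commutes with pull-backs.\<close>

datatype tensor_expr = Riemann | Contraction nat nat tensor_expr | Trace_Poly "real list" tensor_expr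
  | Covariant tensor_expr

primrec expr_rank :: "tensor_expr \<Rightarrow> nat" where
  "expr_rank Riemann = 4"
| "expr_rank (Contraction p q e) = expr_rank e - 2"
| "expr_rank (Trace_Poly cs e) = expr_rank e"
| "expr_rank (Covariant e) = Suc (expr_rank e)"

primrec expr_ok :: "tensor_expr \<Rightarrow> bool" where
  "expr_ok Riemann = True"
| "expr_ok (Contraction p q e) = (expr_ok e \<and> p < q \<and> q < expr_rank e)"
| "expr_ok (Trace_Poly cs e) = expr_ok e"
| "expr_ok (Covariant e) = expr_ok e"

primrec expr_tensor :: "tensor_expr \<Rightarrow> ('k::real_normed_field^'n::finite \<Rightarrow> 'k^'n^'n) \<Rightarrow> 'k^'n \<Rightarrow> 'n list \<Rightarrow> 'k" where
  "expr_tensor Riemann G = riemann G"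
| "expr_tensor (Contraction p q e) G = (\<lambda>x. contract (G x) p q (expr_tensor e G x))"
| "expr_tensor (Trace_Poly cs e) G = (\<lambda>x. trace_poly (G x) (expr_rank e) cs (expr_tensor e G x))"
| "expr_tensor (Covariant e) G = cov_deriv G (expr_tensor e G)"

text \<open>Agreement is claimed on \<open>U\<close> and for index lists of length \<open>r\<close>
  only, because a trace-free projection determines its values nowhere else.\<close>

lemma algebraic_curvature_tensor_expr:
  fixes G :: "real^'n::finite \<Rightarrow> real^'n^'n"
  assumes "algebraic_curvature_tensor U G r T" and G: "\<And>x. x \<in> U \<Longrightarrow> lorentzian_form (G x)"
  shows "\<exists>e. expr_ok e \<and> expr_rank e = r \<and> (\<forall>x\<in>U. \<forall>js. length js = r \<longrightarrow> T x js = expr_tensor e G x js)"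
  using assms(1)
proof induction
  case riemann
  show ?case by (rule exI[of _ Riemann]) simp
next
  case (contraction r T p q)
  then obtain e where e: "expr_ok e" "expr_rank e = r + 2"
    "\<And>x js. x \<in> U \<Longrightarrow> length js = r + 2 \<Longrightarrow> T x js = expr_tensor e G x js" by blast
  have "contract (G x) p q (T x) js = expr_tensor (Contraction p q e) G x js" if "x \<in> U" "length js = r" for x js
    using that contraction.hyps by (simp, intro contract_cong e) auto
  then show ?case using e contraction.hyps by (intro exI[of _ "Contraction p q e"]) simp
next
  case (trace_free r T W)
  then obtain e where e: "expr_ok e" "expr_rank e = r"
    "\<And>x js. x \<in> U \<Longrightarrow> length js = r \<Longrightarrow> T x js = expr_tensor e G x js" by blast
  \<comment> \<open>The coefficients are chosen before the metric, so one expression serves at all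
    points of \<open>U\<close>.\<close>
  obtain cs where cs: "\<And>(G :: real^'n^'n) T W js. lorentzian_form G \<Longrightarrow> trace_free_projection G r T W \<Longrightarrow>
     length js = r \<Longrightarrow> W js = trace_poly G r cs T js"
    using trace_free_projection_eq_trace_poly[of r] by blast
  have "W x js = expr_tensor (Trace_Poly cs e) G x js" if x: "x \<in> U" and js: "length js = r" for x js
  proof -
    have "W x js = trace_poly (G x) r cs (T x) js"
      by (rule cs[OF G[OF x] _ js]) (rule trace_free.hyps(2)[OF x])
    also have "\<dots> = trace_poly (G x) r cs (expr_tensor e G x) js"
      using js x by (intro trace_poly_cong e)
    finally show ?thesis using e(2) by simp
  qed
  then show ?case using e by (intro exI[of _ "Trace_Poly cs e"]) simp
qed

text \<open>Agreement on an open set passes to partial derivatives, which carries the correspondence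
  through \<open>cov_deriv\<close>.\<close>

lemma curvature_tensor_expr:
  fixes G :: "real^'n::finite \<Rightarrow> real^'n^'n"
  assumes "curvature_tensor U G r T" and G: "\<And>x. x \<in> U \<Longrightarrow> lorentzian_form (G x)" and U: "open U"
  shows "\<exists>e. expr_ok e \<and> expr_rank e = r \<and> (\<forall>x\<in>U. \<forall>js. length js = r \<longrightarrow> T x js = expr_tensor e G x js)"
  using assms(1)
proof induction
  case (algebraic r T)
  then show ?case using G by (rule algebraic_curvature_tensor_expr)
next
  case (derivative r T)
  then obtain e where e: "expr_ok e" "expr_rank e = r"
    "\<And>x js. x \<in> U \<Longrightarrow> length js = r \<Longrightarrow> T x js = expr_tensor e G x js" by blast
  have "cov_deriv G T x js = expr_tensor (Covariant e) G x js" if x: "x \<in> U" and js: "length js = Suc r" for x js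
  proof -
    have tl: "length (tl js) = r" using js by simp
    have "partial_deriv (hd js) (\<lambda>y. T y (tl js)) x = partial_deriv (hd js) (\<lambda>y. expr_tensor e G y (tl js)) x"
      by (rule partial_deriv_cong[OF U x]) (rule e(3)[OF _ tl])
    moreover have "T x ((tl js)[p := c]) = expr_tensor e G x ((tl js)[p := c])" for p c
      using x tl by (intro e(3)) simp_all
    ultimately show ?thesis by (simp add: cov_deriv_def)
  qed
  then show ?case using e by (intro exI[of _ "Covariant e"]) simp
qed

lemma holomorphic_christoffel:
  assumes S: "open S" and G: "\<And>i j. holomorphic_several_on S (\<lambda>z. G z $ i $ j)" "\<And>z. z \<in> S \<Longrightarrow> invertible (G z)"
  shows "holomorphic_several_on S (christoffel G k i j)"
  unfolding christoffel_def[abs_def]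
  by (intro holomorphic_several_on_sum holomorphic_several_on_mult holomorphic_several_on_divide
      holomorphic_several_on_add holomorphic_several_on_diff holomorphic_several_on_const
      holomorphic_several_on_matrix_inv holomorphic_several_on_partial_deriv S G) simp_all

text \<open>Holomorphy of the ambient tensor provides the chain rule along a slice for the next
  covariant derivative.\<close>

lemma holomorphic_expr_tensor:
  assumes S: "open S" and G: "\<And>i j. holomorphic_several_on S (\<lambda>z. G z $ i $ j)" "\<And>z. z \<in> S \<Longrightarrow> invertible (G z)"
  shows "holomorphic_several_on S (\<lambda>z. expr_tensor e G z js)"
proof (induction e arbitrary: js)
  case Riemann
  show ?case
    unfolding expr_tensor.simps riemann_def riemann_up_def
    by (intro holomorphic_several_on_sum holomorphic_several_on_mult
      holomorphic_several_on_add holomorphic_several_on_diff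
      holomorphic_several_on_partial_deriv holomorphic_christoffel S G)
next
  case (Contraction p q e)
  show ?case
    unfolding expr_tensor.simps contract_def
    by (intro holomorphic_several_on_sum holomorphic_several_on_mult holomorphic_several_on_matrix_inv S G Contraction)
next
  case (Trace_Poly cs e)
  have "holomorphic_several_on S (\<lambda>z. trace_poly (G z) r cs (expr_tensor e G z) js)" for r
  proof (induction cs arbitrary: js)
    case Nil
    show ?case by (simp add: holomorphic_several_on_const)
  next
    case (Cons c cs)
    show ?case
      unfolding trace_poly.simps trace_part_def contract_def
      by (intro holomorphic_several_on_sum holomorphic_several_on_mult holomorphic_several_on_add
          holomorphic_several_on_const holomorphic_several_on_matrix_inv S G Cons Trace_Poly)
  qed
  then show ?case by simp
next
  case (Covariant e)
  show ?case
    unfolding expr_tensor.simps cov_deriv_def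
    by (intro holomorphic_several_on_sum holomorphic_several_on_mult holomorphic_several_on_diff
      holomorphic_several_on_partial_deriv holomorphic_christoffel S G Covariant)
qed

text \<open>Contracting one index of the tensor with a matrix amounts to applying the matrix to the
  argument in that slot. The correction terms of a covariant derivative have this shape.\<close>

lemma teval_update:
  "p < length vs \<Longrightarrow> teval vs (\<lambda>ks. \<Sum>c\<in>UNIV. g c (ks ! p) * T (ks[p := c]))
     = teval (vs[p := \<chi> c. \<Sum>b\<in>UNIV. g c b * vs ! p $ b]) T"
proof (induction vs arbitrary: p T)
  case (Cons v vs)
  show ?case
  proof (cases p)
    case 0
    have "teval (v # vs) (\<lambda>ks. \<Sum>c\<in>UNIV. g c (ks ! 0) * T (ks[0 := c]))
       = (\<Sum>c\<in>UNIV. \<Sum>b\<in>UNIV. v $ b * (g c b * teval vs (\<lambda>ks. T (c # ks))))"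
      by (simp only: teval.simps teval_sum teval_mult sum_distrib_left nth_Cons_0 list_update_code)
    also have "\<dots> = (\<Sum>c\<in>UNIV. (\<Sum>b\<in>UNIV. g c b * v $ b) * teval vs (\<lambda>ks. T (c # ks)))"
      unfolding sum_distrib_right by (simp only: mult_ac)
    finally show ?thesis by (simp add: 0)
  next
    case (Suc q)
    then have "q < length vs" using Cons.prems by simp
    from Cons.IH[OF this, of "\<lambda>ks. T (_ # ks)"] show ?thesis by (simp add: Suc)
  qed
qed simp

text \<open>The product rule: the first summand differentiates the tensor, the others the frame, one
  slot at a time. For a slice the latter bring in the second derivatives of the embedding.\<close>

lemma has_derivative_teval:
  fixes J :: "'a::real_normed_vector \<Rightarrow> 'j \<Rightarrow> 'k::real_normed_field^'n::finite"
  assumes J: "\<And>j i. ((\<lambda>y. J y j $ i) has_derivative (\<lambda>h. J' j h $ i)) (at x)"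
    and T: "\<And>ks. ((\<lambda>y. T y ks) has_derivative (\<lambda>h. T' h ks)) (at x)"
  shows "((\<lambda>y. teval (map (J y) js) (T y)) has_derivative
     (\<lambda>h. teval (map (J x) js) (T' h) + (\<Sum>p<length js. teval ((map (J x) js)[p := J' (js ! p) h]) (T x)))) (at x)"
  using T
proof (induction js arbitrary: T T')
  case Nil
  then show ?case by simp
next
  case (Cons j js)
  have *: "((\<lambda>y. teval (map (J y) js) (\<lambda>ks. T y (i # ks))) has_derivative
     (\<lambda>h. teval (map (J x) js) (\<lambda>ks. T' h (i # ks)) +
       (\<Sum>p<length js. teval ((map (J x) js)[p := J' (js ! p) h]) (\<lambda>ks. T x (i # ks))))) (at x)" for i
    by (rule Cons.IH) (rule Cons.prems)
  have "((\<lambda>y. \<Sum>i\<in>UNIV. J y j $ i * teval (map (J y) js) (\<lambda>ks. T y (i # ks))) has_derivative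
     (\<lambda>h. \<Sum>i\<in>UNIV. J x j $ i * (teval (map (J x) js) (\<lambda>ks. T' h (i # ks)) +
       (\<Sum>p<length js. teval ((map (J x) js)[p := J' (js ! p) h]) (\<lambda>ks. T x (i # ks)))) +
       J' j h $ i * teval (map (J x) js) (\<lambda>ks. T x (i # ks)))) (at x)"
    by (rule has_derivative_sum) (rule has_derivative_mult[OF J *])
  then show ?case
    by (simp add: sum.lessThan_Suc_shift sum.distrib distrib_left sum_distrib_left del: sum.lessThan_Suc)
       (simp add: sum.swap[of _ "UNIV" "{..<length js}"] add_ac)
qed

section \<open>Curvature of a real slice\<close>

lemma smooth_on_differentiable:
  assumes "smooth_on A f" "x \<in> A"
  shows "f differentiable (at x)"
proof -
  have "continuously_differentiable_on (Suc 0) A f" using assms(1) unfolding smooth_on_def by blast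
  then show ?thesis using assms(2) by simp
qed

lemma smooth_on_frechet_derivative:
  assumes "smooth_on A f"
  shows "smooth_on A (\<lambda>x. frechet_derivative f (at x) v)"
  unfolding smooth_on_def
proof
  fix k
  have "continuously_differentiable_on (Suc k) A f" using assms unfolding smooth_on_def by blast
  then show "continuously_differentiable_on k A (\<lambda>x. frechet_derivative f (at x) v)" by simp
qed

lemma has_derivative_bilin:
  fixes P :: "'a::real_normed_vector \<Rightarrow> 'k::real_normed_field^'n::finite^'n"
  assumes P: "\<And>i j. ((\<lambda>y. P y $ i $ j) has_derivative (\<lambda>h. P' h $ i $ j)) (at x)"
    and u: "\<And>i. ((\<lambda>y. u y $ i) has_derivative (\<lambda>h. u' h $ i)) (at x)"
    and v: "\<And>i. ((\<lambda>y. v y $ i) has_derivative (\<lambda>h. v' h $ i)) (at x)"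
  shows "((\<lambda>y. bilin (P y) (u y) (v y)) has_derivative
    (\<lambda>h. bilin (P' h) (u x) (v x) + bilin (P x) (u' h) (v x) + bilin (P x) (u x) (v' h))) (at x)"
  unfolding bilin_def
  by (rule has_derivative_eq_rhs, rule has_derivative_sum, rule has_derivative_sum,
      rule has_derivative_mult[OF has_derivative_mult[OF P u] v])
     (simp add: fun_eq_iff sum.distrib algebra_simps)

lemma has_derivative_holomorphic_compose:
  assumes h: "holomorphic_several_on B h" "\<phi> x \<in> B" and \<phi>: "(\<phi> has_derivative \<phi>') (at x)"
  shows "((\<lambda>y. h (\<phi> y)) has_derivative (\<lambda>v. \<Sum>k\<in>UNIV. \<phi>' v $ k * partial_deriv k h (\<phi> x))) (at x)"
  using diff_chain_at[OF \<phi> holomorphic_several_on_frechet(1)[OF h]]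
  by (simp add: o_def holomorphic_several_on_frechet_expand[OF h])

lemma has_derivative_vec_nth: "(f has_derivative f') F \<Longrightarrow> ((\<lambda>y. f y $ k) has_derivative (\<lambda>h. f' h $ k)) F"
  by (rule bounded_linear.has_derivative[OF bounded_linear_vec_nth])

text \<open>Differentiability of \<open>g\<close> is transferred from \<open>F\<close>, and the
  derivative of \<open>F\<close> is real because it coincides with that of its real part.\<close>

lemma has_derivative_of_real_iff:
  assumes "open A" "x \<in> A" and eq: "\<And>y. y \<in> A \<Longrightarrow> F y = complex_of_real (g y)"
    and F: "(F has_derivative F') (at x)"
  shows "(g has_derivative (\<lambda>h. Re (F' h))) (at x)"
    and "complex_of_real (frechet_derivative g (at x) h) = F' h"
proof -
  have "((\<lambda>y. Re (F y)) has_derivative (\<lambda>h. Re (F' h))) (at x)"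
    using F by (rule has_derivative_Re)
  then show g: "(g has_derivative (\<lambda>h. Re (F' h))) (at x)"
    by (rule has_derivative_transform_within_open[OF _ assms(1,2)]) (simp add: eq)
  have "((\<lambda>y. complex_of_real (g y)) has_derivative (\<lambda>h. of_real (Re (F' h)))) (at x)"
    using g by (rule has_derivative_of_real)
  then have "(F has_derivative (\<lambda>h. of_real (Re (F' h)))) (at x)"
    by (rule has_derivative_transform_within_open[OF _ assms(1,2)]) (simp add: eq)
  with F have "F' = (\<lambda>h. of_real (Re (F' h)))" by (rule has_derivative_unique)
  then show "complex_of_real (frechet_derivative g (at x) h) = F' h"
    using frechet_derivative_at[OF g] by metis
qed

section \<open>Christoffel symbols and curvature evaluated on vectors\<close>

definition metric_deriv :: "('k::real_normed_field^'n::finite \<Rightarrow> 'k^'n^'n) \<Rightarrow> 'k^'n \<Rightarrow> 'k^'n \<Rightarrow> 'k^'n^'n" where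
  "metric_deriv G x u = (\<chi> c d. \<Sum>e\<in>UNIV. u $ e * partial_deriv e (\<lambda>z. G z $ c $ d) x)"

definition christoffel_form :: "('k::real_normed_field^'n::finite \<Rightarrow> 'k^'n^'n) \<Rightarrow> 'k^'n \<Rightarrow> 'n \<Rightarrow> 'k^'n^'n" where
  "christoffel_form G x k = (\<chi> a b. christoffel G k a b x)"

definition christoffel_vec :: "('k::real_normed_field^'n::finite \<Rightarrow> 'k^'n^'n) \<Rightarrow> 'k^'n \<Rightarrow> 'k^'n \<Rightarrow> 'k^'n \<Rightarrow> 'k^'n" where
  "christoffel_vec G x u v = (\<chi> k. bilin (christoffel_form G x k) u v)"

lemma christoffel_vec_linear:
  "christoffel_vec G x u (v + w) = christoffel_vec G x u v + christoffel_vec G x u w"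
  "christoffel_vec G x u (c *s v) = c *s christoffel_vec G x u v"
  "christoffel_vec G x u (\<Sum>i\<in>A. f i) = (\<Sum>i\<in>A. christoffel_vec G x u (f i))"
  by (simp_all add: christoffel_vec_def vec_eq_iff bilin_linear bilin_sum_right)

text \<open>Lowering the upper index cancels the inverse metric and gives the Christoffel symbols of
  the first kind.\<close>

lemma christoffel_lower:
  assumes "invertible (G x)"
  shows "(\<Sum>k\<in>UNIV. G x $ m $ k * christoffel G k i j x) =
    (partial_deriv i (\<lambda>y. G y $ j $ m) x + partial_deriv j (\<lambda>y. G y $ i $ m) x
      - partial_deriv m (\<lambda>y. G y $ i $ j) x) / 2"
proof -
  let ?d = "\<lambda>l. (partial_deriv i (\<lambda>y. G y $ j $ l) x + partial_deriv j (\<lambda>y. G y $ i $ l) x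
      - partial_deriv l (\<lambda>y. G y $ i $ j) x)"
  have "(\<Sum>k\<in>UNIV. G x $ m $ k * christoffel G k i j x)
     = (\<Sum>k\<in>UNIV. \<Sum>l\<in>UNIV. G x $ m $ k * matrix_inv (G x) $ k $ l * (?d l / 2))"
    unfolding christoffel_def sum_distrib_left by (intro sum.cong refl) simp
  also have "\<dots> = (\<Sum>l\<in>UNIV. (G x ** matrix_inv (G x)) $ m $ l * (?d l / 2))"
    by (subst sum.swap) (simp only: matrix_matrix_mult_def vec_lambda_beta sum_distrib_right)
  also have "\<dots> = ?d m / 2"
    unfolding matrix_inv_right[OF assms] by (rule sum_mat_1)
  finally show ?thesis .
qed

text \<open>The Koszul formula for vector fields with constant components, whose brackets
  vanish.\<close>

lemma bilin_christoffel_vec: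
  assumes "invertible (G x)"
  shows "bilin (G x) w (christoffel_vec G x u v) =
    (bilin (metric_deriv G x u) v w + bilin (metric_deriv G x v) u w - bilin (metric_deriv G x w) u v) / 2"
proof -
  let ?p = "\<lambda>a b c. partial_deriv a (\<lambda>y. G y $ b $ c) x"
  let ?s = "\<lambda>a b c. ((?p a b c + ?p b a c - ?p c a b) / 2) * (u $ a * v $ b * w $ c)"
  let ?h = "\<lambda>c k a b. G x $ c $ k * christoffel G k a b x * (u $ a * v $ b * w $ c)"
  let ?S = "\<lambda>f. \<Sum>a\<in>UNIV. \<Sum>b\<in>UNIV. \<Sum>c\<in>UNIV. f a b c * u $ a * v $ b * w $ c"
  have 1: "bilin (metric_deriv G x u) v w = ?S (\<lambda>a b c. ?p a b c)"
  proof -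
    have "bilin (metric_deriv G x u) v w = (\<Sum>b\<in>UNIV. \<Sum>c\<in>UNIV. \<Sum>a\<in>UNIV. ?p a b c * u $ a * v $ b * w $ c)"
      unfolding bilin_def metric_deriv_def vec_lambda_beta sum_distrib_right by (simp only: mult_ac)
    also have "\<dots> = (\<Sum>b\<in>UNIV. \<Sum>a\<in>UNIV. \<Sum>c\<in>UNIV. ?p a b c * u $ a * v $ b * w $ c)"
      by (intro sum.cong refl sum.swap)
    also have "\<dots> = ?S (\<lambda>a b c. ?p a b c)" by (rule sum.swap)
    finally show ?thesis .
  qed
  have 2: "bilin (metric_deriv G x v) u w = ?S (\<lambda>a b c. ?p b a c)"
  proof -
    have "bilin (metric_deriv G x v) u w = (\<Sum>a\<in>UNIV. \<Sum>c\<in>UNIV. \<Sum>b\<in>UNIV. ?p b a c * u $ a * v $ b * w $ c)"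
      unfolding bilin_def metric_deriv_def vec_lambda_beta sum_distrib_right by (simp only: mult_ac)
    also have "\<dots> = ?S (\<lambda>a b c. ?p b a c)"
      by (intro sum.cong refl sum.swap)
    finally show ?thesis .
  qed
  have 3: "bilin (metric_deriv G x w) u v = ?S (\<lambda>a b c. ?p c a b)"
    unfolding bilin_def metric_deriv_def vec_lambda_beta sum_distrib_right by (simp only: mult_ac)
  have "bilin (G x) w (christoffel_vec G x u v)
     = (\<Sum>c\<in>UNIV. \<Sum>k\<in>UNIV. \<Sum>a\<in>UNIV. \<Sum>b\<in>UNIV. ?h c k a b)"
    unfolding christoffel_vec_def christoffel_form_def bilin_def vec_lambda_beta
    by (simp only: sum_distrib_left mult_ac)
  also have "\<dots> = (\<Sum>c\<in>UNIV. \<Sum>a\<in>UNIV. \<Sum>b\<in>UNIV. (\<Sum>k\<in>UNIV. G x $ c $ k * christoffel G k a b x) * (u $ a * v $ b * w $ c))"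
  proof (rule sum.cong[OF refl])
    fix c
    have "(\<Sum>k\<in>UNIV. \<Sum>a\<in>UNIV. \<Sum>b\<in>UNIV. ?h c k a b)
      = (\<Sum>a\<in>UNIV. \<Sum>k\<in>UNIV. \<Sum>b\<in>UNIV. ?h c k a b)"
      by (rule sum.swap)
    also have "\<dots> = (\<Sum>a\<in>UNIV. \<Sum>b\<in>UNIV. \<Sum>k\<in>UNIV. ?h c k a b)"
      by (intro sum.cong refl sum.swap)
    finally show "(\<Sum>k\<in>UNIV. \<Sum>a\<in>UNIV. \<Sum>b\<in>UNIV. ?h c k a b)
       = (\<Sum>a\<in>UNIV. \<Sum>b\<in>UNIV. (\<Sum>k\<in>UNIV. G x $ c $ k * christoffel G k a b x) * (u $ a * v $ b * w $ c))"
      by (simp only: sum_distrib_right)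
  qed
  also have "\<dots> = (\<Sum>c\<in>UNIV. \<Sum>a\<in>UNIV. \<Sum>b\<in>UNIV. ?s a b c)"
    by (simp only: christoffel_lower[of G x, OF assms])
  also have "\<dots> = (\<Sum>a\<in>UNIV. \<Sum>c\<in>UNIV. \<Sum>b\<in>UNIV. ?s a b c)"
    by (rule sum.swap)
  also have "\<dots> = (\<Sum>a\<in>UNIV. \<Sum>b\<in>UNIV. \<Sum>c\<in>UNIV. ?s a b c)"
    by (intro sum.cong refl sum.swap)
  also have "\<dots> = (?S (\<lambda>a b c. ?p a b c) + ?S (\<lambda>a b c. ?p b a c) - ?S (\<lambda>a b c. ?p c a b)) / 2"
    by (simp add: sum.distrib sum_subtractf algebra_simps sum_divide_distrib add_divide_distrib diff_divide_distrib)
  finally show ?thesis unfolding 1 2 3 .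
qed

definition christoffel_deriv :: "('k::real_normed_field^'n::finite \<Rightarrow> 'k^'n^'n) \<Rightarrow> 'k^'n \<Rightarrow> 'k^'n \<Rightarrow> 'n \<Rightarrow> 'k^'n^'n" where
  "christoffel_deriv G x u e = (\<chi> a b. \<Sum>c\<in>UNIV. u $ c * partial_deriv c (christoffel G e a b) x)"

text \<open>The vector R(u, v) w. Arguments that are vectors rather than indices are required
  because the tangent vectors of a slice are not coordinate vectors of the ambient chart.\<close>

definition riemann_vec :: "('k::real_normed_field^'n::finite \<Rightarrow> 'k^'n^'n) \<Rightarrow> 'k^'n \<Rightarrow> 'k^'n \<Rightarrow> 'k^'n \<Rightarrow> 'k^'n \<Rightarrow> 'k^'n" where
  "riemann_vec G x w u v = (\<chi> e. bilin (christoffel_deriv G x u e) v w - bilin (christoffel_deriv G x v e) u w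
     + (christoffel_vec G x u (christoffel_vec G x v w) - christoffel_vec G x v (christoffel_vec G x u w)) $ e)"

lemma riemann_vec_eq_sum:
  fixes G :: "'k::real_normed_field^'n::finite \<Rightarrow> 'k^'n^'n"
  shows "riemann_vec G x w u v $ e =
     (\<Sum>c\<in>UNIV. \<Sum>a\<in>UNIV. \<Sum>b\<in>UNIV. w $ c * (u $ a * (v $ b * riemann_up G e c a b x)))"
proof -
  let ?d = "\<lambda>a b c. partial_deriv a (christoffel G e b c) x"
  let ?r = "\<lambda>u v a b c m. w $ c * (u $ a * (v $ b * (christoffel G e a m x * christoffel G m b c x)))"
  let ?q = "\<lambda>a b c. \<Sum>m\<in>UNIV. christoffel G e a m x * christoffel G m b c x"
  let ?S = "\<lambda>f. \<Sum>c\<in>UNIV. \<Sum>a\<in>UNIV. \<Sum>b\<in>UNIV. w $ c * (u $ a * (v $ b * f a b c))"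
  have 1: "bilin (christoffel_deriv G x u e) v w =
     (\<Sum>c\<in>UNIV. \<Sum>a\<in>UNIV. \<Sum>b\<in>UNIV. w $ c * (u $ a * (v $ b * ?d a b c)))" for u v :: "'k^'n"
  proof -
    have "bilin (christoffel_deriv G x u e) v w = (\<Sum>b\<in>UNIV. \<Sum>c\<in>UNIV. \<Sum>a\<in>UNIV. w $ c * (u $ a * (v $ b * ?d a b c)))"
      unfolding bilin_def christoffel_deriv_def vec_lambda_beta sum_distrib_right by (simp only: mult_ac)
    also have "\<dots> = (\<Sum>c\<in>UNIV. \<Sum>b\<in>UNIV. \<Sum>a\<in>UNIV. w $ c * (u $ a * (v $ b * ?d a b c)))" by (rule sum.swap)
    also have "\<dots> = (\<Sum>c\<in>UNIV. \<Sum>a\<in>UNIV. \<Sum>b\<in>UNIV. w $ c * (u $ a * (v $ b * ?d a b c)))"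
      by (intro sum.cong refl sum.swap)
    finally show ?thesis .
  qed
  have 2: "christoffel_vec G x u (christoffel_vec G x v w) $ e =
     (\<Sum>c\<in>UNIV. \<Sum>a\<in>UNIV. \<Sum>b\<in>UNIV. w $ c * (u $ a * (v $ b * ?q a b c)))" for u v :: "'k^'n"
  proof -
    have "christoffel_vec G x u (christoffel_vec G x v w) $ e =
      (\<Sum>a\<in>UNIV. \<Sum>m\<in>UNIV. \<Sum>b\<in>UNIV. \<Sum>c\<in>UNIV. ?r u v a b c m)"
      unfolding christoffel_vec_def christoffel_form_def bilin_def vec_lambda_beta
      by (simp only: sum_distrib_left mult_ac)
    also have "\<dots> = (\<Sum>a\<in>UNIV. \<Sum>b\<in>UNIV. \<Sum>m\<in>UNIV. \<Sum>c\<in>UNIV. ?r u v a b c m)"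
      by (intro sum.cong refl sum.swap)
    also have "\<dots> = (\<Sum>a\<in>UNIV. \<Sum>b\<in>UNIV. \<Sum>c\<in>UNIV. w $ c * (u $ a * (v $ b * ?q a b c)))"
      unfolding sum_distrib_left by (intro sum.cong refl sum.swap)
    also have "\<dots> = (\<Sum>a\<in>UNIV. \<Sum>c\<in>UNIV. \<Sum>b\<in>UNIV. w $ c * (u $ a * (v $ b * ?q a b c)))"
      by (intro sum.cong refl sum.swap)
    also have "\<dots> = (\<Sum>c\<in>UNIV. \<Sum>a\<in>UNIV. \<Sum>b\<in>UNIV. w $ c * (u $ a * (v $ b * ?q a b c)))"
      by (rule sum.swap)
    finally show ?thesis .
  qed
  have sw: "(\<Sum>c\<in>UNIV. \<Sum>a\<in>UNIV. \<Sum>b\<in>UNIV. w $ c * (v $ a * (u $ b * f a b c))) = ?S (\<lambda>a b c. f b a c)" for f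
    by (rule sum.cong[OF refl], subst sum.swap) (simp only: mult_ac)
  have "riemann_vec G x w u v $ e = ?S (\<lambda>a b c. ?d a b c) - ?S (\<lambda>a b c. ?d b a c)
      + (?S (\<lambda>a b c. ?q a b c) - ?S (\<lambda>a b c. ?q b a c))"
    unfolding riemann_vec_def vec_lambda_beta vector_minus_component 1 2 sw ..
  also have "\<dots> = ?S (\<lambda>a b c. riemann_up G e c a b x)"
    unfolding riemann_up_def by (simp add: sum.distrib sum_subtractf algebra_simps)
  finally show ?thesis .
qed

lemma invertible_frame_matrix:
  fixes G :: "'k::field^'n::finite^'n"
  assumes "invertible (pullm E G)"
  shows "invertible (frame_matrix E)"
  using assms by (simp add: invertible_det_nz pullm_eq det_mul)

lemma nondegenerate_frame:
  fixes G :: "'k::field^'n::finite^'n"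
  assumes "invertible (pullm E G)" "\<And>m. bilin G (E m) u = 0"
  shows "u = 0"
proof -
  have E: "invertible (frame_matrix E)" by (rule invertible_frame_matrix[OF assms(1)])
  define w where "w = matrix_inv (frame_matrix E) *v u"
  have u: "u = frame_comb E w"
    by (simp add: w_def frame_comb_eq_mult matrix_vector_mul_assoc matrix_inv_right[OF E])
  have "pullm E G *v w = 0"
    unfolding vec_eq_iff
  proof
    fix m
    have "(pullm E G *v w) $ m = bilin G (E m) u"
      by (simp add: u frame_comb_def bilin_sum_right bilin_scale_right matrix_vector_mult_def pullm_def mult.commute)
    then show "(pullm E G *v w) $ m = 0 $ m" using assms(2) by simp
  qed
  then have "matrix_inv (pullm E G) *v (pullm E G *v w) = 0" by simp
  then have "w = 0" by (simp add: matrix_vector_mul_assoc matrix_inv_left[OF assms(1)])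
  then show ?thesis by (simp add: u frame_comb_def)
qed

text \<open>A real slice in one chart of the slice and one of the ambient manifold. The signature of
  \<open>G\<close> is left open, so that both P and Q are instances.\<close>

locale slice_chart =
  fixes \<phi> :: "real^'n::finite \<Rightarrow> complex^'n" and A B
    and G :: "real^'n \<Rightarrow> real^'n^'n" and M :: "complex^'n \<Rightarrow> complex^'n^'n"
  assumes A: "open A" and B: "open B" and \<phi>_B: "\<And>x. x \<in> A \<Longrightarrow> \<phi> x \<in> B"
    and smooth: "smooth_on A \<phi>"
    and M_hol: "\<And>i j. holomorphic_several_on B (\<lambda>z. M z $ i $ j)"
    and M_sym: "\<And>z u v. z \<in> B \<Longrightarrow> bilin (M z) u v = bilin (M z) v u"
    and M_inv: "\<And>z. z \<in> B \<Longrightarrow> invertible (M z)"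
    and G_inv: "\<And>x. x \<in> A \<Longrightarrow> invertible (G x)"
    and induced: "\<And>x i j. x \<in> A \<Longrightarrow> bilin (M (\<phi> x)) (frechet_derivative \<phi> (at x) (axis i 1))
        (frechet_derivative \<phi> (at x) (axis j 1)) = of_real (G x $ i $ j)"
begin

definition J :: "real^'n \<Rightarrow> 'n \<Rightarrow> complex^'n" where
  "J x i = frechet_derivative \<phi> (at x) (axis i 1)"

definition H :: "real^'n \<Rightarrow> 'n \<Rightarrow> 'n \<Rightarrow> complex^'n" where
  "H x i j = frechet_derivative (\<lambda>y. J y j) (at x) (axis i 1)"

lemma smooth_J: "smooth_on A (\<lambda>y. J y j)"
  unfolding J_def by (rule smooth_on_frechet_derivative[OF smooth])

lemma smooth_H: "smooth_on A (\<lambda>y. H y i j)"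
  unfolding H_def by (rule smooth_on_frechet_derivative[OF smooth_J])

lemma has_derivative_if_smooth:
  "smooth_on A f \<Longrightarrow> x \<in> A \<Longrightarrow> (f has_derivative frechet_derivative f (at x)) (at x)"
  using smooth_on_differentiable frechet_derivative_works by blast

lemma H_commute: "x \<in> A \<Longrightarrow> H x i j = H x j i"
  unfolding H_def
  by (rule symmetric_second_derivative[OF A, where f = \<phi> and D = "\<lambda>y. frechet_derivative \<phi> (at y)"])
     (auto intro: has_derivative_if_smooth[OF smooth] has_derivative_if_smooth[OF smooth_J]
       simp flip: J_def)

text \<open>The third derivatives of the embedding. Their symmetry in the first two indices removes
  them from the curvature.\<close>

definition K :: "real^'n \<Rightarrow> 'n \<Rightarrow> 'n \<Rightarrow> 'n \<Rightarrow> complex^'n" where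
  "K x i j k = frechet_derivative (\<lambda>y. H y j k) (at x) (axis i 1)"

lemma K_commute: "x \<in> A \<Longrightarrow> K x i j k = K x j i k"
  unfolding K_def
  by (rule symmetric_second_derivative[OF A, where f = "\<lambda>y. J y k" and D = "\<lambda>y. frechet_derivative (\<lambda>y. J y k) (at y)"])
     (auto intro: has_derivative_if_smooth[OF smooth_J] has_derivative_if_smooth[OF smooth_H]
       simp flip: H_def)

lemma pullm_J: "x \<in> A \<Longrightarrow> pullm (J x) (M (\<phi> x)) = cmat (G x)"
  by (simp add: pullm_def vec_eq_iff J_def induced cmat_def)

text \<open>The Gram matrix of the real tangent vectors is invertible, so they are linearly
  independent over the complex numbers and, by the equality of dimensions, a basis.\<close>

lemma J_frame: "x \<in> A \<Longrightarrow> invertible (frame_matrix (J x))"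
  by (rule invertible_frame_matrix[of _ "M (\<phi> x)"]) (simp add: pullm_J matrix_inv_cmat(1)[OF G_inv])

lemma J_nondegenerate:
  assumes "x \<in> A" "\<And>m. bilin (M (\<phi> x)) (J x m) u = bilin (M (\<phi> x)) (J x m) v"
  shows "u = v"
proof -
  have "bilin (M (\<phi> x)) (J x m) (u + (-1) *s v) = 0" for m
    unfolding bilin_linear assms(2) by simp
  then have "u + (-1) *s v = 0"
    using assms(1) by (intro nondegenerate_frame[of "J x" "M (\<phi> x)"]) (simp_all add: pullm_J matrix_inv_cmat(1)[OF G_inv])
  then show ?thesis by (simp add: vec_eq_iff)
qed

lemma J_deriv: "x \<in> A \<Longrightarrow> ((\<lambda>y. J y j $ k) has_derivative (\<lambda>h. frechet_derivative (\<lambda>y. J y j) (at x) h $ k)) (at x)"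
  by (rule has_derivative_vec_nth[OF has_derivative_if_smooth[OF smooth_J]])

lemma hol_deriv:
  assumes "x \<in> A" "holomorphic_several_on B f"
  shows "((\<lambda>y. f (\<phi> y)) has_derivative
     (\<lambda>h. \<Sum>k\<in>UNIV. frechet_derivative \<phi> (at x) h $ k * partial_deriv k f (\<phi> x))) (at x)"
  using assms by (intro has_derivative_holomorphic_compose[of B] has_derivative_if_smooth smooth \<phi>_B)

lemma metric_partial_deriv:
  assumes x: "x \<in> A"
  shows "complex_of_real (partial_deriv i (\<lambda>y. G y $ a $ b) x) =
    bilin (metric_deriv M (\<phi> x) (J x i)) (J x a) (J x b)
    + bilin (M (\<phi> x)) (H x i a) (J x b) + bilin (M (\<phi> x)) (J x a) (H x i b)"
proof -
  have "((\<lambda>y. bilin (M (\<phi> y)) (J y a) (J y b)) has_derivative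
    (\<lambda>h. bilin (metric_deriv M (\<phi> x) (frechet_derivative \<phi> (at x) h)) (J x a) (J x b)
       + bilin (M (\<phi> x)) (frechet_derivative (\<lambda>y. J y a) (at x) h) (J x b)
       + bilin (M (\<phi> x)) (J x a) (frechet_derivative (\<lambda>y. J y b) (at x) h))) (at x)"
    by (rule has_derivative_bilin) (simp_all add: J_deriv x metric_deriv_def hol_deriv[OF x M_hol])
  from has_derivative_of_real_iff(2)[OF A x _ this, of "\<lambda>y. G y $ a $ b" "axis i 1"]
  show ?thesis
    using induced unfolding partial_deriv_def J_def[symmetric] H_def[symmetric] by simp
qed

text \<open>The Gauss formula, with no second fundamental form, because
  the vectors \<open>J x k\<close> already span the ambient tangent space over the complex numbers.\<close>

lemma christoffel_law:
  assumes x: "x \<in> A"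
  shows "(\<Sum>k\<in>UNIV. complex_of_real (christoffel G k i j x) *s J x k)
     = H x i j + christoffel_vec M (\<phi> x) (J x i) (J x j)"
proof (rule J_nondegenerate[OF x])
  fix m
  let ?g = "bilin (M (\<phi> x))" and ?d = "\<lambda>i. metric_deriv M (\<phi> x) (J x i)"
  have z: "\<phi> x \<in> B" by (rule \<phi>_B[OF x])
  note sym = M_sym[OF z]
  have "?g (J x m) (\<Sum>k\<in>UNIV. complex_of_real (christoffel G k i j x) *s J x k)
    = of_real (\<Sum>k\<in>UNIV. G x $ m $ k * christoffel G k i j x)"
    by (simp add: bilin_sum_right bilin_scale_right J_def induced[OF x] mult.commute)
  also have "\<dots> = (of_real (partial_deriv i (\<lambda>y. G y $ j $ m) x) + of_real (partial_deriv j (\<lambda>y. G y $ i $ m) x)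
      - of_real (partial_deriv m (\<lambda>y. G y $ i $ j) x)) / 2"
    unfolding christoffel_lower[of G x, OF G_inv[OF x]] by simp
  \<comment> \<open>Six terms contain second derivatives of the embedding. By their symmetry four
    cancel, and the two equal ones left absorb the factor 1/2.\<close>
  also have "\<dots> = (bilin (?d i) (J x j) (J x m) + bilin (?d j) (J x i) (J x m) - bilin (?d m) (J x i) (J x j)) / 2
      + ?g (J x m) (H x i j)"
    unfolding metric_partial_deriv[OF x] H_commute[OF x, of j i] H_commute[OF x, of m] sym[of "H x _ _"]
    by (simp add: field_simps)
  also have "\<dots> = ?g (J x m) (H x i j + christoffel_vec M (\<phi> x) (J x i) (J x j))"
    unfolding bilin_linear bilin_christoffel_vec[of M "\<phi> x", OF M_inv[OF z]] by simp
  finally show "?g (J x m) (\<Sum>k\<in>UNIV. complex_of_real (christoffel G k i j x) *s J x k)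
     = ?g (J x m) (H x i j + christoffel_vec M (\<phi> x) (J x i) (J x j))" .
qed

lemma christoffel_vec_deriv:
  assumes x: "x \<in> A"
  shows "((\<lambda>y. christoffel_vec M (\<phi> y) (J y j) (J y k) $ e) has_derivative
     (\<lambda>h. bilin (christoffel_deriv M (\<phi> x) (frechet_derivative \<phi> (at x) h) e) (J x j) (J x k)
       + christoffel_vec M (\<phi> x) (frechet_derivative (\<lambda>y. J y j) (at x) h) (J x k) $ e
       + christoffel_vec M (\<phi> x) (J x j) (frechet_derivative (\<lambda>y. J y k) (at x) h) $ e)) (at x)"
  unfolding christoffel_vec_def vec_lambda_beta
  by (rule has_derivative_bilin)
     (simp_all add: J_deriv x christoffel_deriv_def christoffel_form_def hol_deriv
       holomorphic_christoffel[OF B M_hol M_inv])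

text \<open>The Gauss formula is solved for the Christoffel symbols: the inverse of the frame matrix
  and the vector on the other side are both differentiable.\<close>

lemma christoffel_differentiable:
  assumes x: "x \<in> A"
  shows "christoffel G k i j differentiable (at x)"
proof -
  let ?V = "\<lambda>y. H y i j + christoffel_vec M (\<phi> y) (J y i) (J y j)"
  have e: "(matrix_inv (frame_matrix (J y)) *v ?V y) $ k = of_real (christoffel G k i j y)" if y: "y \<in> A" for y
  proof -
    have "?V y = frame_matrix (J y) *v (\<chi> k. of_real (christoffel G k i j y))"
      unfolding christoffel_law[OF y, symmetric] frame_comb_eq_mult[symmetric] by (simp add: frame_comb_def)
    then show ?thesis by (simp add: matrix_vector_mul_assoc matrix_inv_left[OF J_frame[OF y]])
  qed
  have "(\<lambda>y. \<Sum>l\<in>UNIV. matrix_inv (frame_matrix (J y)) $ k $ l * (?V y $ l)) differentiable (at x)"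
  proof (intro differentiable_sum finite ballI differentiable_mult)
    fix l
    show "(\<lambda>y. matrix_inv (frame_matrix (J y)) $ k $ l) differentiable (at x)"
      using J_deriv[OF x] unfolding differentiable_def
      by (intro differentiable_matrix_inv[OF A x, unfolded differentiable_def] J_frame) (auto simp: frame_matrix_def)
    have "(\<lambda>y. H y i j $ l) differentiable (at x)"
      using has_derivative_vec_nth[OF has_derivative_if_smooth[OF smooth_H x]] unfolding differentiable_def by blast
    moreover have "(\<lambda>y. christoffel_vec M (\<phi> y) (J y i) (J y j) $ l) differentiable (at x)"
      using christoffel_vec_deriv[OF x] unfolding differentiable_def by blast
    ultimately show "(\<lambda>y. ?V y $ l) differentiable (at x)" by simp
  qed
  then have "(\<lambda>y. (matrix_inv (frame_matrix (J y)) *v ?V y) $ k) differentiable (at x)"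
    by (simp only: matrix_vector_mult_def vec_lambda_beta)
  then obtain D where "((\<lambda>y. (matrix_inv (frame_matrix (J y)) *v ?V y) $ k) has_derivative D) (at x)"
    unfolding differentiable_def by blast
  from has_derivative_of_real_iff(1)[OF A x e this] show ?thesis
    unfolding differentiable_def by blast
qed

lemma christoffel_has_derivative:
  assumes "x \<in> A"
  shows "((\<lambda>y. complex_of_real (christoffel G k i j y)) has_derivative
     (\<lambda>h. of_real (frechet_derivative (christoffel G k i j) (at x) h))) (at x)"
  using christoffel_differentiable[OF assms, unfolded frechet_derivative_works]
  by (rule has_derivative_of_real)

text \<open>The two sides of the Gauss formula agree on all of \<open>A\<close>, so their
  derivatives in the direction \<open>i\<close> agree.\<close>

lemma christoffel_law_derivative:
  assumes x: "x \<in> A"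
  shows "(\<Sum>l\<in>UNIV. of_real (partial_deriv i (christoffel G l j k) x) *s J x l)
      + (\<Sum>l\<in>UNIV. of_real (christoffel G l j k x) *s H x i l)
    = K x i j k + (\<chi> e. bilin (christoffel_deriv M (\<phi> x) (J x i) e) (J x j) (J x k))
      + christoffel_vec M (\<phi> x) (H x i j) (J x k) + christoffel_vec M (\<phi> x) (J x j) (H x i k)"
proof (rule vec_eq_iff[THEN iffD2], rule allI)
  fix e
  let ?L = "\<lambda>y. \<Sum>l\<in>UNIV. complex_of_real (christoffel G l j k y) * J y l $ e"
  let ?R = "\<lambda>y. H y j k $ e + christoffel_vec M (\<phi> y) (J y j) (J y k) $ e"
  have L: "(?L has_derivative (\<lambda>h. \<Sum>l\<in>UNIV. of_real (christoffel G l j k x) * frechet_derivative (\<lambda>y. J y l) (at x) h $ e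
      + of_real (frechet_derivative (christoffel G l j k) (at x) h) * J x l $ e)) (at x)"
    by (rule has_derivative_sum, rule has_derivative_mult[OF christoffel_has_derivative[OF x] J_deriv[OF x]])
  have "(?R has_derivative (\<lambda>h. frechet_derivative (\<lambda>y. H y j k) (at x) h $ e
       + (bilin (christoffel_deriv M (\<phi> x) (frechet_derivative \<phi> (at x) h) e) (J x j) (J x k)
       + christoffel_vec M (\<phi> x) (frechet_derivative (\<lambda>y. J y j) (at x) h) (J x k) $ e
       + christoffel_vec M (\<phi> x) (J x j) (frechet_derivative (\<lambda>y. J y k) (at x) h) $ e))) (at x)"
    by (rule has_derivative_add[OF has_derivative_vec_nth[OF has_derivative_if_smooth[OF smooth_H x]] christoffel_vec_deriv[OF x]])
  moreover have "?R y = ?L y" if "y \<in> A" for y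
  proof -
    have "(\<Sum>l\<in>UNIV. complex_of_real (christoffel G l j k y) *s J y l) $ e
       = (H y j k + christoffel_vec M (\<phi> y) (J y j) (J y k)) $ e"
      by (simp only: christoffel_law[OF that])
    then show ?thesis by simp
  qed
  ultimately have R: "(?L has_derivative (\<lambda>h. frechet_derivative (\<lambda>y. H y j k) (at x) h $ e
       + (bilin (christoffel_deriv M (\<phi> x) (frechet_derivative \<phi> (at x) h) e) (J x j) (J x k)
       + christoffel_vec M (\<phi> x) (frechet_derivative (\<lambda>y. J y j) (at x) h) (J x k) $ e
       + christoffel_vec M (\<phi> x) (J x j) (frechet_derivative (\<lambda>y. J y k) (at x) h) $ e))) (at x)"
    by (rule has_derivative_transform_within_open[OF _ A x])
  from fun_cong[OF has_derivative_unique[OF L R], of "axis i 1"]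
  show "((\<Sum>l\<in>UNIV. of_real (partial_deriv i (christoffel G l j k) x) *s J x l)
      + (\<Sum>l\<in>UNIV. of_real (christoffel G l j k x) *s H x i l)) $ e
    = (K x i j k + (\<chi> e. bilin (christoffel_deriv M (\<phi> x) (J x i) e) (J x j) (J x k))
      + christoffel_vec M (\<phi> x) (H x i j) (J x k) + christoffel_vec M (\<phi> x) (J x j) (H x i k)) $ e"
    by (simp add: partial_deriv_def sum.distrib J_def[symmetric] H_def[symmetric] K_def[symmetric] add_ac)
qed

text \<open>The differentiated Gauss formula is antisymmetrised in \<open>i\<close> and
  \<open>j\<close>. The terms \<open>K x i j k\<close> and \<open>H x i j\<close> are symmetric and
  drop out; the remaining second derivatives are eliminated by the Gauss formula itself, and the
  mixed terms so created cancel in pairs.\<close>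

lemma riemann_law:
  assumes x: "x \<in> A"
  shows "(\<Sum>l\<in>UNIV. complex_of_real (riemann_up G l k i j x) *s J x l)
     = riemann_vec M (\<phi> x) (J x k) (J x i) (J x j)"
proof -
  let ?\<gamma> = "\<lambda>l i j. complex_of_real (christoffel G l i j x)"
  let ?d = "\<lambda>i l j k. complex_of_real (partial_deriv i (christoffel G l j k) x)"
  let ?C = "christoffel_vec M (\<phi> x)"
  let ?D = "\<lambda>i j k. \<chi> e. bilin (christoffel_deriv M (\<phi> x) (J x i) e) (J x j) (J x k)"
  let ?X = "\<lambda>i j k. \<Sum>l\<in>UNIV. ?\<gamma> l j k *s ?C (J x i) (J x l)"
  let ?Y = "\<lambda>i j k. \<Sum>m\<in>UNIV. (\<Sum>l\<in>UNIV. ?\<gamma> m i l * ?\<gamma> l j k) *s J x m"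
  let ?S = "\<lambda>i j k. \<Sum>l\<in>UNIV. ?d i l j k *s J x l"
  have h: "H x i j = (\<Sum>l\<in>UNIV. ?\<gamma> l i j *s J x l) - ?C (J x i) (J x j)" for i j
    using christoffel_law[OF x, of i j] by simp
  have 1: "(\<Sum>l\<in>UNIV. ?\<gamma> l j k *s H x i l) = ?Y i j k - ?X i j k" for i j k
  proof -
    have "(\<Sum>l\<in>UNIV. ?\<gamma> l j k *s H x i l) = (\<Sum>l\<in>UNIV. ?\<gamma> l j k *s (\<Sum>m\<in>UNIV. ?\<gamma> m i l *s J x m)) - ?X i j k"
      unfolding h by (simp add: vec_eq_iff right_diff_distrib sum_subtractf)
    also have "(\<Sum>l\<in>UNIV. ?\<gamma> l j k *s (\<Sum>m\<in>UNIV. ?\<gamma> m i l *s J x m)) = ?Y i j k"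
      by (simp add: vec_eq_iff sum_distrib_left sum_distrib_right mult_ac)
        (intro allI, subst sum.swap, simp only: mult_ac)
    finally show ?thesis .
  qed
  have 2: "?C (J x j) (H x i k) = ?X j i k - ?C (J x j) (?C (J x i) (J x k))" for i j k
  proof -
    have "?C (J x j) (H x i k) + ?C (J x j) (?C (J x i) (J x k))
       = ?C (J x j) (\<Sum>l\<in>UNIV. ?\<gamma> l i k *s J x l)"
      unfolding christoffel_vec_linear(1)[symmetric] christoffel_law[OF x] ..
    then show ?thesis unfolding christoffel_vec_linear by (simp add: eq_diff_eq)
  qed
  have e: "?S i j k + (?Y i j k - ?X i j k) = K x i j k + ?D i j k + ?C (H x i j) (J x k)
      + (?X j i k - ?C (J x j) (?C (J x i) (J x k)))" for i j k
    using christoffel_law_derivative[OF x, of i j k] unfolding 1 2 .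
  \<comment> \<open>Here \<open>k\<close> and \<open>c\<close> stand for the symmetric terms, and
    \<open>x1\<close>, \<open>x2\<close> for the mixed terms, which trade places when
    \<open>i\<close> and \<open>j\<close> are exchanged.\<close>
  have cancel: "s1 - s2 + (y1 - y2) = d1 - d2 + (w2 - w1)"
    if 1: "s1 + (y1 - x1) = k + d1 + c + (x2 - w1)" and 2: "s2 + (y2 - x2) = k + d2 + c + (x1 - w2)"
    for s1 s2 y1 y2 x1 x2 d1 d2 w1 w2 k c :: "complex^'n"
  proof -
    have "s1 = k + d1 + c + (x2 - w1) - (y1 - x1)" "s2 = k + d2 + c + (x1 - w2) - (y2 - x2)"
      using 1 2 by (simp_all add: eq_diff_eq)
    then show ?thesis by simp
  qed
  have "?S i j k - ?S j i k + (?Y i j k - ?Y j i k) = ?D i j k - ?D j i k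
      + (?C (J x i) (?C (J x j) (J x k)) - ?C (J x j) (?C (J x i) (J x k)))"
    by (rule cancel[OF e[of i j k]])
       (use e[of j i k] in \<open>simp only: K_commute[OF x, of j i k] H_commute[OF x, of j i]\<close>)
  also have "\<dots> = riemann_vec M (\<phi> x) (J x k) (J x i) (J x j)"
    by (simp add: vec_eq_iff riemann_vec_def)
  also have "?S i j k - ?S j i k + (?Y i j k - ?Y j i k)
     = (\<Sum>l\<in>UNIV. complex_of_real (riemann_up G l k i j x) *s J x l)"
    by (simp add: vec_eq_iff riemann_up_def ring_distribs sum.distrib sum_subtractf)
  finally show ?thesis .
qed

text \<open>The pull-back relation is demanded on the whole open set, not at one point, so that it
  can be differentiated.\<close>

definition related :: "nat \<Rightarrow> (real^'n \<Rightarrow> 'n list \<Rightarrow> real) \<Rightarrow> (complex^'n \<Rightarrow> 'n list \<Rightarrow> complex) \<Rightarrow> bool" where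
  "related r T T' \<longleftrightarrow> (\<forall>x\<in>A. \<forall>js. length js = r \<longrightarrow> complex_of_real (T x js) = pull (J x) (T' (\<phi> x)) js)"

lemma related_riemann: "related 4 (riemann G) (riemann M)"
  unfolding related_def
proof (intro ballI allI impI)
  fix x and js :: "'n list" assume x: "x \<in> A" and "length js = 4"
  then obtain m k i j where js: "js = [m, k, i, j]"
    by (auto simp: numeral_eq_Suc length_Suc_conv)
  let ?t = "\<lambda>a b c d e. M (\<phi> x) $ a $ e * (J x k $ b * (J x i $ c * (J x j $ d * riemann_up M e b c d (\<phi> x))))"
  have "pull (J x) (riemann M (\<phi> x)) js = (\<Sum>a\<in>UNIV. J x m $ a * (\<Sum>b\<in>UNIV. J x k $ b * (\<Sum>c\<in>UNIV. J x i $ c *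
      (\<Sum>d\<in>UNIV. J x j $ d * (\<Sum>e\<in>UNIV. M (\<phi> x) $ a $ e * riemann_up M e b c d (\<phi> x))))))"
    by (simp add: pull_def js riemann_def)
  also have "\<dots> = (\<Sum>a\<in>UNIV. \<Sum>e\<in>UNIV. M (\<phi> x) $ a $ e * J x m $ a *
      (\<Sum>b\<in>UNIV. \<Sum>c\<in>UNIV. \<Sum>d\<in>UNIV. J x k $ b * (J x i $ c * (J x j $ d * riemann_up M e b c d (\<phi> x)))))"
  proof (rule sum.cong[OF refl])
    fix a
    have "(\<Sum>b\<in>UNIV. J x k $ b * (\<Sum>c\<in>UNIV. J x i $ c *
      (\<Sum>d\<in>UNIV. J x j $ d * (\<Sum>e\<in>UNIV. M (\<phi> x) $ a $ e * riemann_up M e b c d (\<phi> x)))))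
      = (\<Sum>b\<in>UNIV. \<Sum>c\<in>UNIV. \<Sum>d\<in>UNIV. \<Sum>e\<in>UNIV. ?t a b c d e)"
      by (simp only: sum_distrib_left mult_ac)
    also have "\<dots> = (\<Sum>b\<in>UNIV. \<Sum>c\<in>UNIV. \<Sum>e\<in>UNIV. \<Sum>d\<in>UNIV. ?t a b c d e)"
      by (intro sum.cong refl sum.swap)
    also have "\<dots> = (\<Sum>b\<in>UNIV. \<Sum>e\<in>UNIV. \<Sum>c\<in>UNIV. \<Sum>d\<in>UNIV. ?t a b c d e)"
      by (intro sum.cong refl sum.swap)
    also have "\<dots> = (\<Sum>e\<in>UNIV. \<Sum>b\<in>UNIV. \<Sum>c\<in>UNIV. \<Sum>d\<in>UNIV. ?t a b c d e)"
      by (rule sum.swap)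
    finally show "J x m $ a * (\<Sum>b\<in>UNIV. J x k $ b * (\<Sum>c\<in>UNIV. J x i $ c *
      (\<Sum>d\<in>UNIV. J x j $ d * (\<Sum>e\<in>UNIV. M (\<phi> x) $ a $ e * riemann_up M e b c d (\<phi> x)))))
      = (\<Sum>e\<in>UNIV. M (\<phi> x) $ a $ e * J x m $ a *
      (\<Sum>b\<in>UNIV. \<Sum>c\<in>UNIV. \<Sum>d\<in>UNIV. J x k $ b * (J x i $ c * (J x j $ d * riemann_up M e b c d (\<phi> x)))))"
      by (simp only: sum_distrib_left mult_ac)
  qed
  also have "\<dots> = bilin (M (\<phi> x)) (J x m) (riemann_vec M (\<phi> x) (J x k) (J x i) (J x j))"
    unfolding bilin_def riemann_vec_eq_sum ..
  also have "\<dots> = (\<Sum>l\<in>UNIV. of_real (riemann_up G l k i j x) * of_real (G x $ m $ l))"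
    unfolding riemann_law[OF x, symmetric] bilin_sum_right bilin_scale_right
    using induced[OF x] by (simp add: J_def)
  also have "\<dots> = of_real (riemann G x js)"
    by (simp add: js riemann_def mult.commute)
  finally show "complex_of_real (riemann G x js) = pull (J x) (riemann M (\<phi> x)) js" ..
qed

lemma related_contract:
  assumes T: "related r T T'" and pq: "p < q" "q < r"
  shows "related (r - 2) (\<lambda>x. contract (G x) p q (T x)) (\<lambda>z. contract (M z) p q (T' z))"
  unfolding related_def
proof (intro ballI allI impI)
  fix x and js :: "'n list" assume x: "x \<in> A" and js: "length js = r - 2"
  have "complex_of_real (contract (G x) p q (T x) js) = contract (cmat (G x)) p q (cten (T x)) js"
    by (simp add: contract_cten[OF G_inv[OF x]])
  also have "\<dots> = contract (pullm (J x) (M (\<phi> x))) p q (pull (J x) (T' (\<phi> x))) js"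
    unfolding pullm_J[OF x]
    using T x js pq by (intro contract_cong) (auto simp: related_def cten_def)
  also have "\<dots> = pull (J x) (contract (M (\<phi> x)) p q (T' (\<phi> x))) js"
    using js pq by (intro contract_pull M_inv \<phi>_B x J_frame) auto
  finally show "complex_of_real (contract (G x) p q (T x) js) = pull (J x) (contract (M (\<phi> x)) p q (T' (\<phi> x))) js" .
qed

lemma related_trace_poly:
  assumes T: "related r T T'"
  shows "related r (\<lambda>x. trace_poly (G x) r cs (T x)) (\<lambda>z. trace_poly (M z) r cs (T' z))"
  unfolding related_def
proof (intro ballI allI impI)
  fix x and js :: "'n list" assume x: "x \<in> A" and js: "length js = r"
  have "complex_of_real (trace_poly (G x) r cs (T x) js) = trace_poly (cmat (G x)) r cs (cten (T x)) js"
    by (simp add: trace_poly_cten[OF G_inv[OF x]])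
  also have "\<dots> = trace_poly (pullm (J x) (M (\<phi> x))) r cs (pull (J x) (T' (\<phi> x))) js"
    unfolding pullm_J[OF x]
    using T x js by (intro trace_poly_cong) (auto simp: related_def cten_def)
  also have "\<dots> = pull (J x) (trace_poly (M (\<phi> x)) r cs (T' (\<phi> x))) js"
    using js by (intro trace_poly_pull M_inv \<phi>_B x J_frame)
  finally show "complex_of_real (trace_poly (G x) r cs (T x) js) = pull (J x) (trace_poly (M (\<phi> x)) r cs (T' (\<phi> x))) js" .
qed

text \<open>Differentiating the pull-back produces a term with second derivatives \<open>H\<close>
  of the embedding in each slot. By the Gauss formula the Christoffel symbols of the slice produce
  the same terms together with the ambient Christoffel corrections, so exactly the latter
  survive.\<close>

lemma related_cov_deriv:
  assumes T: "related r T T'" and hol: "\<And>js. holomorphic_several_on B (\<lambda>z. T' z js)"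
  shows "related (Suc r) (cov_deriv G T) (cov_deriv M T')"
  unfolding related_def
proof (intro ballI allI impI)
  fix x and js' :: "'n list" assume x: "x \<in> A" and "length js' = Suc r"
  then obtain i js where js': "js' = i # js" and js: "length js = r" by (auto simp: length_Suc_conv)
  let ?vs = "map (J x) js" and ?C = "christoffel_vec M (\<phi> x)" and ?T = "T' (\<phi> x)"
  let ?dT = "\<lambda>u ks. \<Sum>a\<in>UNIV. u $ a * partial_deriv a (\<lambda>z. T' z ks) (\<phi> x)"
  let ?u = "\<lambda>ks p c a. J x i $ a * christoffel M c a (ks ! p) (\<phi> x) * ?T (ks[p := c])"
  have T_eq: "complex_of_real (T y ks) = teval (map (J y) ks) (T' (\<phi> y))" if "y \<in> A" "length ks = r" for y ks
    using T that unfolding related_def pull_def by blast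
  have "((\<lambda>y. teval (map (J y) js) (T' (\<phi> y))) has_derivative
     (\<lambda>h. teval ?vs (?dT (frechet_derivative \<phi> (at x) h)) +
       (\<Sum>p<length js. teval (?vs[p := frechet_derivative (\<lambda>y. J y (js ! p)) (at x) h]) ?T))) (at x)"
    by (rule has_derivative_teval[where J' = "\<lambda>j. frechet_derivative (\<lambda>y. J y j) (at x)"])
       (rule J_deriv[OF x], rule hol_deriv[OF x hol])
  from has_derivative_of_real_iff(2)[OF A x _ this, of "\<lambda>y. T y js" "axis i 1"]
  have pd: "complex_of_real (partial_deriv i (\<lambda>y. T y js) x)
     = teval ?vs (?dT (J x i)) + (\<Sum>p<length js. teval (?vs[p := H x i (js ! p)]) ?T)"
    using T_eq js unfolding partial_deriv_def J_def[symmetric] H_def[symmetric] by simp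
  \<comment> \<open>The Gauss formula inside slot \<open>p\<close>: the summand with
    \<open>H\<close> is the one that differentiation of the frame contributes in this slot.\<close>
  have ch: "(\<Sum>c\<in>UNIV. complex_of_real (christoffel G c i (js ! p) x * T x (js[p := c])))
     = teval (?vs[p := H x i (js ! p)]) ?T + teval (?vs[p := ?C (J x i) (J x (js ! p))]) ?T"
    if p: "p < length js" for p
  proof -
    have up: "?vs[p := u] = take p ?vs @ u # drop (Suc p) ?vs" for u
      using p by (simp add: upd_conv_take_nth_drop)
    have "(\<Sum>c\<in>UNIV. complex_of_real (christoffel G c i (js ! p) x * T x (js[p := c])))
       = (\<Sum>c\<in>UNIV. of_real (christoffel G c i (js ! p) x) * teval (?vs[p := J x c]) ?T)"
      using js x by (intro sum.cong refl) (simp add: T_eq map_update)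
    also have "\<dots> = teval (?vs[p := \<Sum>c\<in>UNIV. of_real (christoffel G c i (js ! p) x) *s J x c]) ?T"
      unfolding up by (simp only: teval_slot_sum teval_slot_scale)
    finally show ?thesis unfolding christoffel_law[OF x] up teval_slot_add .
  qed
  have "complex_of_real (cov_deriv G T x js') = teval ?vs (?dT (J x i))
     + (\<Sum>p<length js. teval (?vs[p := H x i (js ! p)]) ?T)
     - (\<Sum>p<length js. \<Sum>c\<in>UNIV. complex_of_real (christoffel G c i (js ! p) x * T x (js[p := c])))"
    by (simp add: cov_deriv_def js' pd)
  also have "\<dots> = teval ?vs (?dT (J x i)) - (\<Sum>p<length js. teval (?vs[p := ?C (J x i) (J x (js ! p))]) ?T)"
    using ch by (simp add: sum.distrib)
  also have "\<dots> = pull (J x) (cov_deriv M T' (\<phi> x)) js'"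
  proof -
    have "pull (J x) (cov_deriv M T' (\<phi> x)) js'
      = (\<Sum>a\<in>UNIV. J x i $ a * teval ?vs (\<lambda>ks. partial_deriv a (\<lambda>z. T' z ks) (\<phi> x)
         - (\<Sum>p<length js. \<Sum>c\<in>UNIV. christoffel M c a (ks ! p) (\<phi> x) * ?T (ks[p := c]))))"
      unfolding pull_def js' list.map teval.simps
      by (intro sum.cong refl arg_cong[of _ _ "(*) _"] teval_cong) (simp add: cov_deriv_def)
    also have "\<dots> = teval ?vs (?dT (J x i)) - teval ?vs (\<lambda>ks. \<Sum>p<length js. \<Sum>c\<in>UNIV.
         (\<Sum>a\<in>UNIV. J x i $ a * christoffel M c a (ks ! p) (\<phi> x)) * ?T (ks[p := c]))"
    proof -
      have "(\<Sum>a\<in>UNIV. J x i $ a * (\<Sum>p<length js. \<Sum>c\<in>UNIV. christoffel M c a (ks ! p) (\<phi> x) * ?T (ks[p := c])))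
        = (\<Sum>p<length js. \<Sum>c\<in>UNIV. (\<Sum>a\<in>UNIV. J x i $ a * christoffel M c a (ks ! p) (\<phi> x)) * ?T (ks[p := c]))" for ks
      proof -
        have "(\<Sum>a\<in>UNIV. J x i $ a * (\<Sum>p<length js. \<Sum>c\<in>UNIV. christoffel M c a (ks ! p) (\<phi> x) * ?T (ks[p := c])))
          = (\<Sum>a\<in>UNIV. \<Sum>p<length js. \<Sum>c\<in>UNIV. ?u ks p c a)"
          by (simp only: sum_distrib_left mult.assoc)
        also have "\<dots> = (\<Sum>p<length js. \<Sum>a\<in>UNIV. \<Sum>c\<in>UNIV. ?u ks p c a)"
          by (rule sum.swap)
        also have "\<dots> = (\<Sum>p<length js. \<Sum>c\<in>UNIV. \<Sum>a\<in>UNIV. ?u ks p c a)"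
          by (intro sum.cong refl sum.swap)
        finally show ?thesis by (simp only: sum_distrib_right)
      qed
      then show ?thesis
        unfolding teval_mult[symmetric] teval_sum[symmetric] teval_diff[symmetric] right_diff_distrib sum_subtractf
        by simp
    qed
    also have "teval ?vs (\<lambda>ks. \<Sum>p<length js. \<Sum>c\<in>UNIV. (\<Sum>a\<in>UNIV. J x i $ a * christoffel M c a (ks ! p) (\<phi> x)) * ?T (ks[p := c]))
       = (\<Sum>p<length js. teval (?vs[p := ?C (J x i) (J x (js ! p))]) ?T)"
      unfolding teval_sum[of _ _ "{..<length js}"]
    proof (rule sum.cong[OF refl])
      fix p assume "p \<in> {..<length js}"
      then have p: "p < length js" by simp
      have "teval ?vs (\<lambda>ks. \<Sum>c\<in>UNIV. (\<Sum>a\<in>UNIV. J x i $ a * christoffel M c a (ks ! p) (\<phi> x)) * ?T (ks[p := c]))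
        = teval (?vs[p := \<chi> c. \<Sum>b\<in>UNIV. (\<Sum>a\<in>UNIV. J x i $ a * christoffel M c a b (\<phi> x)) * ?vs ! p $ b]) ?T"
        using p by (intro teval_update[where g = "\<lambda>c b. \<Sum>a\<in>UNIV. J x i $ a * christoffel M c a b (\<phi> x)"]) simp
      also have "(\<chi> c. \<Sum>b\<in>UNIV. (\<Sum>a\<in>UNIV. J x i $ a * christoffel M c a b (\<phi> x)) * ?vs ! p $ b) = ?C (J x i) (J x (js ! p))"
        unfolding vec_eq_iff
      proof
        fix c
        have "(\<Sum>b\<in>UNIV. (\<Sum>a\<in>UNIV. J x i $ a * christoffel M c a b (\<phi> x)) * ?vs ! p $ b)
           = (\<Sum>b\<in>UNIV. \<Sum>a\<in>UNIV. christoffel M c a b (\<phi> x) * J x i $ a * J x (js ! p) $ b)"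
          unfolding sum_distrib_right using p by (simp add: mult_ac)
        also have "\<dots> = (\<Sum>a\<in>UNIV. \<Sum>b\<in>UNIV. christoffel M c a b (\<phi> x) * J x i $ a * J x (js ! p) $ b)"
          by (rule sum.swap)
        finally show "(\<chi> c. \<Sum>b\<in>UNIV. (\<Sum>a\<in>UNIV. J x i $ a * christoffel M c a b (\<phi> x)) * ?vs ! p $ b) $ c
           = ?C (J x i) (J x (js ! p)) $ c"
          by (simp add: christoffel_vec_def christoffel_form_def bilin_def)
      qed
      finally show "teval ?vs (\<lambda>ks. \<Sum>c\<in>UNIV. (\<Sum>a\<in>UNIV. J x i $ a * christoffel M c a (ks ! p) (\<phi> x)) * ?T (ks[p := c]))
        = teval (?vs[p := ?C (J x i) (J x (js ! p))]) ?T" .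
    qed
    finally show ?thesis ..
  qed
  finally show "complex_of_real (cov_deriv G T x js') = pull (J x) (cov_deriv M T' (\<phi> x)) js'" .
qed

lemma related_expr_tensor:
  "expr_ok e \<Longrightarrow> related (expr_rank e) (expr_tensor e G) (expr_tensor e M)"
proof (induction e)
  case Riemann
  show ?case using related_riemann by simp
next
  case (Contraction p q e)
  then show ?case by (simp add: related_contract)
next
  case (Trace_Poly cs e)
  then show ?case by (simp add: related_trace_poly)
next
  case (Covariant e)
  then show ?case by (simp add: related_cov_deriv holomorphic_expr_tensor[OF B M_hol M_inv])
qed

end

section \<open>Charts\<close>

lemma invertible_if_nondegenerate:
  fixes G :: "'k::field^'n::finite^'n"
  assumes sym: "\<And>u v. bilin G u v = bilin G v u" and nd: "\<And>u. (\<And>v. bilin G u v = 0) \<Longrightarrow> u = 0"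
  shows "invertible G"
proof -
  have "u = 0" if "G *v u = 0" for u
  proof (rule nd)
    fix v
    have "bilin G u v = bilin G v u" by (rule sym)
    also have "\<dots> = 0" using that by (simp add: bilin_eq_mult)
    finally show "bilin G u v = 0" .
  qed
  then have "\<exists>B. B ** G = mat 1" unfolding matrix_left_invertible_ker by blast
  then show ?thesis by (simp add: invertible_left_inverse)
qed

lemma embedding_map_imp_continuous_map: "embedding_map X Y f \<Longrightarrow> continuous_map X Y f"
  unfolding embedding_map_def using homeomorphic_imp_continuous_map continuous_map_in_subtopology by blast

lemma is_chartD:
  assumes "is_chart X c"
  shows "fst c \<subseteq> topspace X" "open (snd c ` fst c)" "inj_on (snd c) (fst c)"
    and "\<And>S. openin X S \<Longrightarrow> S \<subseteq> fst c \<Longrightarrow> open (snd c ` S)"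
proof -
  have c: "openin X (fst c)" "open (snd c ` fst c)"
    "homeomorphic_map (subtopology X (fst c)) (top_of_set (snd c ` fst c)) (snd c)"
    using assms by (auto simp: is_chart_def)
  show sub: "fst c \<subseteq> topspace X" using c(1) by (rule openin_subset)
  show "open (snd c ` fst c)" by (rule c(2))
  have "topspace (subtopology X (fst c)) = fst c" using sub by auto
  then show "inj_on (snd c) (fst c)" using homeomorphic_imp_injective_map[OF c(3)] by simp
  fix S assume S: "openin X S" "S \<subseteq> fst c"
  then have "openin (subtopology X (fst c)) S" by (simp add: openin_open_subtopology[OF c(1)])
  then have "openin (top_of_set (snd c ` fst c)) (snd c ` S)"
    using homeomorphic_imp_open_map[OF c(3)] unfolding open_map_def by blast
  then show "open (snd c ` S)" using c(2) openin_open_eq by blast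
qed

lemma chart_rep_apply:
  assumes "is_chart X c" "p \<in> fst c"
  shows "chart_rep c d f (snd c p) = snd d (f p)"
  using assms by (simp add: chart_rep_def is_chartD(3))

lemma is_metric_manifoldD:
  assumes "is_metric_manifold reg M" "c \<in> charts M"
  shows "is_chart (points M) c"
    and "\<And>i j. reg (snd c ` fst c) (\<lambda>x. metric M c x $ i $ j)"
    and "\<And>x u v. x \<in> snd c ` fst c \<Longrightarrow> bilin (metric M c x) u v = bilin (metric M c x) v u"
    and "\<And>x. x \<in> snd c ` fst c \<Longrightarrow> invertible (metric M c x)"
proof -
  have 1: "\<forall>c\<in>charts M. is_chart (points M) c"
    and 2: "\<forall>c\<in>charts M. \<forall>i j. reg (snd c ` fst c) (\<lambda>x. metric M c x $ i $ j)"
    and 3: "\<forall>c\<in>charts M. \<forall>x\<in>snd c ` fst c.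
        (\<forall>u v. bilin (metric M c x) u v = bilin (metric M c x) v u) \<and>
        (\<forall>u. (\<forall>v. bilin (metric M c x) u v = 0) \<longrightarrow> u = 0)"
    using assms(1) unfolding is_metric_manifold_def by - (elim conjE, assumption)+
  show "is_chart (points M) c" by (rule bspec[OF 1 assms(2)])
  show "reg (snd c ` fst c) (\<lambda>x. metric M c x $ i $ j)" for i j
    using bspec[OF 2 assms(2)] by (elim allE)
  fix x assume x: "x \<in> snd c ` fst c"
  have *: "(\<forall>u v. bilin (metric M c x) u v = bilin (metric M c x) v u) \<and>
        (\<forall>u. (\<forall>v. bilin (metric M c x) u v = 0) \<longrightarrow> u = 0)"
    by (rule bspec[OF bspec[OF 3 assms(2)] x])
  then show "bilin (metric M c x) u v = bilin (metric M c x) v u" for u v by blast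
  show "invertible (metric M c x)" using * by (intro invertible_if_nondegenerate) blast+
qed

lemma is_metric_manifold_covered:
  assumes "is_metric_manifold reg M" "p \<in> topspace (points M)"
  obtains c where "c \<in> charts M" "p \<in> fst c"
proof -
  have "(\<Union>c\<in>charts M. fst c) = topspace (points M)"
    using assms(1) unfolding is_metric_manifold_def by - (elim conjE, assumption)
  then show thesis using assms(2) that by blast
qed

lemma slice_chart_real_slice:
  assumes M: "holomorphic_riemannian M" and N: "pseudo_riemannian N" and slice: "real_slice N M f"
    and c: "c \<in> charts N" and d: "d \<in> charts M"
  shows "slice_chart (chart_rep c d f) (chart_rep_dom c d f) (snd d ` fst d) (metric N c) (metric M d)"
proof
  note cN = is_metric_manifoldD[OF N[unfolded pseudo_riemannian_def] c]
  note dM = is_metric_manifoldD[OF M[unfolded holomorphic_riemannian_def] d]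
  have emb: "smooth_embedding N M f" using slice by (simp add: real_slice_def)
  have cont: "continuous_map (points N) (points M) f"
    using emb by (auto simp: smooth_embedding_def embedding_map_imp_continuous_map)
  have sub: "chart_rep_dom c d f \<subseteq> snd c ` fst c" by (auto simp: chart_rep_dom_def)
  show "open (chart_rep_dom c d f)"
    unfolding chart_rep_dom_def
  proof (rule is_chartD(4)[OF cN(1)])
    have "openin (points N) {x \<in> topspace (points N). f x \<in> fst d}"
      using cont dM(1) by (intro openin_continuous_map_preimage) (auto simp: is_chart_def)
    moreover have "openin (points N) (fst c)" using cN(1) by (simp add: is_chart_def)
    ultimately have "openin (points N) (fst c \<inter> {x \<in> topspace (points N). f x \<in> fst d})" by blast
    moreover have "fst c \<inter> {x \<in> topspace (points N). f x \<in> fst d} = fst c \<inter> f -` fst d"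
      using is_chartD(1)[OF cN(1)] by auto
    ultimately show "openin (points N) (fst c \<inter> f -` fst d)" by simp
  qed simp
  show "open (snd d ` fst d)" by (rule is_chartD(2)[OF dM(1)])
  show "chart_rep c d f x \<in> snd d ` fst d" if "x \<in> chart_rep_dom c d f" for x
    using that by (auto simp: chart_rep_dom_def chart_rep_apply[OF cN(1)])
  show "smooth_on (chart_rep_dom c d f) (chart_rep c d f)"
    using emb c d by (simp add: smooth_embedding_def)
  show "holomorphic_several_on (snd d ` fst d) (\<lambda>z. metric M d z $ i $ j)" for i j by (rule dM(2))
  show "bilin (metric M d z) u v = bilin (metric M d z) v u" if "z \<in> snd d ` fst d" for z u v
    using that by (rule dM(3))
  show "invertible (metric M d z)" if "z \<in> snd d ` fst d" for z using that by (rule dM(4))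
  show "invertible (metric N c x)" if "x \<in> chart_rep_dom c d f" for x using that sub by (intro cN(4)) blast
  show "bilin (metric M d (chart_rep c d f x)) (frechet_derivative (chart_rep c d f) (at x) (axis i 1))
      (frechet_derivative (chart_rep c d f) (at x) (axis j 1)) = of_real (metric N c x $ i $ j)"
    if "x \<in> chart_rep_dom c d f" for x i j
    using slice c d that by (simp add: real_slice_def Let_def bilin_axis)
qed

section \<open>Both slices at the common point\<close>

theorem theorem6p1:
  fixes P :: "('p, real, 'n::finite) metric_manifold" and m :: 'p
  assumes "lorentzian P"
    and "m \<in> topspace (points P)"
    and "some_curvature_tensor_at P m
           (\<lambda>G r T. proper_type_II G r T \<or> proper_type_III G r T \<or> proper_type_N G r T)"
  shows "\<not> (\<exists>(M :: ('z, complex, 'n) metric_manifold) (Q :: ('q, real, 'n) metric_manifold).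
           riemannian Q \<and> wick_rotated M P m Q)"
proof
  assume "\<exists>(M :: ('z, complex, 'n) metric_manifold) (Q :: ('q, real, 'n) metric_manifold).
           riemannian Q \<and> wick_rotated M P m Q"
  then obtain M :: "('z, complex, 'n) metric_manifold" and Q :: "('q, real, 'n) metric_manifold"
    where Q: "riemannian Q" and W: "wick_rotated M P m Q" by blast
  from W obtain f h where M: "holomorphic_riemannian M" and P: "pseudo_riemannian P" and Q': "pseudo_riemannian Q"
    and f: "real_slice P M f" and h: "real_slice Q M h" and meet: "f m \<in> h ` topspace (points Q)"
    by (auto simp: wick_rotated_def)
  from meet obtain q where q: "q \<in> topspace (points Q)" "f m = h q" by blast
  from assms(3) obtain c r T where c: "c \<in> charts P" "m \<in> fst c"
    and T: "curvature_tensor (snd c ` fst c) (metric P c) r T"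
    and proper: "proper_type_II (metric P c (snd c m)) r (T (snd c m)) \<or>
      proper_type_III (metric P c (snd c m)) r (T (snd c m)) \<or> proper_type_N (metric P c (snd c m)) r (T (snd c m))"
    by (auto simp: some_curvature_tensor_at_def)
  have "continuous_map (points P) (points M) f"
    using f by (auto simp: real_slice_def smooth_embedding_def embedding_map_imp_continuous_map)
  then have fm: "f m \<in> topspace (points M)" using assms(2) by (auto simp: continuous_map_def)
  \<comment> \<open>A single ambient chart serves both slices, so that literally the same complex
    components are pulled back to P and to Q.\<close>
  obtain d where d: "d \<in> charts M" "f m \<in> fst d"
    by (rule is_metric_manifold_covered[OF M[unfolded holomorphic_riemannian_def] fm])
  obtain e where e: "e \<in> charts Q" "q \<in> fst e"
    by (rule is_metric_manifold_covered[OF Q'[unfolded pseudo_riemannian_def] q(1)])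
  note cP = is_metric_manifoldD[OF P[unfolded pseudo_riemannian_def] c(1)]
  note eQ = is_metric_manifoldD[OF Q'[unfolded pseudo_riemannian_def] e(1)]
  interpret p: slice_chart "chart_rep c d f" "chart_rep_dom c d f" "snd d ` fst d" "metric P c" "metric M d"
    by (rule slice_chart_real_slice[OF M P f c(1) d(1)])
  interpret q: slice_chart "chart_rep e d h" "chart_rep_dom e d h" "snd d ` fst d" "metric Q e" "metric M d"
    by (rule slice_chart_real_slice[OF M Q' h e(1) d(1)])
  define x where "x = snd c m"
  define y where "y = snd e q"
  define z where "z = snd d (f m)"
  have x: "x \<in> chart_rep_dom c d f" "chart_rep c d f x = z"
    using c d by (simp_all add: x_def z_def chart_rep_dom_def chart_rep_apply[OF cP(1)])
  have y: "y \<in> chart_rep_dom e d h" "chart_rep e d h y = z"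
    using e d by (simp_all add: y_def z_def chart_rep_dom_def chart_rep_apply[OF eQ(1)] q(2)[symmetric])
  have x': "x \<in> snd c ` fst c" and y': "y \<in> snd e ` fst e" using c e by (auto simp: x_def y_def)
  \<comment> \<open>The recipe is read off from the Lorentzian side, where
    \<open>trace_free_projection\<close> is known to be a polynomial, and is then evaluated for the
    metrics of M and Q.\<close>
  obtain E where E: "expr_ok E" "expr_rank E = r"
    "\<And>x js. x \<in> snd c ` fst c \<Longrightarrow> length js = r \<Longrightarrow> T x js = expr_tensor E (metric P c) x js"
    using curvature_tensor_expr[OF T _ is_chartD(2)[OF cP(1)]] assms(1) c(1) unfolding lorentzian_def by blast
  define T' where "T' = expr_tensor E (metric M d) z"
  have TP: "cten (T x) js = pull (p.J x) T' js" if "length js = r" for js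
    using p.related_expr_tensor[OF E(1), unfolded p.related_def E(2), rule_format, OF x(1) that]
    by (simp add: cten_def T'_def E(3)[OF x' that] x(2))
  have TQ: "pull (q.J y) T' js \<in> \<real>" if "length js = r" for js
    using q.related_expr_tensor[OF E(1), unfolded q.related_def E(2), rule_format, OF y(1) that]
    unfolding T'_def y(2) by (metis Reals_of_real)
  \<comment> \<open>The tangent vectors of Q written in the complex frame given by the tangent
    vectors of P. In these coordinates the ambient metric is the complexified metric of P.\<close>
  define L where "L i = matrix_inv (frame_matrix (p.J x)) *v q.J y i" for i
  have L: "frame_comb (p.J x) (L i) = q.J y i" for i
    by (simp add: L_def frame_comb_eq_mult matrix_vector_mul_assoc matrix_inv_right[OF p.J_frame[OF x(1)]])
  have gram: "bilin (cmat (metric P c x)) (L i) (L j) = of_real (metric Q e y $ i $ j)" for i j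
  proof -
    have "bilin (cmat (metric P c x)) (L i) (L j) = bilin (metric M d z) (q.J y i) (q.J y j)"
      unfolding p.pullm_J[OF x(1), symmetric] x(2) bilin_frame_comb[symmetric] L ..
    also have "\<dots> = of_real (metric Q e y $ i $ j)"
      using q.induced[OF y(1)] by (simp add: q.J_def y(2))
    finally show ?thesis .
  qed
  have "\<not> (proper_type_II (metric P c x) r (T x) \<or> proper_type_III (metric P c x) r (T x)
      \<or> proper_type_N (metric P c x) r (T x))"
  proof (rule not_proper_type[OF cP(3)[OF x'] gram])
    show "bilin (metric Q e y) u u > 0" if "u \<noteq> 0" for u
      using Q e(1) y' that by (auto simp: riemannian_def)
    show "invertible (frame_matrix L)"
    proof (rule invertible_frame_matrix[of _ "cmat (metric P c x)"])
      have "pullm L (cmat (metric P c x)) = cmat (metric Q e y)"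
        by (simp add: vec_eq_iff pullm_def gram) (simp add: cmat_def)
      then show "invertible (pullm L (cmat (metric P c x)))"
        by (simp add: matrix_inv_cmat(1)[OF eQ(4)[OF y']])
    qed
    \<comment> \<open>Evaluating the complexified tensor of P on \<open>L\<close> is evaluating the
      ambient tensor on tangent vectors of Q, and these values are components of a real tensor of
      Q.\<close>
    show "teval (map L js) (cten (T x)) \<in> \<real>" if "length js = r" for js
    proof -
      have "teval (map L js) (cten (T x)) = teval (map L js) (pull (p.J x) T')"
        using that by (intro teval_cong TP) simp
      also have "\<dots> = pull (q.J y) T' js"
        by (simp add: teval_pull pull_def comp_def L)
      finally show ?thesis using TQ[OF that] by simp
    qed
  qed
  then show False using proper by (simp add: x_def)
qed

end
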